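(* Let $0<\beta<\gamma<1$ and $T>0$ be given. For $p\ge1$, the convolution mapping $f\mapsto P^D\star f$ is continuous from $L_\infty\left(0,T;H_p^{\gamma}(0,\pi)\right)$ to $L_\infty\left(0,T;H_p^{2+\beta}(0,\pi)\right)$. In particular, $$\|P^D\star f\|_{L_\infty\left(0,T;H_p^{2+\beta}(0,\pi)\right)}\le C\,T^{(\gamma-\beta)/2}\,\|f\|_{L_\infty\left(0,T;H_p^{\gamma}(0,\pi)\right)}$$ for some constant $C>0$ depending only on $\beta$ and $\gamma$.
   Context: Dirichlet heat kernel on $(0,\pi)$: $P^D(t,x,y)=\sum_{k=1}^\infty e^{-k^2t}m_k(x)m_k(y)$, $m_k(x)=\sqrt{2/\pi}\,\sin(kx)$, $k\ge1$. The convolution is $$(P^D\star f)(t,x)=\int_0^t\int_0^\pi P^D(t-s,x,y)f(s,y)\,dy\,ds.$$ Fractional Sobolev space: $H_p^s=H_p^s(0,\pi)$ is the collection of all functions $f$ with $\|f\|_{H_p^s(0,\pi)}:=\|(-\Delta)^{s/2}f\|_{L_p(0,\pi)}<\infty$. Here $-\Delta$ is the Laplacian on $(0,\pi)$ with zero (Dirichlet) boundary conditions, $e^{t\Delta}$ is its semigroup (with kernel $P^D$), and $(-\Delta)^{s/2}$ is its fractional power: for $0<s<2$, $(-\Delta)^{s/2}f=\frac{1}{\Gamma(-s/2)}\int_0^\infty(e^{t\Delta}-I)f\,\frac{dt}{t^{1+s/2}}$ with $\Gamma$ the gamma function, and for larger $s$ it is the usual fractional power, obtained by composition (it multiplies the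 $k$-th sine coefficient by $k^{s}$). $L_\infty(0,T;X)$ is the space of $X$-valued functions on $(0,T)$ with norm the (essential) supremum in $t$ of the $X$-norm. *)

theory Defs
  imports "HOL-Analysis.Analysis" "HOL-Probability.Essential_Supremum"
begin

abbreviation interval_pi :: "real measure"
  where "interval_pi \<equiv> lebesgue_on {0<..<pi}"

definition eigenfun :: "nat \<Rightarrow> real \<Rightarrow> real"
  where "eigenfun k x = sqrt (2 / pi) * sin (real k * x)"

definition heat_kernel :: "real \<Rightarrow> real \<Rightarrow> real \<Rightarrow> real"
  where "heat_kernel t x y =
    (\<Sum>j. exp (- (real (Suc j))\<^sup>2 * t) * eigenfun (Suc j) x * eigenfun (Suc j) y)"

definition heat_semigroup :: "real \<Rightarrow> (real \<Rightarrow> real) \<Rightarrow> real \<Rightarrow> real"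
  where "heat_semigroup t f x = (LINT y|interval_pi. heat_kernel t x y * f y)"

definition heat_conv :: "(real \<Rightarrow> real \<Rightarrow> real) \<Rightarrow> real \<Rightarrow> real \<Rightarrow> real"
  where "heat_conv f t x =
    (LINT s|lebesgue_on {0<..<t}. LINT y|interval_pi. heat_kernel (t - s) x y * f s y)"

text \<open>Functions on the interval are represented by total functions on the reals of which only the
  values on \<open>(0, \<pi>)\<close> matter; almost everywhere equal functions are not identified, so the
  norms below are seminorms.\<close>

definition Lp_space :: "real \<Rightarrow> (real \<Rightarrow> real) set"
  where "Lp_space p = {f. f \<in> borel_measurable interval_pi \<and>
                          integrable interval_pi (\<lambda>x. \<bar>f x\<bar> powr p)}"

definition Lp_norm :: "real \<Rightarrow> (real \<Rightarrow> real) \<Rightarrow> real"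
  where "Lp_norm p f = (LINT x|interval_pi. \<bar>f x\<bar> powr p) powr (1 / p)"

text \<open>The relation \<open>frac_laplacian_small s f g\<close> says that, for \<open>0 < s < 2\<close>,
  \<open>g = (-\<Delta>)\<^bsup>s/2\<^esup> f = 1/\<Gamma>(-s/2) \<integral>\<^sub>0\<^sup>\<infinity> (e\<^bsup>t\<Delta>\<^esup> - I) f dt/t\<^bsup>1+s/2\<^esup>\<close>. The integral is singular
  at \<open>t = 0\<close> and for a general \<open>f\<close> in the domain it is not absolutely convergent; as usual it is
  the strong limit of the integrals over \<open>[\<epsilon>, \<infinity>)\<close>, which do converge absolutely. The limit is
  taken in \<open>L\<^sub>1(0, \<pi>)\<close>, the largest space of the scale, so that the operator does not depend
  on \<open>p\<close>. The distance is a nonnegative integral because the Bochner integral of a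
  non-integrable function is \<open>0\<close>.\<close>

definition frac_laplacian_trunc :: "real \<Rightarrow> real \<Rightarrow> (real \<Rightarrow> real) \<Rightarrow> real \<Rightarrow> real"
  where "frac_laplacian_trunc s \<epsilon> f x =
    1 / Gamma (- s / 2) *
      (LINT t|lebesgue_on {\<epsilon>..}. (heat_semigroup t f x - f x) / t powr (1 + s / 2))"

definition frac_laplacian_small :: "real \<Rightarrow> (real \<Rightarrow> real) \<Rightarrow> (real \<Rightarrow> real) \<Rightarrow> bool"
  where "frac_laplacian_small s f g \<longleftrightarrow>
    f \<in> Lp_space 1 \<and> g \<in> Lp_space 1 \<and>
    ((\<lambda>\<epsilon>. \<integral>\<^sup>+x. ennreal \<bar>frac_laplacian_trunc s \<epsilon> f x - g x\<bar> \<partial>interval_pi) \<longlongrightarrow> 0) (at_right 0)"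

text \<open>For arbitrary \<open>s > 0\<close> the power is the \<open>n\<close>-fold composition of the power of order \<open>s / n\<close>,
  where \<open>n = \<lfloor>s / 2\<rfloor> + 1\<close> is the least number of factors for which \<open>s / n < 2\<close>; for \<open>s < 2\<close>
  this is \<open>n = 1\<close>. The iteration \<open>^^\<close> is that of relations.\<close>

definition frac_laplacian :: "real \<Rightarrow> (real \<Rightarrow> real) \<Rightarrow> (real \<Rightarrow> real) \<Rightarrow> bool"
  where "frac_laplacian s =
    (let n = nat \<lfloor>s / 2\<rfloor> + 1 in frac_laplacian_small (s / real n) ^^ n)"

definition Sobolev :: "real \<Rightarrow> real \<Rightarrow> (real \<Rightarrow> real) set"
  where "Sobolev p s = {f. \<exists>g. frac_laplacian s f g \<and> g \<in> Lp_space p}"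

text \<open>The function \<open>(-\<Delta>)\<^bsup>s/2\<^esup> f\<close> is determined up to null sets, hence the choice of \<open>g\<close> is
  immaterial.\<close>

definition Sobolev_norm :: "real \<Rightarrow> real \<Rightarrow> (real \<Rightarrow> real) \<Rightarrow> real"
  where "Sobolev_norm p s f = Lp_norm p (SOME g. frac_laplacian s f g)"

text \<open>\<open>Linf T X N\<close> is the Bochner space \<open>L\<^sub>\<infinity>(0, T; X)\<close> for a space \<open>X\<close> of functions with seminorm
  \<open>N\<close>: the strongly measurable, essentially bounded \<open>X\<close>-valued functions on \<open>(0, T)\<close>.\<close>

definition strongly_measurable ::
  "real \<Rightarrow> (real \<Rightarrow> real) set \<Rightarrow> ((real \<Rightarrow> real) \<Rightarrow> real) \<Rightarrow> (real \<Rightarrow> real \<Rightarrow> real) \<Rightarrow> bool"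
  where "strongly_measurable T X N f \<longleftrightarrow>
    (AE t in lebesgue_on {0<..<T}. f t \<in> X) \<and>
    (\<exists>\<phi> :: nat \<Rightarrow> real \<Rightarrow> real \<Rightarrow> real.
       (\<forall>n. simple_function (lebesgue_on {0<..<T}) (\<phi> n) \<and> \<phi> n ` {0<..<T} \<subseteq> X) \<and>
       (AE t in lebesgue_on {0<..<T}. (\<lambda>n. N (\<lambda>x. f t x - \<phi> n t x)) \<longlonglongrightarrow> 0))"

definition Linf_norm ::
  "real \<Rightarrow> ((real \<Rightarrow> real) \<Rightarrow> real) \<Rightarrow> (real \<Rightarrow> real \<Rightarrow> real) \<Rightarrow> ereal"
  where "Linf_norm T N f = esssup (lebesgue_on {0<..<T}) (\<lambda>t. ereal (N (f t)))"

definition Linf ::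
  "real \<Rightarrow> (real \<Rightarrow> real) set \<Rightarrow> ((real \<Rightarrow> real) \<Rightarrow> real) \<Rightarrow> (real \<Rightarrow> real \<Rightarrow> real) set"
  where "Linf T X N = {f. strongly_measurable T X N f \<and> Linf_norm T N f < \<infinity>}"

abbreviation Linf_Sobolev :: "real \<Rightarrow> real \<Rightarrow> real \<Rightarrow> (real \<Rightarrow> real \<Rightarrow> real) set"
  where "Linf_Sobolev T p s \<equiv> Linf T (Sobolev p s) (Sobolev_norm p s)"

abbreviation Linf_Sobolev_norm :: "real \<Rightarrow> real \<Rightarrow> real \<Rightarrow> (real \<Rightarrow> real \<Rightarrow> real) \<Rightarrow> ereal"
  where "Linf_Sobolev_norm T p s \<equiv> Linf_norm T (Sobolev_norm p s)"

end

theory Submission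
  imports Defs
begin

text \<open>Write \<open>A = -\<Delta>\<close>. On sine series, \<open>A\<^bsup>s/2\<^esup>\<close> multiplies the coefficient number \<open>k\<close> by \<open>k\<^sup>s\<close> and
\<open>exp (\<tau>\<Delta>)\<close> multiplies it by \<open>exp (-k\<^sup>2 \<tau>)\<close>. Hence, with \<open>g s = A\<^bsup>\<gamma>/2\<^esup> (f s)\<close>, formally
  \<open>A\<^bsup>1+\<beta>/2\<^esup> (P \<star> f)(t) = \<integral>\<^sub>0\<^sup>t A\<^bsup>q/2\<^esup> exp ((t - s)\<Delta>) (g s) ds\<close> where \<open>q = 2 - (\<gamma> - \<beta>)\<close>.
The operator \<open>A\<^bsup>q/2\<^esup> exp (\<tau>\<Delta>)\<close> is bounded on \<open>L\<^sub>p\<close> by \<open>112 \<tau>\<^bsup>-q/2\<^esup>\<close>, with the same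
constant for all \<open>p \<ge> 1\<close>. Since \<open>q < 2\<close>, this is integrable in \<open>\<tau>\<close>, and the integral over
\<open>(0, t)\<close> is a multiple of \<open>t\<^bsup>(\<gamma>-\<beta>)/2\<^esup>\<close>.

The bound for the operator comes from its kernel. By the Schur test
(\<open>Schur_bound\<close>) it suffices to bound the \<open>L\<^sub>1\<close> norm of \<open>\<Sum>k. a k * cos (k \<theta>)\<close> with
\<open>a k = k\<^sup>q exp (-k\<^sup>2 \<tau>)\<close>. That norm is controlled by Parseval's identity with the weight
\<open>1 + \<bar>1 - exp (i\<theta>)\<bar>\<^sup>2 / \<tau>\<close>, which turns into a bound for the coefficients and for
their differences (\<open>smooth_symbol_kernel_bound\<close>).

The work lies in justifying the formal identity for the definition of \<open>A\<^bsup>s/2\<^esup>\<close> as an \<open>L\<^sub>1\<close>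
limit of truncated integrals. Identities between functions are checked on sine coefficients, which
determine an integrable function (\<open>sine_coef_eq_imp_AE_eq\<close>). The truncated operator is a
multiplier too, and its distance from \<open>k\<^sup>s\<close> is at most a multiple of
\<open>\<epsilon>\<^bsup>\<eta>-s/2\<^esup> k\<^bsup>2\<eta>\<^esup>\<close> for every \<open>\<eta>\<close> between \<open>s/2\<close> and \<open>1\<close>. The truncation error of a potential
is thus a potential of slightly higher order with a small factor, and it tends to \<open>0\<close> as long as
that higher order still leaves an integrable singularity
(\<open>frac_laplacian_small_series_integral\<close>). The power of order \<open>2 + \<beta>\<close> is reached
in two steps of order \<open>1 + \<beta>/2\<close> (\<open>heat_potential_frac_laplacian\<close>).

Membership in the Bochner space also requires strong measurability of the solution; it follows from
its continuity in time, which is one more estimate of the same kind (\<open>heat_potential_time_diff\<close>).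
The continuity of the map is its linearity together with the bound.\<close>

section \<open>A weighted form of Jensen's inequality\<close>

text \<open>The convex function \<open>u powr p\<close> lies above its tangent at \<open>a\<close>; in the variable \<open>u / a\<close> this is Young's inequality.\<close>

lemma powr_tangent_line:
  fixes u a p :: real
  assumes "u \<ge> 0" "a > 0" "p \<ge> 1"
  shows "a powr p + p * a powr (p - 1) * (u - a) \<le> u powr p"
proof -
  define z where "z = u / a"
  have z: "z \<ge> 0" "u = z * a" using assms by (auto simp: z_def)
  have "p * z \<le> z powr p + (p - 1)"
  proof (cases "z = 0")
    case False
    have "(z powr p) powr (1/p) * 1 powr (1 - 1/p) \<le> (1/p) * (z powr p) + (1 - 1/p) * 1"
      using assms z False by (intro Youngs_inequality_0) auto
    then have "z \<le> (1/p) * (z powr p) + (1 - 1/p)"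
      using assms z by (simp add: powr_powr)
    then have "p * z \<le> p * ((1/p) * (z powr p) + (1 - 1/p))"
      using assms by (intro mult_left_mono) auto
    then show ?thesis using assms by (simp add: algebra_simps)
  qed (use assms in auto)
  then have "a powr p * (1 + p * (z - 1)) \<le> a powr p * z powr p"
    by (intro mult_left_mono) (auto simp: algebra_simps)
  moreover have "a powr p = a powr (p - 1) * a" using assms by (simp add: powr_diff)
  ultimately show ?thesis using z assms by (simp add: powr_mult algebra_simps)
qed

text \<open>This is Jensen's inequality for the measure with density \<open>w\<close> of mass at most \<open>B\<close>. It serves
  twice: with a kernel as weight it gives the Schur test, and with a weight depending on time it gives
  Minkowski's inequality for integrals. The right-hand side may be infinite, and the integral on the left
  may be the default value \<open>0\<close> of a non-integrable function.\<close>

lemma weighted_Jensen_powr: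
  fixes w u :: "'a \<Rightarrow> real"
  assumes [measurable]: "w \<in> borel_measurable M" "u \<in> borel_measurable M"
    and w0: "\<And>x. x \<in> space M \<Longrightarrow> w x \<ge> 0"
    and wB: "(\<integral>\<^sup>+x. ennreal (w x) \<partial>M) \<le> ennreal B" and "B \<ge> 0" and "p \<ge> 1"
  shows "ennreal (\<bar>LINT x|M. w x * u x\<bar> powr p)
          \<le> ennreal (B powr (p - 1)) * (\<integral>\<^sup>+x. ennreal (w x * \<bar>u x\<bar> powr p) \<partial>M)"
proof (cases "integrable M (\<lambda>x. w x * u x) \<and> (LINT x|M. w x * u x) \<noteq> 0")
  case False
  then have "(LINT x|M. w x * u x) = 0" using not_integrable_integral_eq by blast
  then show ?thesis by simp
next
  case True
  then have int: "integrable M (\<lambda>x. w x * u x)" by simp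
  have inta: "integrable M (\<lambda>x. w x * \<bar>u x\<bar>)"
    using integrable_abs[OF int] by (rule Bochner_Integration.integrable_cong[THEN iffD1, rotated 2])
      (auto simp: abs_mult w0)
  have intw: "integrable M w"
    by (rule integrableI_nonneg) (use w0 wB in \<open>auto simp: le_less_trans[OF wB] intro!: AE_I2\<close>)
  have intwB: "(LINT x|M. w x) \<le> B"
    using wB w0 \<open>B \<ge> 0\<close> by (subst (asm) nn_integral_eq_integral[OF intw]) (auto intro!: AE_I2)
  define Y where "Y = (LINT x|M. w x * \<bar>u x\<bar>)"
  have XY: "\<bar>LINT x|M. w x * u x\<bar> \<le> Y"
  proof -
    have "\<bar>LINT x|M. w x * u x\<bar> \<le> (LINT x|M. \<bar>w x * u x\<bar>)" by (rule integral_abs_bound)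
    also have "\<dots> = Y" unfolding Y_def by (rule Bochner_Integration.integral_cong) (auto simp: abs_mult w0)
    finally show ?thesis .
  qed
  then have Y: "Y > 0" using True by linarith
  have B: "B > 0"
  proof (rule ccontr)
    assume "\<not> B > 0"
    then have "(\<integral>\<^sup>+x. ennreal (w x) \<partial>M) = 0" using wB \<open>B \<ge> 0\<close> by simp
    then have "AE x in M. ennreal (w x) = 0" by (subst (asm) nn_integral_0_iff_AE) auto
    then have "AE x in M. w x * \<bar>u x\<bar> = 0" using AE_space
    proof eventually_elim
      case (elim x)
      then show ?case using w0[of x] by (simp add: ennreal_eq_0_iff)
    qed
    then have "Y = 0" unfolding Y_def by (rule integral_eq_zero_AE)
    with Y show False by simp
  qed
  show ?thesis
  proof (cases "(\<integral>\<^sup>+x. ennreal (w x * \<bar>u x\<bar> powr p) \<partial>M) = \<infinity>")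
    case True
    then show ?thesis using B by (simp add: ennreal_mult_top)
  next
    case fin: False
    have intp: "integrable M (\<lambda>x. w x * \<bar>u x\<bar> powr p)"
      by (rule integrableI_nonneg) (use w0 fin in \<open>auto simp: less_top intro!: AE_I2\<close>)
    \<comment> \<open>The mean of \<open>\<bar>u\<bar>\<close>; the tangent at this point is integrated.\<close>
    define a where "a = Y / B"
    have a: "a > 0" using Y B by (simp add: a_def)
    have "a powr p * B \<le> (1 - p) * a powr p * (LINT x|M. w x) + p * a powr (p - 1) * Y"
    proof -
      have "a powr (p - 1) * Y = a powr p * B" 
      proof -
        have "a powr p = a powr (p - 1) * a" using a by (simp add: powr_diff)
        then have "a powr p * B = a powr (p - 1) * (a * B)" by simp
        also have "a * B = Y" using B by (simp add: a_def)
        finally show ?thesis by simp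
      qed
      moreover have "(1 - p) * a powr p * B \<le> (1 - p) * a powr p * (LINT x|M. w x)"
        using assms(6) intwB by (intro mult_left_mono_neg) (auto intro!: mult_nonpos_nonneg)
      moreover have "p * a powr (p - 1) * Y = p * (a powr p * B)" using calculation(1) by simp
      moreover have "a powr p * B = (1 - p) * a powr p * B + p * (a powr p * B)" by (simp add: algebra_simps)
      ultimately show ?thesis by linarith
    qed
    also have "\<dots> = (LINT x|M. (1 - p) * a powr p * w x + p * a powr (p - 1) * (w x * \<bar>u x\<bar>))"
      unfolding Y_def using intw inta by simp
    also have "\<dots> \<le> (LINT x|M. w x * \<bar>u x\<bar> powr p)"
    proof (rule integral_mono)
      fix x assume x: "x \<in> space M"
      have "w x * (a powr p + p * a powr (p - 1) * (\<bar>u x\<bar> - a)) \<le> w x * \<bar>u x\<bar> powr p"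
        using powr_tangent_line[of "\<bar>u x\<bar>" a p] a assms(6) w0[OF x] by (intro mult_left_mono) auto
      moreover have "a powr (p - 1) * a = a powr p" using a by (simp add: powr_diff)
      then have "w x * (a powr p + p * a powr (p - 1) * (\<bar>u x\<bar> - a)) =
         (1 - p) * a powr p * w x + p * a powr (p - 1) * (w x * \<bar>u x\<bar>)"
        by (simp add: algebra_simps flip: \<open>a powr (p - 1) * a = a powr p\<close>)
      ultimately show "(1 - p) * a powr p * w x + p * a powr (p - 1) * (w x * \<bar>u x\<bar>) \<le> w x * \<bar>u x\<bar> powr p"
        by simp
    qed (use intw inta intp in auto)
    finally have "B powr (p - 1) * (a powr p * B) \<le> B powr (p - 1) * (LINT x|M. w x * \<bar>u x\<bar> powr p)"
      by (intro mult_left_mono) auto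
    moreover have "B powr (p - 1) * (a powr p * B) = Y powr p"
      using B Y by (simp add: a_def powr_divide powr_diff)
    moreover have "\<bar>LINT x|M. w x * u x\<bar> powr p \<le> Y powr p" using XY assms(6) by (intro powr_mono2) auto
    moreover have "(\<integral>\<^sup>+x. ennreal (w x * \<bar>u x\<bar> powr p) \<partial>M) = ennreal (LINT x|M. w x * \<bar>u x\<bar> powr p)"
      by (rule nn_integral_eq_integral[OF intp]) (auto simp: w0 intro!: AE_I2)
    ultimately show ?thesis by (simp add: ennreal_mult'[symmetric] ennreal_leI)
  qed
qed

section \<open>Sine coefficients\<close>

definition sine_coef :: "(real \<Rightarrow> real) \<Rightarrow> nat \<Rightarrow> real"
  where "sine_coef f k = (LINT y|interval_pi. f y * eigenfun k y)"

definition sine_kernel :: "(nat \<Rightarrow> real) \<Rightarrow> real \<Rightarrow> real \<Rightarrow> real"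
  where "sine_kernel a x y = (\<Sum>j. a (Suc j) * eigenfun (Suc j) x * eigenfun (Suc j) y)"

definition sine_series :: "(nat \<Rightarrow> real) \<Rightarrow> real \<Rightarrow> real"
  where "sine_series a x = (\<Sum>j. a (Suc j) * eigenfun (Suc j) x)"

lemma abs_eigenfun_le_1: "\<bar>eigenfun k x\<bar> \<le> 1"
proof -
  have "sqrt (2 / pi) \<le> 1" using pi_ge_two by simp
  then have "\<bar>sqrt (2 / pi)\<bar> * \<bar>sin (real k * x)\<bar> \<le> 1 * 1" by (intro mult_mono) auto
  then show ?thesis by (simp add: eigenfun_def abs_mult)
qed

lemma borel_measurable_eigenfun [measurable]: "eigenfun k \<in> borel_measurable borel"
  unfolding eigenfun_def by measurable

lemma borel_measurable_interval_piI [measurable (raw)]: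
  "f \<in> borel_measurable borel \<Longrightarrow> f \<in> borel_measurable (lebesgue_on S)"
  by (simp add: borel_measurable_if_I measurable_completion measurable_restrict_space1)

lemma fst_snd_borel_measurable_lebesgue_on [measurable]:
  "fst \<in> borel_measurable (lebesgue_on (S :: real set) \<Otimes>\<^sub>M N)"
  "snd \<in> borel_measurable (N \<Otimes>\<^sub>M lebesgue_on S)"
  using measurable_compose[OF measurable_fst borel_measurable_interval_piI[OF measurable_ident]]
    measurable_compose[OF measurable_snd borel_measurable_interval_piI[OF measurable_ident]]
  by auto

lemma finite_measure_lebesgue_on_Ioo: "finite_measure (lebesgue_on {a<..<b::real})"
  by (rule finite_measure_lebesgue_on) simp

lemma Lp_space_1_iff: "f \<in> Lp_space 1 \<longleftrightarrow> integrable interval_pi f"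
proof
  assume f: "f \<in> Lp_space 1"
  then have [measurable]: "f \<in> borel_measurable interval_pi" by (simp add: Lp_space_def)
  have "integrable interval_pi (\<lambda>x. \<bar>f x\<bar>)" using f by (simp add: Lp_space_def)
  then show "integrable interval_pi f" by (subst (asm) integrable_abs_iff) auto
qed (auto simp: Lp_space_def)

lemma integrable_mult_eigenfun:
  assumes "integrable interval_pi f"
  shows "integrable interval_pi (\<lambda>y. f y * eigenfun k y)"
  by (rule Bochner_Integration.integrable_bound[OF assms])
    (use assms abs_eigenfun_le_1 in \<open>auto simp: abs_mult intro!: AE_I2 mult_left_le\<close>)

lemma sine_coef_le: 
  assumes "integrable interval_pi f"
  shows "\<bar>sine_coef f k\<bar> \<le> (LINT y|interval_pi. \<bar>f y\<bar>)"
proof -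
  have "\<bar>sine_coef f k\<bar> \<le> (LINT y|interval_pi. \<bar>f y * eigenfun k y\<bar>)"
    unfolding sine_coef_def by (rule integral_abs_bound)
  also have "\<dots> \<le> (LINT y|interval_pi. \<bar>f y\<bar>)"
    using assms integrable_abs[OF integrable_mult_eigenfun[OF assms]] abs_eigenfun_le_1 
    by (intro integral_mono) (auto simp: abs_mult intro!: mult_left_le)
  finally show ?thesis .
qed

lemma sine_coef_diff:
  assumes "integrable interval_pi f" "integrable interval_pi g"
  shows "sine_coef (\<lambda>x. f x - g x) k = sine_coef f k - sine_coef g k"
  using integrable_mult_eigenfun[OF assms(1)] integrable_mult_eigenfun[OF assms(2)]
  by (simp add: sine_coef_def left_diff_distrib)

text \<open>The coefficients give the integrals of \<open>f\<close> against \<open>sin (k x)\<close>, hence against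
  \<open>sin x * (cos x) ^ n\<close>, hence by Weierstrass against \<open>sin x * \<phi> x\<close> for every continuous
  \<open>\<phi>\<close>, as \<open>\<phi> \<circ> arccos\<close> is a limit of polynomials. Continuous functions that tend to the
  sign of \<open>f x * sin x\<close> almost everywhere then show that \<open>\<bar>f x * sin x\<bar>\<close> has integral \<open>0\<close>.\<close>

lemma sine_coef_zero_imp_AE_zero:
  assumes f: "integrable interval_pi f" and z: "\<And>k. k \<ge> 1 \<Longrightarrow> sine_coef f k = 0"
  shows "AE x in interval_pi. f x = 0"
proof -
  let ?I = interval_pi
  have [measurable]: "f \<in> borel_measurable ?I" using f by auto
  have bd: "integrable ?I (\<lambda>x. f x * g x)" if [measurable]: "g \<in> borel_measurable ?I" 
     and "\<And>x. x \<in> {0<..<pi} \<Longrightarrow> \<bar>g x\<bar> \<le> C" for g C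
  proof (rule Bochner_Integration.integrable_bound)
    show "integrable ?I (\<lambda>x. C * f x)" using f by simp
    show "AE x in ?I. norm (f x * g x) \<le> norm (C * f x)"
    proof (rule AE_I2)
      fix x assume "x \<in> space ?I"
      then have "\<bar>f x\<bar> * \<bar>g x\<bar> \<le> \<bar>f x\<bar> * \<bar>C\<bar>"
        using that(2)[of x] by (intro mult_left_mono) auto
      then show "norm (f x * g x) \<le> norm (C * f x)" by (simp add: abs_mult mult.commute)
    qed
  qed measurable
  have poly: "(LINT x|?I. f x * (sin (real k * x) * cos x ^ n)) = 0" for k n
  proof (induction n arbitrary: k)
    case 0
    have "sine_coef f k = 0" if "k \<noteq> 0" using z that by simp
    then have "sqrt (2 / pi) * (LINT x|?I. f x * sin (real k * x)) = 0" if "k \<noteq> 0"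
      using that unfolding sine_coef_def eigenfun_def
      by (subst integral_mult_right_zero[symmetric]) (simp add: mult_ac)
    then show ?case by (cases "k = 0") auto
  next
    case (Suc n)
    show ?case
    proof (cases "k = 0")
      case False
      have i: "integrable ?I (\<lambda>x. f x * (sin (real k * x) * cos x ^ n))" for k n
        by (rule bd[of _ 1]) (auto simp: abs_mult power_abs intro!: mult_le_one power_le_one)
      have e: "f x * (sin (real k * x) * cos x ^ Suc n) = 
         (f x * (sin (real (Suc k) * x) * cos x ^ n) + f x * (sin (real (k - 1) * x) * cos x ^ n)) / 2" for x
      proof -
        have "real (Suc k) * x = real k * x + x" "real (k - 1) * x = real k * x - x"
          using False by (auto simp: algebra_simps of_nat_diff)
        then have "sin (real (Suc k) * x) + sin (real (k - 1) * x) = 2 * sin (real k * x) * cos x"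
          by (simp only: sin_add sin_diff)
        then have "sin (real k * x) * cos x = (sin (real (Suc k) * x) + sin (real (k - 1) * x)) / 2" by simp
        then have "(f x * cos x ^ n) * (sin (real k * x) * cos x) = f x * cos x ^ n * ((sin (real (Suc k) * x) + sin (real (k - 1) * x)) / 2)"
          by (simp only:)
        then show ?thesis by (simp add: field_simps)
      qed
      show ?thesis
        unfolding e using Suc.IH[of "Suc k"] Suc.IH[of "k - 1"] i[of "Suc k" n] i[of "k-1" n]
        by (simp add: Bochner_Integration.integral_add)
    qed auto
  qed
  have cont: "(LINT x|?I. f x * (sin x * \<phi> x)) = 0" if \<phi>: "continuous_on {0..pi} \<phi>" for \<phi>
  proof -
    have M\<phi>: "\<phi> \<in> borel_measurable ?I"
      by (rule continuous_imp_measurable_on_sets_lebesgue[OF continuous_on_subset[OF \<phi>]]) auto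
    obtain C where C: "\<And>x. x \<in> {0..pi} \<Longrightarrow> \<bar>\<phi> x\<bar> \<le> C"
      using compact_imp_bounded[OF compact_continuous_image[OF \<phi>]] unfolding bounded_iff by fastforce
    have C0: "C \<ge> 0" using C[of 0] by auto
    have ct: "continuous_on {-1..1} (\<lambda>t. \<phi> (arccos t))"
      by (rule continuous_on_compose2[OF \<phi> continuous_on_arccos']) (auto simp: arccos_lbound arccos_ubound)
    have "\<bar>LINT x|?I. f x * (sin x * \<phi> x)\<bar> \<le> e * (LINT x|?I. \<bar>f x\<bar>)" if "e > 0" for e
    proof -
      obtain g where g: "real_polynomial_function g" and ge: "\<And>t. t \<in> {-1..1} \<Longrightarrow> \<bar>\<phi> (arccos t) - g t\<bar> < e"
        using Stone_Weierstrass_real_polynomial_function[OF _ ct \<open>e > 0\<close>] by auto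
      obtain a n where g_eq: "g = (\<lambda>x. \<Sum>i\<le>n. a i * x ^ i)" using g real_polynomial_function_iff_sum by auto
      have i: "integrable ?I (\<lambda>x. f x * (sin (real 1 * x) * cos x ^ n))" for n
        by (rule bd[of _ 1]) (auto simp: abs_mult power_abs intro!: mult_le_one power_le_one)
      have eq: "f x * (sin x * g (cos x)) = (\<Sum>i\<le>n. a i * (f x * (sin (real 1 * x) * cos x ^ i)))" for x
        unfolding g_eq by (simp add: sum_distrib_left mult_ac)
      have gi: "integrable ?I (\<lambda>x. f x * (sin x * g (cos x)))"
        unfolding eq using i by (intro Bochner_Integration.integrable_sum integrable_mult_right) auto
      have g0: "(LINT x|?I. f x * (sin x * g (cos x))) = 0"
      proof -
        have "(LINT x|?I. (\<Sum>i\<le>n. a i * (f x * (sin (real 1 * x) * cos x ^ i)))) = (\<Sum>i\<le>n. (LINT x|?I. a i * (f x * (sin (real 1 * x) * cos x ^ i))))"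
          by (rule Bochner_Integration.integral_sum) (intro integrable_mult_right i)
        also have "\<dots> = 0" by (rule sum.neutral) (simp only: integral_mult_right_zero poly, simp)
        finally show ?thesis unfolding eq .
      qed
      have pi': "integrable ?I (\<lambda>x. f x * (sin x * \<phi> x))"
      proof (rule bd[of _ C])
        show "\<bar>sin x * \<phi> x\<bar> \<le> C" if "x \<in> {0<..<pi}" for x
          using mult_mono[of "\<bar>sin x\<bar>" 1 "\<bar>\<phi> x\<bar>" C] C[of x] that C0 by (auto simp: abs_mult)
      qed (use M\<phi> in measurable)
      have diff: "(LINT x|?I. f x * (sin x * \<phi> x)) = (LINT x|?I. f x * (sin x * \<phi> x) - f x * (sin x * g (cos x)))"
        using g0 gi pi' by simp
      have "\<bar>LINT x|?I. f x * (sin x * \<phi> x)\<bar> \<le> (LINT x|?I. \<bar>f x * (sin x * \<phi> x) - f x * (sin x * g (cos x))\<bar>)"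
        unfolding diff by (rule integral_abs_bound)
      also have "\<dots> \<le> (LINT x|?I. e * \<bar>f x\<bar>)"
      proof (rule integral_mono)
        fix x assume "x \<in> space ?I"
        then have x: "x \<in> {0<..<pi}" by simp
        have "\<bar>\<phi> x - g (cos x)\<bar> \<le> e" using ge[of "cos x"] x by (simp add: arccos_cos)
        then have "\<bar>sin x\<bar> * \<bar>\<phi> x - g (cos x)\<bar> \<le> 1 * e" by (intro mult_mono) auto
        then have "\<bar>f x\<bar> * (\<bar>sin x\<bar> * \<bar>\<phi> x - g (cos x)\<bar>) \<le> \<bar>f x\<bar> * e" by (intro mult_left_mono) auto
        also have "\<bar>f x\<bar> * (\<bar>sin x\<bar> * \<bar>\<phi> x - g (cos x)\<bar>) = \<bar>f x * (sin x * \<phi> x) - f x * (sin x * g (cos x))\<bar>"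
          by (simp add: abs_mult[symmetric] algebra_simps)
        finally show "\<bar>f x * (sin x * \<phi> x) - f x * (sin x * g (cos x))\<bar> \<le> e * \<bar>f x\<bar>" by (simp add: mult.commute)
      qed (use gi pi' f in auto)
      finally show ?thesis by simp
    qed
    then have le: "\<bar>LINT x|?I. f x * (sin x * \<phi> x)\<bar> \<le> e * (LINT x|?I. \<bar>f x\<bar>)" if "e > 0" for e using that by blast
    have "(LINT x|?I. \<bar>f x\<bar>) \<ge> 0" by simp
    show ?thesis
    proof (rule ccontr)
      assume n: "(LINT x|?I. f x * (sin x * \<phi> x)) \<noteq> 0"
      define L where "L = (LINT x|?I. \<bar>f x\<bar>)"
      have L: "L \<ge> 0" by (simp add: L_def)
      define X where "X = \<bar>LINT x|?I. f x * (sin x * \<phi> x)\<bar>"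
      have X: "X > 0" using n by (simp add: X_def)
      have "X / (2 * (L + 1)) > 0" using X L by simp
      then have "X \<le> (X / (2 * (L + 1))) * L" unfolding X_def[symmetric] L_def[symmetric]
        using le[of "X / (2 * (L + 1))", folded X_def L_def] by simp
      also have "\<dots> < X" using X L by (simp add: field_simps add_nonneg_pos)
      finally show False by simp
    qed
  qed
  define h where "h x = f x * sin x" for x
  have hi: "integrable ?I h" unfolding h_def by (rule bd[of _ 1]) auto
  have [measurable]: "h \<in> borel_measurable ?I" using hi by auto
  define \<sigma> where "\<sigma> x = (if x \<in> {0<..<pi} then sgn (h x) else 0)" for x
  have "(\<lambda>x. sgn (h x)) \<in> borel_measurable ?I" by measurable
  then have "\<sigma> \<in> borel_measurable lebesgue" unfolding \<sigma>_def by (subst borel_measurable_if) auto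
  then have "\<sigma> measurable_on UNIV" by (rule lebesgue_measurable_imp_measurable_on_real) auto
  then obtain N g where N: "negligible N" and gc: "\<And>n::nat. continuous_on UNIV (g n)"
    and gl: "\<And>x. x \<notin> N \<Longrightarrow> (\<lambda>n. g n x) \<longlonglongrightarrow> \<sigma> x" unfolding measurable_on_def by auto
  \<comment> \<open>The truncation makes the convergence dominated.\<close>
  define G where "G n x = max (-1) (min 1 (g n x))" for n x
  have Gc: "continuous_on UNIV (G n)" for n unfolding G_def by (intro continuous_intros gc)
  have Gb: "\<bar>G n x\<bar> \<le> 1" for n x by (auto simp: G_def)
  have Gl: "(\<lambda>n. G n x) \<longlonglongrightarrow> \<sigma> x" if "x \<notin> N" for x
  proof -
    have "(\<lambda>n. G n x) \<longlonglongrightarrow> max (-1) (min 1 (\<sigma> x))" unfolding G_def by (intro tendsto_intros gl that)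
    moreover have "max (-1) (min 1 (\<sigma> x)) = \<sigma> x" by (auto simp: \<sigma>_def sgn_if)
    ultimately show ?thesis by simp
  qed
  have "(\<lambda>n. LINT x|?I. h x * G n x) \<longlonglongrightarrow> (LINT x|?I. h x * \<sigma> x)"
  proof (rule integral_dominated_convergence)
    show "integrable ?I (\<lambda>x. \<bar>h x\<bar>)" using hi by simp
    show "AE x in ?I. (\<lambda>n. h x * G n x) \<longlonglongrightarrow> h x * \<sigma> x"
    proof -
      have "AE x in lebesgue. x \<notin> N" using N by (simp add: negligible_iff_null_sets AE_not_in)
      then have "AE x in ?I. x \<notin> N" by (subst AE_restrict_space_iff) auto
      then show ?thesis by eventually_elim (intro tendsto_intros Gl)
    qed
    show "AE x in ?I. norm (h x * G n x) \<le> \<bar>h x\<bar>" for n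
      by (intro AE_I2) (auto simp: abs_mult intro!: mult_left_le Gb)
    show "(\<lambda>x. h x * G n x) \<in> borel_measurable ?I" for n
      using borel_measurable_interval_piI[OF borel_measurable_continuous_onI[OF Gc[of n]]] by measurable
    show "(\<lambda>x. h x * \<sigma> x) \<in> borel_measurable ?I"
    proof -
      have "(\<lambda>x. h x * \<sigma> x) \<in> borel_measurable ?I \<longleftrightarrow> (\<lambda>x. h x * sgn (h x)) \<in> borel_measurable ?I"
        by (rule measurable_cong) (auto simp: \<sigma>_def)
      then show ?thesis by simp
    qed
  qed
  moreover have "(LINT x|?I. h x * G n x) = 0" for n
    using cont[OF continuous_on_subset[OF Gc]] by (simp add: h_def mult.assoc)
  ultimately have "(LINT x|?I. h x * \<sigma> x) = 0" by (simp add: LIMSEQ_const_iff)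
  moreover have "(LINT x|?I. h x * \<sigma> x) = (LINT x|?I. \<bar>h x\<bar>)"
    by (rule Bochner_Integration.integral_cong) (auto simp: \<sigma>_def abs_sgn)
  ultimately have "AE x in ?I. \<bar>h x\<bar> = 0" 
    using integral_nonneg_eq_0_iff_AE[of ?I "\<lambda>x. \<bar>h x\<bar>"] hi by auto
  then show ?thesis using AE_space
  proof eventually_elim
    case (elim x)
    then have "sin x > 0" by (auto intro: sin_gt_zero)
    with elim show ?case by (simp add: h_def)
  qed
qed

lemma sine_coef_eq_imp_AE_eq:
  assumes "integrable interval_pi f" "integrable interval_pi g"
    and "\<And>k. k \<ge> 1 \<Longrightarrow> sine_coef f k = sine_coef g k"
  shows "AE x in interval_pi. f x = g x"
proof -
  have "AE x in interval_pi. f x - g x = 0"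
    by (rule sine_coef_zero_imp_AE_zero) (use assms in \<open>auto simp: sine_coef_diff\<close>)
  then show ?thesis by simp
qed

section \<open>Schur's test for kernels given by sine series\<close>

lemma Lp_imp_integrable:
  assumes "g \<in> Lp_space p" "p \<ge> 1"
  shows "integrable interval_pi g"
proof (rule Bochner_Integration.integrable_bound)
  show "integrable interval_pi (\<lambda>x. 1 + \<bar>g x\<bar> powr p)"
    using assms finite_measure.integrable_const[OF finite_measure_lebesgue_on_Ioo[of 0 pi], of "1::real"]
    by (auto simp: Lp_space_def)
  show "AE x in interval_pi. norm (g x) \<le> norm (1 + \<bar>g x\<bar> powr p)"
  proof (rule AE_I2)
    fix x
    have "\<bar>g x\<bar> \<le> 1 + \<bar>g x\<bar> powr p"
    proof (cases "\<bar>g x\<bar> \<le> 1")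
      case False
      then have "\<bar>g x\<bar> powr 1 \<le> \<bar>g x\<bar> powr p" using assms by (intro powr_mono) auto
      then show ?thesis using False by simp
    qed (simp add: add_increasing2)
    then show "norm (g x) \<le> norm (1 + \<bar>g x\<bar> powr p)" by simp
  qed
qed (use assms in \<open>auto simp: Lp_space_def\<close>)

lemma nn_integral_Lp_norm:
  assumes "g \<in> Lp_space p" "p \<ge> 1"
  shows "(\<integral>\<^sup>+x. ennreal (\<bar>g x\<bar> powr p) \<partial>interval_pi) = ennreal (Lp_norm p g powr p)"
proof -
  have "(\<integral>\<^sup>+x. ennreal (\<bar>g x\<bar> powr p) \<partial>interval_pi) = ennreal (LINT x|interval_pi. \<bar>g x\<bar> powr p)"
    using assms by (intro nn_integral_eq_integral) (auto simp: Lp_space_def)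
  also have "(LINT x|interval_pi. \<bar>g x\<bar> powr p) = Lp_norm p g powr p"
    using assms by (auto simp: Lp_norm_def powr_powr)
  finally show ?thesis .
qed

lemma Lp_norm_nonneg: "Lp_norm p g \<ge> 0"
  by (simp add: Lp_norm_def)

lemma Lp_bound_from_nn_integral:
  assumes [measurable]: "g \<in> borel_measurable interval_pi" and "p \<ge> 1" "B \<ge> 0"
    and le: "(\<integral>\<^sup>+x. ennreal (\<bar>g x\<bar> powr p) \<partial>interval_pi) \<le> ennreal (B powr p)"
  shows "g \<in> Lp_space p" "Lp_norm p g \<le> B"
proof -
  have int: "integrable interval_pi (\<lambda>x. \<bar>g x\<bar> powr p)"
    by (rule integrableI_nonneg) (auto simp: le_less_trans[OF le])
  then show g: "g \<in> Lp_space p" by (simp add: Lp_space_def)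
  have "Lp_norm p g powr p \<le> B powr p"
    using le unfolding nn_integral_Lp_norm[OF g \<open>p \<ge> 1\<close>] by simp
  then show "Lp_norm p g \<le> B"
    using \<open>p \<ge> 1\<close> \<open>B \<ge> 0\<close> Lp_norm_nonneg[of p g] by (metis linorder_not_less powr_less_mono2 less_le_trans zero_less_one)
qed

lemma nn_integral_interval_pi_const: "(\<integral>\<^sup>+x. ennreal c \<partial>interval_pi) = ennreal (pi * c)" if "c \<ge> 0"
  using that by (simp add: emeasure_restrict_space ennreal_mult' mult.commute)

text \<open>The constant \<open>4\<close> is a bound for \<open>pi powr (1 - 1 / p)\<close> that is uniform in \<open>p\<close>.\<close>

lemma L1_norm_le_Lp_norm:
  assumes g: "g \<in> Lp_space p" and "p \<ge> 1"
  shows "(LINT x|interval_pi. \<bar>g x\<bar>) \<le> 4 * Lp_norm p g"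
proof -
  have [measurable]: "g \<in> borel_measurable interval_pi" using g by (simp add: Lp_space_def)
  have "ennreal (\<bar>LINT x|interval_pi. 1 * \<bar>g x\<bar>\<bar> powr p) \<le>
      ennreal (4 powr (p - 1)) * (\<integral>\<^sup>+x. ennreal (1 * \<bar>\<bar>g x\<bar>\<bar> powr p) \<partial>interval_pi)"
  proof (rule weighted_Jensen_powr)
    show "(\<integral>\<^sup>+ x. ennreal 1 \<partial>interval_pi) \<le> ennreal 4"
      using ennreal_leI[OF less_imp_le[OF pi_less_4]] by (subst nn_integral_interval_pi_const) auto
  qed (use \<open>p \<ge> 1\<close> in auto)
  also have "\<dots> = ennreal (4 powr (p - 1)) * ennreal (Lp_norm p g powr p)"
    using nn_integral_Lp_norm[OF assms] by simp
  also have "\<dots> \<le> ennreal (4 powr p) * ennreal (Lp_norm p g powr p)"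
    using \<open>p \<ge> 1\<close> by (intro mult_right_mono ennreal_leI powr_mono) auto
  also have "\<dots> = ennreal ((4 * Lp_norm p g) powr p)"
    by (simp add: powr_mult Lp_norm_nonneg ennreal_mult)
  finally have "(LINT x|interval_pi. \<bar>g x\<bar>) powr p \<le> (4 * Lp_norm p g) powr p"
    by simp
  then show "(LINT x|interval_pi. \<bar>g x\<bar>) \<le> 4 * Lp_norm p g"
    using \<open>p \<ge> 1\<close> Lp_norm_nonneg[of p g] 
    by (metis linorder_not_less powr_less_mono2 less_le_trans zero_less_one mult_nonneg_nonneg zero_le_numeral)
qed

text \<open>By the symmetry of the kernel the one condition in \<open>x\<close> gives both halves of Schur's
  hypothesis.\<close>

definition kernel_bound :: "(nat \<Rightarrow> real) \<Rightarrow> real \<Rightarrow> bool"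
  where "kernel_bound a A \<longleftrightarrow> summable (\<lambda>j. \<bar>a (Suc j)\<bar>) \<and>
    (\<forall>x\<in>{0<..<pi}. (\<integral>\<^sup>+y. ennreal \<bar>sine_kernel a x y\<bar> \<partial>interval_pi) \<le> ennreal A)"

lemma abs_sine_term_le: "\<bar>b * eigenfun j x * eigenfun k y\<bar> \<le> \<bar>b\<bar>" "\<bar>b * eigenfun j x\<bar> \<le> \<bar>b\<bar>"
proof -
  show *: "\<bar>b * eigenfun j x\<bar> \<le> \<bar>b\<bar>" for b j x
    using mult_left_mono[OF abs_eigenfun_le_1[of j x] abs_ge_zero[of b]] by (simp add: abs_mult)
  show "\<bar>b * eigenfun j x * eigenfun k y\<bar> \<le> \<bar>b\<bar>"
    using *[of "b * eigenfun j x" k y] *[of b j x] by linarith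
qed

lemma sine_series_measurable [measurable (raw)]:
  assumes [measurable]: "\<And>k. (\<lambda>z. a z k) \<in> borel_measurable N" "h \<in> borel_measurable N"
  shows "(\<lambda>z. sine_series (a z) (h z)) \<in> borel_measurable N"
  unfolding sine_series_def by measurable

lemma sine_kernel_measurable [measurable (raw)]:
  assumes [measurable]: "g \<in> borel_measurable N" "h \<in> borel_measurable N"
  shows "(\<lambda>z. sine_kernel a (g z) (h z)) \<in> borel_measurable N"
  unfolding sine_kernel_def by measurable

lemma sine_kernel_commute: "sine_kernel a x y = sine_kernel a y x"
  by (simp add: sine_kernel_def mult_ac)

lemma abs_sine_series_le:
  assumes "summable (\<lambda>j. \<bar>a (Suc j)\<bar>)"
  shows "\<bar>sine_series a x\<bar> \<le> (\<Sum>j. \<bar>a (Suc j)\<bar>)"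
proof -
  have s: "summable (\<lambda>j. \<bar>a (Suc j) * eigenfun (Suc j) x\<bar>)"
    by (rule summable_comparison_test'[OF assms]) (simp add: abs_sine_term_le)
  have "\<bar>sine_series a x\<bar> \<le> (\<Sum>j. \<bar>a (Suc j) * eigenfun (Suc j) x\<bar>)"
    unfolding sine_series_def by (rule summable_rabs[OF s])
  also have "\<dots> \<le> (\<Sum>j. \<bar>a (Suc j)\<bar>)" by (intro suminf_le abs_sine_term_le s assms)
  finally show ?thesis .
qed

text \<open>The absolute summability of \<open>a\<close> allows the sum and the integral to be exchanged.\<close>

lemma integral_kernel_eq_sine_series:
  assumes a: "summable (\<lambda>j. \<bar>a (Suc j)\<bar>)" and g: "integrable interval_pi g"
  shows "integrable interval_pi (\<lambda>y. sine_kernel a x y * g y)"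
    "(LINT y|interval_pi. sine_kernel a x y * g y) = sine_series (\<lambda>k. a k * sine_coef g k) x"
proof -
  let ?f = "\<lambda>j y. a (Suc j) * eigenfun (Suc j) x * eigenfun (Suc j) y * g y"
  have sy: "summable (\<lambda>j. norm (?f j y))" for y
  proof (rule summable_comparison_test')
    show "summable (\<lambda>j. \<bar>a (Suc j)\<bar> * \<bar>g y\<bar>)" using a by (rule summable_mult2)
    show "norm (norm (?f j y)) \<le> \<bar>a (Suc j)\<bar> * \<bar>g y\<bar>" for j
      using mult_right_mono[OF abs_sine_term_le(1), of "\<bar>g y\<bar>"] by (simp add: abs_mult)
  qed
  have s: "summable (\<lambda>j. a (Suc j) * eigenfun (Suc j) x * eigenfun (Suc j) y)" for y
    by (rule summable_comparison_test'[OF a]) (use abs_sine_term_le in auto)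
  have fi: "integrable interval_pi (?f j)" for j
    using integrable_mult_right[OF integrable_mult_eigenfun[OF g], of "a (Suc j) * eigenfun (Suc j) x" "Suc j"]
    by (simp add: mult_ac)
  have si: "summable (\<lambda>j. LINT y|interval_pi. norm (?f j y))"
  proof (rule summable_comparison_test')
    show "summable (\<lambda>j. \<bar>a (Suc j)\<bar> * (LINT y|interval_pi. \<bar>g y\<bar>))" using a by (rule summable_mult2)
    fix j
    have "(LINT y|interval_pi. norm (?f j y)) \<le> (LINT y|interval_pi. \<bar>a (Suc j)\<bar> * \<bar>g y\<bar>)"
      using mult_right_mono[OF abs_sine_term_le(1), of "\<bar>g _\<bar>"] fi[of j] g
      by (intro integral_mono) (auto simp: abs_mult intro!: integrable_norm[OF fi[of j], simplified abs_mult real_norm_def])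
    then show "norm (LINT y|interval_pi. norm (?f j y)) \<le> \<bar>a (Suc j)\<bar> * (LINT y|interval_pi. \<bar>g y\<bar>)" by simp
  qed
  have eq: "(\<Sum>j. ?f j y) = sine_kernel a x y * g y" for y
    unfolding sine_kernel_def by (rule suminf_mult2[OF s, symmetric])
  show "integrable interval_pi (\<lambda>y. sine_kernel a x y * g y)"
    using integrable_suminf[OF fi _ si] sy by (simp add: eq)
  have "(LINT y|interval_pi. sine_kernel a x y * g y) = (\<Sum>j. LINT y|interval_pi. ?f j y)"
    using integral_suminf[OF fi _ si] sy by (simp add: eq)
  also have "\<dots> = sine_series (\<lambda>k. a k * sine_coef g k) x"
    unfolding sine_series_def sine_coef_def
    by (intro suminf_cong, subst integral_mult_right_zero[symmetric], subst integral_mult_left_zero[symmetric])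
      (simp add: mult_ac)
  finally show "(LINT y|interval_pi. sine_kernel a x y * g y) = sine_series (\<lambda>k. a k * sine_coef g k) x" .
qed

text \<open>This bounds the kernel pointwise by the sum of the coefficients; compared with the sharp estimate
  it loses a factor \<open>\<tau> powr (-1/2)\<close> for heat kernels, which the lower order terms can afford.\<close>

lemma kernel_bound_crude:
  assumes a: "summable (\<lambda>j. \<bar>a (Suc j)\<bar>)" and S: "(\<Sum>j. \<bar>a (Suc j)\<bar>) \<le> S"
  shows "kernel_bound a (pi * S)"
  unfolding kernel_bound_def
proof (intro conjI ballI a)
  fix x :: real
  have S0: "S \<ge> 0" using suminf_nonneg[OF a] S by auto
  have "(\<integral>\<^sup>+y. ennreal \<bar>sine_kernel a x y\<bar> \<partial>interval_pi) \<le> (\<integral>\<^sup>+y. ennreal S \<partial>interval_pi)"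
  proof (intro nn_integral_mono ennreal_leI)
    fix y
    have s: "summable (\<lambda>j. \<bar>a (Suc j) * eigenfun (Suc j) x\<bar>)"
      by (rule summable_comparison_test'[OF a]) (simp add: abs_sine_term_le)
    have "\<bar>sine_kernel a x y\<bar> \<le> (\<Sum>j. \<bar>a (Suc j) * eigenfun (Suc j) x\<bar>)"
      using abs_sine_series_le[of "\<lambda>j. a j * eigenfun j x" y, OF s]
      by (simp add: sine_series_def sine_kernel_def)
    also have "\<dots> \<le> (\<Sum>j. \<bar>a (Suc j)\<bar>)" by (intro suminf_le abs_sine_term_le s a)
    finally show "\<bar>sine_kernel a x y\<bar> \<le> S" using S by simp
  qed
  then show "(\<integral>\<^sup>+y. ennreal \<bar>sine_kernel a x y\<bar> \<partial>interval_pi) \<le> ennreal (pi * S)"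
    using nn_integral_interval_pi_const[OF S0] by simp
qed

interpretation interval_pi: finite_measure interval_pi
  by (rule finite_measure_lebesgue_on_Ioo)

lemma integrable_continuous_interval_pi:
  "continuous_on {0..pi} f \<Longrightarrow> integrable interval_pi f" for f :: "real \<Rightarrow> real"
proof -
  assume "continuous_on {0..pi} f"
  then have "integrable (lebesgue_on {0..pi}) f" by (rule continuous_imp_integrable_real)
  then have "f absolutely_integrable_on {0..pi}" by (simp add: absolutely_integrable_on_iff_nonneg set_integrable_def integrable_restrict_space)
  then have "f absolutely_integrable_on {0<..<pi}"
    by (rule set_integrable_subset) auto
  then show "integrable interval_pi f" by (simp add: set_integrable_def integrable_restrict_space)
qed

lemma sine_orthonormal:
  assumes "j \<ge> 1" "k \<ge> 1"
  shows "(LINT x|interval_pi. eigenfun j x * eigenfun k x) = (if j = k then 1 else 0)"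
proof -
  have ci: "(LINT x|interval_pi. cos (real_of_int n * x)) = (if n = 0 then pi else 0)" for n
  proof -
    have "((\<lambda>x. cos (real_of_int n * x)) has_integral (if n = 0 then pi else 0)) {0..pi}"
    proof (cases "n = 0")
      case True
      then show ?thesis using has_integral_const_real[of "1::real" 0 pi] by simp
    next
      case False
      have "((\<lambda>x. cos (real_of_int n * x)) has_integral (sin (real_of_int n * pi) / n - sin (real_of_int n * 0) / n)) {0..pi}"
        using False by (intro fundamental_theorem_of_calculus)
          (auto intro!: derivative_eq_intros simp: has_real_derivative_iff_has_vector_derivative[symmetric])
      then show ?thesis using False by (simp add: sin_int_times_real mult.commute)
    qed
    then have h: "((\<lambda>x. cos (real_of_int n * x)) has_integral (if n = 0 then pi else 0)) {0<..<pi}"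
      by (simp only: has_integral_open_interval[of _ _ 0 pi, unfolded box_real cbox_interval])
    have "integrable interval_pi (\<lambda>x. cos (real_of_int n * x))"
      by (intro integrable_continuous_interval_pi continuous_intros)
    then have "((\<lambda>x. cos (real_of_int n * x)) has_integral (LINT x|interval_pi. cos (real_of_int n * x))) {0<..<pi}"
      by (intro has_integral_integral_lebesgue_on) auto
    with h show ?thesis by (rule has_integral_unique[rotated])
  qed
  have ii: "integrable interval_pi (\<lambda>x. cos (real_of_int n * x))" for n
    by (intro integrable_continuous_interval_pi continuous_intros)
  have e: "eigenfun j x * eigenfun k x = 1 / pi * (cos (real_of_int (int j - int k) * x) - cos (real_of_int (int j + int k) * x))" for x
  proof -
    have "eigenfun j x * eigenfun k x = (sqrt (2 / pi) * sqrt (2 / pi)) * (sin (j * x) * sin (k * x))"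
      by (simp only: eigenfun_def mult_ac)
    also have "\<dots> = (2 / pi) * ((cos (j * x - k * x) - cos (j * x + k * x)) / 2)"
      by (simp add: sin_times_sin)
    finally show ?thesis by (simp add: algebra_simps)
  qed
  show ?thesis unfolding e integral_mult_right_zero
    by (subst Bochner_Integration.integral_diff[OF ii ii]) (use assms in \<open>auto simp only: ci; simp\<close>)
qed

lemma sine_coef_sine_series:
  assumes a: "summable (\<lambda>j. \<bar>a (Suc j)\<bar>)" and k: "k \<ge> 1"
  shows "sine_coef (sine_series a) k = a k" 
proof -
  have k': "k = Suc (k - 1)" using k by simp
  let ?f = "\<lambda>j y. a (Suc j) * eigenfun (Suc j) y * eigenfun k y"
  have i1: "integrable interval_pi (\<lambda>y. eigenfun j y * eigenfun k y)" for j
    unfolding eigenfun_def by (intro integrable_continuous_interval_pi continuous_intros)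
  have fi: "integrable interval_pi (?f j)" for j
    using integrable_mult_right[OF i1[of "Suc j"], of "a (Suc j)"] by (simp add: mult_ac)
  have sy: "summable (\<lambda>j. norm (?f j y))" for y
    by (rule summable_comparison_test'[OF a]) (use abs_sine_term_le in auto)
  have s: "summable (\<lambda>j. a (Suc j) * eigenfun (Suc j) y)" for y
    by (rule summable_comparison_test'[OF a]) (use abs_sine_term_le in auto)
  have si: "summable (\<lambda>j. LINT y|interval_pi. norm (?f j y))"
  proof (rule summable_comparison_test')
    show "summable (\<lambda>j. \<bar>a (Suc j)\<bar> * pi)" using a by (rule summable_mult2)
    fix j
    have "(LINT y|interval_pi. norm (?f j y)) \<le> (LINT y|interval_pi. \<bar>a (Suc j)\<bar>)"
      using integrable_norm[OF fi[of j]] abs_sine_term_le(1)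
      by (intro integral_mono) auto
    then show "norm (LINT y|interval_pi. norm (?f j y)) \<le> \<bar>a (Suc j)\<bar> * pi" 
      by (simp add: measure_restrict_space mult.commute)
  qed
  have "sine_coef (sine_series a) k = (LINT y|interval_pi. (\<Sum>j. ?f j y))"
    unfolding sine_coef_def sine_series_def by (simp add: suminf_mult2[OF s])
  also have "\<dots> = (\<Sum>j. LINT y|interval_pi. ?f j y)"
    using integral_suminf[OF fi _ si] sy by simp
  also have "\<dots> = (\<Sum>j. if j = k - 1 then a k else 0)"
  proof (rule suminf_cong)
    fix j
    have "(LINT y|interval_pi. ?f j y) = a (Suc j) * (LINT y|interval_pi. eigenfun (Suc j) y * eigenfun k y)"
      by (simp add: mult.assoc)
    also have "\<dots> = (if j = k - 1 then a k else 0)" using k by (subst sine_orthonormal) auto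
    finally show "(LINT y|interval_pi. ?f j y) = (if j = k - 1 then a k else 0)" .
  qed
  also have "\<dots> = a k" using suminf_finite[of "{k-1}" "\<lambda>j. if j = k - 1 then a k else 0"] by simp
  finally show ?thesis .
qed

interpretation interval_pi2: pair_sigma_finite interval_pi interval_pi ..

text \<open>Jensen's inequality with the kernel as weight in \<open>y\<close>, followed by an integration in \<open>x\<close> and
  the bound of the kernel in its other variable. The constant is \<open>A\<close> for every \<open>p\<close>.\<close>

lemma Schur_bound:
  assumes a: "kernel_bound a A" and "A \<ge> 0" and g: "g \<in> Lp_space p" and p: "p \<ge> 1"
  shows "(\<integral>\<^sup>+x. ennreal (\<bar>sine_series (\<lambda>k. a k * sine_coef g k) x\<bar> powr p) \<partial>interval_pi)
    \<le> ennreal ((A * Lp_norm p g) powr p)"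
proof -
  have s: "summable (\<lambda>j. \<bar>a (Suc j)\<bar>)" using a by (simp add: kernel_bound_def)
  have kb: "(\<integral>\<^sup>+y. ennreal \<bar>sine_kernel a x y\<bar> \<partial>interval_pi) \<le> ennreal A" if "x \<in> {0<..<pi}" for x
    using a that by (simp add: kernel_bound_def)
  have gi: "integrable interval_pi g" by (rule Lp_imp_integrable[OF g p])
  then have [measurable]: "g \<in> borel_measurable interval_pi" by auto
  have "(\<integral>\<^sup>+x. ennreal (\<bar>sine_series (\<lambda>k. a k * sine_coef g k) x\<bar> powr p) \<partial>interval_pi)
    \<le> (\<integral>\<^sup>+x. ennreal (A powr (p - 1)) * (\<integral>\<^sup>+y. ennreal (\<bar>sine_kernel a x y\<bar> * \<bar>g y\<bar> powr p) \<partial>interval_pi) \<partial>interval_pi)"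
  proof (rule nn_integral_mono)
    fix x assume "x \<in> space interval_pi"
    then have x: "x \<in> {0<..<pi}" by simp
    let ?u = "\<lambda>y. sgn (sine_kernel a x y) * g y"
    have "ennreal (\<bar>LINT y|interval_pi. \<bar>sine_kernel a x y\<bar> * ?u y\<bar> powr p)
       \<le> ennreal (A powr (p - 1)) * (\<integral>\<^sup>+y. ennreal (\<bar>sine_kernel a x y\<bar> * \<bar>?u y\<bar> powr p) \<partial>interval_pi)"
      by (rule weighted_Jensen_powr) (use kb[OF x] \<open>A \<ge> 0\<close> p in auto)
    also have "(\<lambda>y. \<bar>sine_kernel a x y\<bar> * ?u y) = (\<lambda>y. sine_kernel a x y * g y)"
      by (auto simp: abs_mult_sgn mult.assoc[symmetric])
    also have "(\<lambda>y. ennreal (\<bar>sine_kernel a x y\<bar> * \<bar>?u y\<bar> powr p)) = (\<lambda>y. ennreal (\<bar>sine_kernel a x y\<bar> * \<bar>g y\<bar> powr p))"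
      by (auto simp: abs_mult sgn_if)
    finally show "ennreal (\<bar>sine_series (\<lambda>k. a k * sine_coef g k) x\<bar> powr p) \<le>
        ennreal (A powr (p - 1)) * (\<integral>\<^sup>+y. ennreal (\<bar>sine_kernel a x y\<bar> * \<bar>g y\<bar> powr p) \<partial>interval_pi)"
      by (simp add: integral_kernel_eq_sine_series(2)[OF s gi])
  qed
  also have "\<dots> = ennreal (A powr (p - 1)) * (\<integral>\<^sup>+x. (\<integral>\<^sup>+y. ennreal (\<bar>sine_kernel a x y\<bar> * \<bar>g y\<bar> powr p) \<partial>interval_pi) \<partial>interval_pi)"
    by (rule nn_integral_cmult, rule interval_pi.borel_measurable_nn_integral) measurable
  also have "(\<integral>\<^sup>+x. (\<integral>\<^sup>+y. ennreal (\<bar>sine_kernel a x y\<bar> * \<bar>g y\<bar> powr p) \<partial>interval_pi) \<partial>interval_pi)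
     = (\<integral>\<^sup>+y. (\<integral>\<^sup>+x. ennreal (\<bar>sine_kernel a x y\<bar> * \<bar>g y\<bar> powr p) \<partial>interval_pi) \<partial>interval_pi)"
    by (rule interval_pi2.Fubini') measurable
  also have "\<dots> \<le> (\<integral>\<^sup>+y. ennreal A * ennreal (\<bar>g y\<bar> powr p) \<partial>interval_pi)"
  proof (rule nn_integral_mono)
    fix y assume "y \<in> space interval_pi"
    then have y: "y \<in> {0<..<pi}" by simp
    have "(\<integral>\<^sup>+x. ennreal (\<bar>sine_kernel a x y\<bar> * \<bar>g y\<bar> powr p) \<partial>interval_pi)
       = (\<integral>\<^sup>+x. ennreal \<bar>sine_kernel a y x\<bar> \<partial>interval_pi) * ennreal (\<bar>g y\<bar> powr p)"
      by (subst nn_integral_multc[symmetric]) (auto simp: ennreal_mult sine_kernel_commute[of a y])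
    also have "\<dots> \<le> ennreal A * ennreal (\<bar>g y\<bar> powr p)" by (intro mult_right_mono kb y) auto
    finally show "(\<integral>\<^sup>+x. ennreal (\<bar>sine_kernel a x y\<bar> * \<bar>g y\<bar> powr p) \<partial>interval_pi) \<le> \<dots>" .
  qed
  also have "\<dots> = ennreal A * ennreal (Lp_norm p g powr p)"
    by (subst nn_integral_cmult) (auto simp: nn_integral_Lp_norm[OF g p])
  finally have "(\<integral>\<^sup>+x. ennreal (\<bar>sine_series (\<lambda>k. a k * sine_coef g k) x\<bar> powr p) \<partial>interval_pi)
     \<le> ennreal (A powr (p - 1)) * (ennreal A * ennreal (Lp_norm p g powr p))"
    by (simp add: mult_left_mono)
  also have "\<dots> = ennreal ((A * Lp_norm p g) powr p)"
  proof -
    have "A powr (p - 1) * A = A powr p" using \<open>A \<ge> 0\<close> by (cases "A = 0") (auto simp: powr_diff)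
    then show ?thesis using \<open>A \<ge> 0\<close> by (simp add: ennreal_mult[symmetric] powr_mult Lp_norm_nonneg mult.assoc[symmetric])
  qed
  finally show ?thesis .
qed

section \<open>Integrals over time of sine series\<close>

text \<open>A time-dependent function \<open>g\<close> with values in a ball of \<open>L\<^sub>p\<close>, represented by its sine
  coefficients \<open>c s k\<close>. Strong measurability of \<open>g\<close> makes each coefficient measurable in
  time but does not make \<open>g s y\<close> jointly measurable in \<open>(s, y)\<close>; a sine series in the coefficients
  is jointly measurable, so that Fubini's theorem applies to it.\<close>

definition source :: "real \<Rightarrow> real \<Rightarrow> real \<Rightarrow> (real \<Rightarrow> nat \<Rightarrow> real) \<Rightarrow> bool"
  where "source T p M c \<longleftrightarrow>
    (\<forall>k. (\<lambda>s. c s k) \<in> borel_measurable (lebesgue_on {0<..<T})) \<and>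
    (AE s in lebesgue_on {0<..<T}. \<exists>g\<in>Lp_space p. Lp_norm p g \<le> M \<and> (\<forall>k\<ge>1. c s k = sine_coef g k))"

definition series_integral :: "(real \<Rightarrow> nat \<Rightarrow> real) \<Rightarrow> (real \<Rightarrow> nat \<Rightarrow> real) \<Rightarrow> real \<Rightarrow> real \<Rightarrow> real"
  where "series_integral a c t x = (LINT s|lebesgue_on {0<..<t}. sine_series (\<lambda>k. a s k * c s k) x)"

lemma sine_series_cong: "(\<And>k. k \<ge> 1 \<Longrightarrow> a k = b k) \<Longrightarrow> sine_series a x = sine_series b x"
  by (simp add: sine_series_def)

lemma AE_lebesgue_on_subset:
  fixes S U :: "real set"
  assumes "AE x in lebesgue_on U. P x" "S \<subseteq> U" "S \<in> sets lebesgue" "U \<in> sets lebesgue"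
  shows "AE x in lebesgue_on S. P x"
  using assms by (auto simp: AE_restrict_space_iff elim!: eventually_mono)

lemma source_subinterval:
  assumes "source T p M c" "0 \<le> t" "t \<le> T"
  shows "source t p M c"
  unfolding source_def
proof (intro conjI allI)
  have "(\<lambda>s. c s k) \<in> borel_measurable (lebesgue_on {0<..<T})" for k
    using assms by (simp add: source_def)
  then show "(\<lambda>s. c s k) \<in> borel_measurable (lebesgue_on {0<..<t})" for k
    by (rule measurable_restrict_mono) (use assms in auto)
  show "AE s in lebesgue_on {0<..<t}. \<exists>g\<in>Lp_space p. Lp_norm p g \<le> M \<and> (\<forall>k\<ge>1. c s k = sine_coef g k)"
    using assms unfolding source_def by (intro AE_lebesgue_on_subset[where U="{0<..<T}" and S="{0<..<t}"]) auto
qed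

lemma source_imp_source_1:
  assumes "source T p M c" "p \<ge> 1"
  shows "source T 1 (4 * M) c"
  using assms(1) unfolding source_def
proof (elim conjE, intro conjI)
  assume "AE s in lebesgue_on {0<..<T}. \<exists>g\<in>Lp_space p. Lp_norm p g \<le> M \<and> (\<forall>k\<ge>1. c s k = sine_coef g k)"
  then show "AE s in lebesgue_on {0<..<T}. \<exists>g\<in>Lp_space 1. Lp_norm 1 g \<le> 4 * M \<and> (\<forall>k\<ge>1. c s k = sine_coef g k)"
  proof eventually_elim
    case (elim s)
    then obtain g where g: "g \<in> Lp_space p" "Lp_norm p g \<le> M" "\<forall>k\<ge>1. c s k = sine_coef g k" by auto
    then have "g \<in> Lp_space 1" using Lp_imp_integrable[OF g(1) \<open>p \<ge> 1\<close>] by (simp add: Lp_space_1_iff)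
    moreover have "Lp_norm 1 g \<le> 4 * M" using L1_norm_le_Lp_norm[OF g(1) \<open>p \<ge> 1\<close>] g(2) by (simp add: Lp_norm_def)
    ultimately show ?case using g(3) by auto
  qed
qed

lemma source_bounded:
  assumes "source T 1 M c"
  shows "AE s in lebesgue_on {0<..<T}. \<forall>k\<ge>1. \<bar>c s k\<bar> \<le> M"
proof -
  have "AE s in lebesgue_on {0<..<T}. \<exists>g\<in>Lp_space 1. Lp_norm 1 g \<le> M \<and> (\<forall>k\<ge>1. c s k = sine_coef g k)"
    using assms by (simp add: source_def)
  then show ?thesis
  proof eventually_elim
    case (elim s)
    then obtain g where g: "g \<in> Lp_space 1" "Lp_norm 1 g \<le> M" "\<forall>k\<ge>1. c s k = sine_coef g k" by auto
    have "\<bar>sine_coef g k\<bar> \<le> M" for k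
      using order_trans[OF sine_coef_le[of g k]] g by (simp add: Lp_norm_def Lp_space_1_iff)
    then show ?case using g(3) by simp
  qed
qed

text \<open>Completeness of Lebesgue measure: the measurability of one side carries over to the other, which
  matters for functions of time that are known only up to a null set.\<close>

lemma integral_cong_AE_lebesgue_on:
  fixes f g :: "real \<Rightarrow> real"
  assumes "AE x in lebesgue_on S. f x = g x" "S \<in> sets lebesgue" "g \<in> borel_measurable (lebesgue_on S)"
  shows "f \<in> borel_measurable (lebesgue_on S)" "(LINT x|lebesgue_on S. f x) = (LINT x|lebesgue_on S. g x)"
proof -
  have "AE x in lebesgue. x \<in> S \<longrightarrow> f x = g x"
    using assms by (simp add: AE_restrict_space_iff)
  then have "AE x in lebesgue. (if x \<in> S then g x else 0) = (if x \<in> S then f x else 0)"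
    by eventually_elim auto
  moreover have "(\<lambda>x. if x \<in> S then g x else 0) \<in> borel_measurable lebesgue"
    using assms by (simp add: borel_measurable_if)
  ultimately have "(\<lambda>x. if x \<in> S then f x else 0) \<in> borel_measurable lebesgue"
    by (rule borel_measurable_AE[rotated])
  then show f: "f \<in> borel_measurable (lebesgue_on S)" using assms by (simp add: borel_measurable_if)
  show "(LINT x|lebesgue_on S. f x) = (LINT x|lebesgue_on S. g x)"
    by (rule integral_cong_AE[OF f assms(3,1)])
qed

text \<open>For each \<open>s\<close> the Schur test bounds the \<open>L\<^sub>p\<close> norm of the integrand by \<open>A s * M\<close>. Jensen's
  inequality with weight \<open>A\<close>, applied to the integrand divided by \<open>A\<close>, integrates this over time
  (Minkowski's inequality). The coefficients result from Fubini's theorem in \<open>L\<^sub>1\<close>.\<close>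

lemma series_integral_bounds:
  fixes A :: "real \<Rightarrow> real"
  assumes p: "p \<ge> 1" and M: "M \<ge> 0" and src: "source t p M c"
    and am: "\<And>k. (\<lambda>s. a s k) \<in> borel_measurable (lebesgue_on {0<..<t})"
    and Am: "A \<in> borel_measurable (lebesgue_on {0<..<t})"
    and kb: "\<And>s. s \<in> {0<..<t} \<Longrightarrow> kernel_bound (a s) (A s)"
    and A0: "\<And>s. s \<in> {0<..<t} \<Longrightarrow> A s > 0"
    and B: "(\<integral>\<^sup>+s. ennreal (A s) \<partial>lebesgue_on {0<..<t}) \<le> ennreal B" and B0: "B \<ge> 0"
  shows "series_integral a c t \<in> Lp_space p" (is ?A)
    and "Lp_norm p (series_integral a c t) \<le> B * M" (is ?B)
    and "k \<ge> 1 \<Longrightarrow> sine_coef (series_integral a c t) k = (LINT s|lebesgue_on {0<..<t}. a s k * c s k)" (is "_ \<Longrightarrow> ?C")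
    and "k \<ge> 1 \<Longrightarrow> integrable (lebesgue_on {0<..<t}) (\<lambda>s. a s k * c s k)" (is "_ \<Longrightarrow> ?D")
proof -
  let ?J = "lebesgue_on {0<..<t}" and ?I = interval_pi
  interpret J: finite_measure ?J by (rule finite_measure_lebesgue_on_Ioo)
  interpret JI: pair_sigma_finite ?J ?I ..
  define v where "v s x = sine_series (\<lambda>k. a s k * c s k) x" for s x
  have cm[measurable]: "(\<lambda>s. c s k) \<in> borel_measurable ?J" for k using src by (simp add: source_def)
  note [measurable] = am Am
  have vm[measurable]: "(\<lambda>z. v (fst z) (snd z)) \<in> borel_measurable (?J \<Otimes>\<^sub>M ?I)"
    unfolding v_def by measurable
  have vm2[measurable]: "(\<lambda>z. v (snd z) (fst z)) \<in> borel_measurable (?I \<Otimes>\<^sub>M ?J)"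
    unfolding v_def by measurable
  have vs[measurable]: "v s \<in> borel_measurable ?I" for s
    unfolding v_def by measurable
  have vx[measurable]: "(\<lambda>s. v s x) \<in> borel_measurable ?J" for x
    unfolding v_def by measurable
  have Wv: "series_integral a c t x = (LINT s|?J. v s x)" for x
    by (simp add: series_integral_def v_def)
  have Wm[measurable]: "series_integral a c t \<in> borel_measurable ?I"
    unfolding Wv using vm2 by (intro J.borel_measurable_lebesgue_integral) (simp add: case_prod_beta')
  have slice: "AE s in ?J. (\<integral>\<^sup>+x. ennreal (\<bar>v s x\<bar> powr q) \<partial>?I) \<le> ennreal ((A s * M') powr q)"
    if q: "q \<ge> 1" and "M' \<ge> 0" and s: "source t q M' c" for q M'
  proof -
    have "AE s in ?J. \<exists>g\<in>Lp_space q. Lp_norm q g \<le> M' \<and> (\<forall>k\<ge>1. c s k = sine_coef g k)"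
      using s by (simp add: source_def)
    then show ?thesis using AE_space
    proof eventually_elim
      case (elim s)
      then obtain g where g: "g \<in> Lp_space q" "Lp_norm q g \<le> M'" "\<forall>k\<ge>1. c s k = sine_coef g k" and s: "s \<in> {0<..<t}"
        by auto
      have "v s = sine_series (\<lambda>k. a s k * sine_coef g k)"
        unfolding v_def using g(3) by (intro ext sine_series_cong) auto
      then have "(\<integral>\<^sup>+x. ennreal (\<bar>v s x\<bar> powr q) \<partial>?I) \<le> ennreal ((A s * Lp_norm q g) powr q)"
        using Schur_bound[OF kb[OF s] _ g(1) q] A0[OF s] by simp
      also have "\<dots> \<le> ennreal ((A s * M') powr q)"
        using A0[OF s] g(2) q Lp_norm_nonneg[of q g] by (intro ennreal_leI powr_mono2 mult_left_mono) auto
      finally show ?case .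
    qed
  qed
  have "(\<integral>\<^sup>+x. ennreal (\<bar>series_integral a c t x\<bar> powr p) \<partial>?I) \<le>
     (\<integral>\<^sup>+x. ennreal (B powr (p - 1)) * (\<integral>\<^sup>+s. ennreal (A s * \<bar>v s x / A s\<bar> powr p) \<partial>?J) \<partial>?I)"
  proof (rule nn_integral_mono)
    fix x
    have "ennreal (\<bar>LINT s|?J. A s * (v s x / A s)\<bar> powr p) \<le>
       ennreal (B powr (p - 1)) * (\<integral>\<^sup>+s. ennreal (A s * \<bar>v s x / A s\<bar> powr p) \<partial>?J)"
      by (rule weighted_Jensen_powr) (use B B0 p A0 in \<open>auto simp: less_imp_le\<close>)
    also have "(LINT s|?J. A s * (v s x / A s)) = series_integral a c t x"
      unfolding Wv using A0 by (intro Bochner_Integration.integral_cong) force+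
    finally show "ennreal (\<bar>series_integral a c t x\<bar> powr p) \<le>
      ennreal (B powr (p - 1)) * (\<integral>\<^sup>+s. ennreal (A s * \<bar>v s x / A s\<bar> powr p) \<partial>?J)" .
  qed
  also have "\<dots> = ennreal (B powr (p - 1)) * (\<integral>\<^sup>+x. (\<integral>\<^sup>+s. ennreal (A s * \<bar>v s x / A s\<bar> powr p) \<partial>?J) \<partial>?I)"
    by (intro nn_integral_cmult J.borel_measurable_nn_integral) measurable
  also have "(\<integral>\<^sup>+x. (\<integral>\<^sup>+s. ennreal (A s * \<bar>v s x / A s\<bar> powr p) \<partial>?J) \<partial>?I)
     = (\<integral>\<^sup>+s. (\<integral>\<^sup>+x. ennreal (A s * \<bar>v s x / A s\<bar> powr p) \<partial>?I) \<partial>?J)"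
    by (rule JI.Fubini') measurable
  also have "\<dots> \<le> (\<integral>\<^sup>+s. ennreal (M powr p) * ennreal (A s) \<partial>?J)"
  proof (rule nn_integral_mono_AE)
    show "AE s in ?J. (\<integral>\<^sup>+x. ennreal (A s * \<bar>v s x / A s\<bar> powr p) \<partial>?I) \<le> ennreal (M powr p) * ennreal (A s)"
      using slice[OF p M src] AE_space
    proof eventually_elim
      case (elim s)
      then have As: "A s > 0" using A0 by simp
      have "(\<integral>\<^sup>+x. ennreal (A s * \<bar>v s x / A s\<bar> powr p) \<partial>?I) =
         ennreal (A s / A s powr p) * (\<integral>\<^sup>+x. ennreal (\<bar>v s x\<bar> powr p) \<partial>?I)"
        using As by (subst nn_integral_cmult[symmetric]) (auto simp: ennreal_mult[symmetric] powr_divide)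
      also have "\<dots> \<le> ennreal (A s / A s powr p) * ennreal ((A s * M) powr p)"
        using elim(1) by (rule mult_left_mono) simp
      also have "\<dots> = ennreal (M powr p) * ennreal (A s)"
        using As M by (simp add: ennreal_mult[symmetric] powr_mult mult.commute)
      finally show ?case .
    qed
  qed
  also have "\<dots> = ennreal (M powr p) * (\<integral>\<^sup>+s. ennreal (A s) \<partial>?J)"
    by (rule nn_integral_cmult) measurable
  also have "\<dots> \<le> ennreal (M powr p) * ennreal B"
    by (intro mult_left_mono B) auto
  finally have "(\<integral>\<^sup>+x. ennreal (\<bar>series_integral a c t x\<bar> powr p) \<partial>?I) \<le> ennreal (B powr (p - 1)) * (ennreal (M powr p) * ennreal B)"
    by (simp add: mult_left_mono)
  also have "\<dots> = ennreal ((B * M) powr p)"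
  proof -
    have "B powr (p - 1) * B = B powr p" using B0 by (cases "B = 0") (auto simp: powr_diff)
    then show ?thesis using B0 M by (simp add: ennreal_mult[symmetric] powr_mult mult_ac)
  qed
  finally have fin: "(\<integral>\<^sup>+x. ennreal (\<bar>series_integral a c t x\<bar> powr p) \<partial>?I) \<le> ennreal ((B * M) powr p)" .
  show ?A ?B using Lp_bound_from_nn_integral[OF Wm p _ fin] B0 M by auto
  assume k: "k \<ge> 1"
  have src1: "source t 1 (4 * M) c" by (rule source_imp_source_1[OF src p])
  have vk: "integrable (?J \<Otimes>\<^sub>M ?I) (\<lambda>(s, x). v s x * eigenfun k x)"
  proof (rule integrableI_bounded)
    show "(\<lambda>(s, x). v s x * eigenfun k x) \<in> borel_measurable (?J \<Otimes>\<^sub>M ?I)"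
      using vm by (simp add: case_prod_beta')
    have "(\<integral>\<^sup>+z. ennreal (norm (case z of (s, x) \<Rightarrow> v s x * eigenfun k x)) \<partial>(?J \<Otimes>\<^sub>M ?I))
       \<le> (\<integral>\<^sup>+z. ennreal \<bar>v (fst z) (snd z)\<bar> \<partial>(?J \<Otimes>\<^sub>M ?I))"
      using abs_sine_term_le(2) by (intro nn_integral_mono ennreal_leI) (auto simp: case_prod_beta')
    also have "\<dots> = (\<integral>\<^sup>+s. (\<integral>\<^sup>+x. ennreal \<bar>v s x\<bar> \<partial>?I) \<partial>?J)"
      using vm by (subst interval_pi.nn_integral_fst[symmetric]) auto
    also have "\<dots> \<le> (\<integral>\<^sup>+s. ennreal (4 * M) * ennreal (A s) \<partial>?J)"
    proof (rule nn_integral_mono_AE)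
      show "AE s in ?J. (\<integral>\<^sup>+x. ennreal \<bar>v s x\<bar> \<partial>?I) \<le> ennreal (4 * M) * ennreal (A s)"
        using slice[OF _ _ src1, simplified, OF M] AE_space
      proof eventually_elim
        case (elim s)
        then have "A s > 0" using A0 by simp
        then show ?case using elim M by (simp add: ennreal_mult[symmetric] abs_mult mult_ac)
      qed
    qed
    also have "\<dots> = ennreal (4 * M) * (\<integral>\<^sup>+s. ennreal (A s) \<partial>?J)"
      by (rule nn_integral_cmult) measurable
    also have "\<dots> \<le> ennreal (4 * M) * ennreal B" by (intro mult_left_mono B) auto
    also have "\<dots> < \<infinity>" by (simp add: ennreal_mult_less_top)
    finally show "(\<integral>\<^sup>+z. ennreal (norm (case z of (s, x) \<Rightarrow> v s x * eigenfun k x)) \<partial>(?J \<Otimes>\<^sub>M ?I)) < \<infinity>" .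
  qed
  have co: "AE s in ?J. (LINT x|?I. v s x * eigenfun k x) = a s k * c s k"
    using source_bounded[OF src1] AE_space
  proof eventually_elim
    case (elim s)
    then have s: "s \<in> {0<..<t}" by simp
    have "summable (\<lambda>j. \<bar>a s (Suc j) * c s (Suc j)\<bar>)"
    proof (rule summable_comparison_test')
      show "summable (\<lambda>j. \<bar>a s (Suc j)\<bar> * (4 * M))"
        using kb[OF s] by (intro summable_mult2) (simp add: kernel_bound_def)
      show "norm \<bar>a s (Suc j) * c s (Suc j)\<bar> \<le> \<bar>a s (Suc j)\<bar> * (4 * M)" for j
        using elim(1) by (auto simp: abs_mult intro!: mult_left_mono)
    qed
    from sine_coef_sine_series[OF this k] show ?case by (simp add: sine_coef_def v_def)
  qed
  have Im: "(\<lambda>s. a s k * c s k) \<in> borel_measurable ?J" by measurable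
  have "integrable ?J (\<lambda>s. LINT x|?I. v s x * eigenfun k x)"
    using JI.integrable_fst[OF vk] .
  then show ?D using integrable_cong_AE[THEN iffD1, OF _ Im co] by auto
  have "sine_coef (series_integral a c t) k = (LINT x|?I. (LINT s|?J. v s x * eigenfun k x))"
    unfolding sine_coef_def Wv by simp
  also have "\<dots> = (LINT s|?J. (LINT x|?I. v s x * eigenfun k x))"
    by (rule JI.Fubini_integral[OF vk])
  also have "\<dots> = (LINT s|?J. a s k * c s k)"
    by (rule integral_cong_AE_lebesgue_on[OF co _ Im]) auto
  finally show ?C .
qed

section \<open>The symbol of the truncated fractional Laplacian\<close>

lemma nn_integral_lebesgue_on_eq_lborel:
  fixes S :: "real set"
  assumes "S \<in> sets borel"
  shows "(\<integral>\<^sup>+x. f x \<partial>lebesgue_on S) = (\<integral>\<^sup>+x. f x * indicator S x \<partial>lborel)"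
  using assms by (simp add: nn_integral_restrict_space nn_integral_completion)

lemma one_minus_exp_le_powr:
  fixes u \<theta> :: real
  assumes "u \<ge> 0" "0 < \<theta>" "\<theta> \<le> 1"
  shows "1 - exp (- u) \<le> u powr \<theta>"
proof (cases "u \<le> 1")
  case True
  have "1 - exp (- u) \<le> u" using exp_ge_add_one_self[of "- u"] by simp
  also have "\<dots> \<le> u powr \<theta>" 
    using assms True powr_mono'[of \<theta> 1 u] by simp
  finally show ?thesis .
next
  case False
  then have "1 \<le> u powr \<theta>" using assms by (simp add: ge_one_powr_ge_zero)
  then show ?thesis by (smt (verit) exp_gt_zero)
qed

text \<open>The factor \<open>1 / \<Gamma>(-\<sigma>)\<close> in the fractional Laplacian is negative, as is \<open>exp (-l r) - 1\<close>.\<close>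

lemma Gamma_neg_less_0: 
  assumes "0 < \<sigma>" "\<sigma> < (1::real)"
  shows "Gamma (- \<sigma>) < 0" "Gamma (1 - \<sigma>) = - \<sigma> * Gamma (- \<sigma>)"
proof -
  have "- \<sigma> \<notin> \<int>\<^sub>\<le>\<^sub>0"
  proof
    assume "- \<sigma> \<in> \<int>\<^sub>\<le>\<^sub>0"
    then obtain n :: int where "- \<sigma> = of_int n" by (auto elim!: nonpos_Ints_cases)
    then have "real_of_int n < 0" "real_of_int (- 1) < real_of_int n" using assms by simp_all
    then have "n < 0" "- 1 < n" by (simp, simp only: of_int_less_iff)
    then show False by simp
  qed
  from Gamma_plus1[OF this] show *: "Gamma (1 - \<sigma>) = - \<sigma> * Gamma (- \<sigma>)" by simp
  have "Gamma (1 - \<sigma>) > 0" using assms by (intro Gamma_real_pos) auto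
  then show "Gamma (- \<sigma>) < 0" using * assms by (simp add: mult_less_0_iff)
qed

text \<open>With \<open>1 - exp (-l r) = \<integral>\<^sub>0\<^sup>r l exp (-l u) du\<close> and Tonelli's theorem, the integral becomes
  \<open>\<integral>\<^sub>0\<^sup>\<infinity> l exp (-l u) u\<^bsup>-\<sigma>\<^esup>/\<sigma> du\<close>, a rescaled Gamma integral.\<close>

lemma nn_integral_frac_power:
  fixes \<sigma> l :: real
  assumes \<sigma>: "0 < \<sigma>" "\<sigma> < 1" and l: "l > 0"
  shows "(\<integral>\<^sup>+r. ennreal ((1 - exp (- l * r)) / r powr (1 + \<sigma>)) \<partial>lebesgue_on {0<..})
    = ennreal (- Gamma (- \<sigma>) * l powr \<sigma>)"
proof -
  define G where "G r u = ennreal (if 0 \<le> u \<and> u \<le> r then l * exp (- l * u) else 0) * ennreal (indicator {0<..} r / r powr (1 + \<sigma>))" for r u :: real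
  have G_meas: "case_prod G \<in> borel_measurable (lborel \<Otimes>\<^sub>M lborel)"
    unfolding G_def case_prod_beta' by measurable
  have "(\<integral>\<^sup>+r. ennreal ((1 - exp (- l * r)) / r powr (1 + \<sigma>)) \<partial>lebesgue_on {0<..})
     = (\<integral>\<^sup>+r. ennreal ((1 - exp (- l * r)) / r powr (1 + \<sigma>)) * indicator {0<..} r \<partial>lborel)"
    by (rule nn_integral_lebesgue_on_eq_lborel) auto
  also have "\<dots> = (\<integral>\<^sup>+r. (\<integral>\<^sup>+u. G r u \<partial>lborel) \<partial>lborel)"
  proof (rule nn_integral_cong)
    fix r :: real
    show "ennreal ((1 - exp (- l * r)) / r powr (1 + \<sigma>)) * indicator {0<..} r = (\<integral>\<^sup>+u. G r u \<partial>lborel)"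
    proof (cases "r > 0")
      case True
      have "(\<integral>\<^sup>+u. ennreal (l * exp (- l * u)) * indicator {0..r} u \<partial>lborel) = ennreal (- exp (- l * r) - (- exp (- l * 0)))"
        using True l by (intro nn_integral_FTC_Icc) (auto intro!: derivative_eq_intros)
      moreover have "ennreal (if 0 \<le> u \<and> u \<le> r then l * exp (- l * u) else 0) = ennreal (l * exp (- l * u)) * indicator {0..r} u" for u
        by (simp add: indicator_def)
      ultimately have "(\<integral>\<^sup>+u. ennreal (if 0 \<le> u \<and> u \<le> r then l * exp (- l * u) else 0) \<partial>lborel) = ennreal (1 - exp (- l * r))"
        by (simp add: algebra_simps)
      then show ?thesis using True l
        unfolding G_def by (subst nn_integral_multc) (auto simp: ennreal_mult''[symmetric])
    qed (simp add: G_def)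
  qed
  also have "\<dots> = (\<integral>\<^sup>+u. (\<integral>\<^sup>+r. G r u \<partial>lborel) \<partial>lborel)"
    by (rule lborel_pair.Fubini'[OF G_meas, symmetric])
  also have "\<dots> = (\<integral>\<^sup>+u. ennreal (l * exp (- l * u) * indicator {0..} u * (u powr (- \<sigma>) / \<sigma>)) \<partial>lborel)"
  proof (rule nn_integral_cong_AE)
    have "AE u in lborel. u \<noteq> (0::real)" by (rule AE_lborel_singleton)
    then show "AE u in lborel. (\<integral>\<^sup>+r. G r u \<partial>lborel) = ennreal (l * exp (- l * u) * indicator {0..} u * (u powr (- \<sigma>) / \<sigma>))"
    proof eventually_elim
      case (elim u)
      show ?case
      proof (cases "u > 0")
        case True
        have "(\<integral>\<^sup>+r. ennreal (r powr (- \<sigma> - 1)) * indicator {u..} r \<partial>lborel) = ennreal (0 - (- (u powr (- \<sigma>) / \<sigma>)))"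
        proof (rule nn_integral_FTC_atLeast)
          show "DERIV (\<lambda>r. - (r powr (- \<sigma>) / \<sigma>)) x :> x powr (- \<sigma> - 1)" if "u \<le> x" for x
            using that True \<sigma> by (auto intro!: derivative_eq_intros simp: algebra_simps)
          have "((\<lambda>r. - (r powr (- \<sigma>) / \<sigma>)) \<longlongrightarrow> - (0 / \<sigma>)) at_top"
            using \<sigma> by (intro tendsto_intros tendsto_neg_powr filterlim_ident) auto
          then show "((\<lambda>r. - (r powr (- \<sigma>) / \<sigma>)) \<longlongrightarrow> 0) at_top" by simp
        qed auto
        moreover have "G r u = ennreal (l * exp (- l * u)) * (ennreal (r powr (- \<sigma> - 1)) * indicator {u..} r)" for r
          using True by (auto simp: G_def powr_minus field_simps indicator_def powr_diff powr_add)
        ultimately show ?thesis using True l \<sigma>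
          by (simp add: nn_integral_cmult ennreal_mult[symmetric])
      next
        case False
        then have "u < 0" using elim by simp
        then show ?thesis by (simp add: G_def)
      qed
    qed
  qed
  also have "\<dots> = ennreal \<bar>1 / l\<bar> * (\<integral>\<^sup>+x. ennreal (l * exp (- l * (0 + 1 / l * x)) * indicator {0..} (0 + 1 / l * x) * ((0 + 1 / l * x) powr (- \<sigma>) / \<sigma>)) \<partial>lborel)"
    using l by (intro nn_integral_real_affine) auto
  also have "\<dots> = ennreal \<bar>1 / l\<bar> * (\<integral>\<^sup>+x. ennreal (l * l powr \<sigma> / \<sigma>) * ennreal (indicator {0..} x * x powr (1 - \<sigma> - 1) / exp x) \<partial>lborel)"
  proof (intro arg_cong2[where f="(*)"] refl nn_integral_cong)
    fix x :: real
    show "ennreal (l * exp (- l * (0 + 1 / l * x)) * indicator {0..} (0 + 1 / l * x) * ((0 + 1 / l * x) powr (- \<sigma>) / \<sigma>))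
      = ennreal (l * l powr \<sigma> / \<sigma>) * ennreal (indicator {0..} x * x powr (1 - \<sigma> - 1) / exp x)"
      using l \<sigma> by (cases "x \<ge> 0") (auto simp: ennreal_mult[symmetric] exp_minus powr_divide powr_minus field_simps indicator_def zero_le_divide_iff)
  qed
  also have "\<dots> = ennreal (1 / l) * (ennreal (l * l powr \<sigma> / \<sigma>) * ennreal (Gamma (1 - \<sigma>)))"
    using l \<sigma> by (subst nn_integral_cmult) (auto simp: Gamma_conv_nn_integral_real)
  also have "\<dots> = ennreal (- Gamma (- \<sigma>) * l powr \<sigma>)"
    using l \<sigma> Gamma_neg_less_0[OF \<sigma>] by (simp add: ennreal_mult[symmetric] mult_le_0_iff)
  finally show ?thesis .
qed

definition heat_increment :: "real \<Rightarrow> real \<Rightarrow> real \<Rightarrow> real"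
  where "heat_increment \<sigma> l r = (exp (- l * r) - 1) / r powr (1 + \<sigma>)"

text \<open>The truncated operator \<open>frac_laplacian_trunc (2 * \<sigma>) \<epsilon>\<close> multiplies the coefficient number \<open>k\<close>
  by this number, with \<open>l = k\<^sup>2\<close> the eigenvalue of \<open>-\<Delta>\<close>.\<close>

definition trunc_symbol :: "real \<Rightarrow> real \<Rightarrow> real \<Rightarrow> real"
  where "trunc_symbol \<sigma> \<epsilon> l = 1 / Gamma (- \<sigma>) * (LINT r|lebesgue_on {\<epsilon>..}. heat_increment \<sigma> l r)"

lemma heat_increment_measurable [measurable]: "heat_increment \<sigma> l \<in> borel_measurable borel"
  unfolding heat_increment_def by measurable

lemma integrable_heat_increment:
  assumes \<sigma>: "0 < \<sigma>" "\<sigma> < 1" and l: "l > 0"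
  shows "integrable (lebesgue_on {0<..}) (heat_increment \<sigma> l)"
    "(LINT r|lebesgue_on {0<..}. heat_increment \<sigma> l r) = Gamma (- \<sigma>) * l powr \<sigma>"
proof -
  have neg: "Gamma (- \<sigma>) < 0" by (rule Gamma_neg_less_0[OF \<sigma>])
  have e: "(\<integral>\<^sup>+r. ennreal (- heat_increment \<sigma> l r) \<partial>lebesgue_on {0<..}) = ennreal (- Gamma (- \<sigma>) * l powr \<sigma>)"
    unfolding nn_integral_frac_power[OF assms, symmetric] heat_increment_def by (simp add: minus_divide_left)
  have "has_bochner_integral (lebesgue_on {0<..}) (\<lambda>r. - heat_increment \<sigma> l r) (- Gamma (- \<sigma>) * l powr \<sigma>)"
    using e neg l
    by (intro has_bochner_integral_nn_integral)
      (auto intro!: AE_I2 divide_nonpos_nonneg mult_nonpos_nonneg simp: heat_increment_def mult_le_0_iff)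
  from has_bochner_integral_minus[OF this]
  show "integrable (lebesgue_on {0<..}) (heat_increment \<sigma> l)"
    "(LINT r|lebesgue_on {0<..}. heat_increment \<sigma> l r) = Gamma (- \<sigma>) * l powr \<sigma>"
    by (auto simp: has_bochner_integral_iff)
qed

lemma integrable_lebesgue_on_mono:
  fixes f :: "real \<Rightarrow> real"
  assumes "integrable (lebesgue_on U) f" "S \<subseteq> U" "S \<in> sets lebesgue" "U \<in> sets lebesgue"
  shows "integrable (lebesgue_on S) f"
proof -
  have "set_integrable lebesgue U f" using assms by (simp add: set_integrable_def integrable_restrict_space)
  then have "set_integrable lebesgue S f" by (rule set_integrable_subset) (use assms in auto)
  then show ?thesis using assms by (simp add: set_integrable_def integrable_restrict_space)
qed

lemma powr_minus_trunc_symbol: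
  assumes \<sigma>: "0 < \<sigma>" "\<sigma> < 1" and l: "l > 0" and \<epsilon>: "\<epsilon> > 0"
  shows "l powr \<sigma> - trunc_symbol \<sigma> \<epsilon> l = 1 / Gamma (- \<sigma>) * (LINT r|lebesgue_on {0<..<\<epsilon>}. heat_increment \<sigma> l r)"
proof -
  have S: "{0<..} = {0<..<\<epsilon>} \<union> {\<epsilon>..}" using \<epsilon> by auto
  have i: "set_integrable lebesgue {0<..} (heat_increment \<sigma> l)"
    using integrable_heat_increment(1)[OF \<sigma> l] by (simp add: set_integrable_def integrable_restrict_space)
  have "(LINT r:{0<..<\<epsilon>} \<union> {\<epsilon>..}|lebesgue. heat_increment \<sigma> l r) =
      (LINT r:{0<..<\<epsilon>}|lebesgue. heat_increment \<sigma> l r) + (LINT r:{\<epsilon>..}|lebesgue. heat_increment \<sigma> l r)"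
    using \<epsilon> by (intro set_integral_Un set_integrable_subset[OF i]) auto
  then have "Gamma (- \<sigma>) * l powr \<sigma> = 
     (LINT r|lebesgue_on {0<..<\<epsilon>}. heat_increment \<sigma> l r) + (LINT r|lebesgue_on {\<epsilon>..}. heat_increment \<sigma> l r)"
    using integrable_heat_increment(2)[OF \<sigma> l]
    by (simp add: set_lebesgue_integral_def integral_restrict_space flip: S)
  moreover have "Gamma (- \<sigma>) \<noteq> 0" using Gamma_neg_less_0[OF \<sigma>] by simp
  ultimately show ?thesis by (simp add: trunc_symbol_def field_simps)
qed

lemma nn_integral_powr_0:
  fixes a \<epsilon> :: real
  assumes "a > -1" "\<epsilon> \<ge> 0"
  shows "(\<integral>\<^sup>+r. ennreal (r powr a) \<partial>lebesgue_on {0<..<\<epsilon>}) = ennreal (\<epsilon> powr (a + 1) / (a + 1))"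
    and "integrable (lebesgue_on {0<..<\<epsilon>}) (\<lambda>r. r powr a)"
    and "(LINT r|lebesgue_on {0<..<\<epsilon>}. r powr a) = \<epsilon> powr (a + 1) / (a + 1)"
proof -
  have "((\<lambda>x. x powr a) has_integral (\<epsilon> powr (a + 1) / (a + 1))) {0<..<\<epsilon>}"
    using has_integral_powr_from_0[OF assms] 
    by (simp only: has_integral_open_interval[of _ _ 0 \<epsilon>, unfolded box_real cbox_interval])
  then have "((\<lambda>x. indicator {0<..<\<epsilon>} x * x powr a) has_integral (\<epsilon> powr (a + 1) / (a + 1))) UNIV"
    by (subst (asm) has_integral_restrict_UNIV[symmetric]) (simp add: indicator_def of_bool_def if_distrib[of "\<lambda>z. z * _"] cong: if_cong)
  then have "(\<integral>\<^sup>+x. ennreal (indicator {0<..<\<epsilon>} x * x powr a) \<partial>lborel) = ennreal (\<epsilon> powr (a + 1) / (a + 1))"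
    by (intro nn_integral_has_integral_lborel) auto
  then show e: "(\<integral>\<^sup>+r. ennreal (r powr a) \<partial>lebesgue_on {0<..<\<epsilon>}) = ennreal (\<epsilon> powr (a + 1) / (a + 1))"
    by (simp add: nn_integral_lebesgue_on_eq_lborel ennreal_mult' ennreal_indicator mult.commute)
  have "has_bochner_integral (lebesgue_on {0<..<\<epsilon>}) (\<lambda>r. r powr a) (\<epsilon> powr (a + 1) / (a + 1))"
    using e assms by (intro has_bochner_integral_nn_integral) auto
  then show "integrable (lebesgue_on {0<..<\<epsilon>}) (\<lambda>r. r powr a)"
    "(LINT r|lebesgue_on {0<..<\<epsilon>}. r powr a) = \<epsilon> powr (a + 1) / (a + 1)"
    by (auto simp: has_bochner_integral_iff)
qed

lemma abs_heat_increment_le: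
  assumes "0 < \<theta>" "\<theta> \<le> 1" "l \<ge> 0" "r > 0"
  shows "\<bar>heat_increment \<sigma> l r\<bar> \<le> l powr \<theta> * r powr (\<theta> - \<sigma> - 1)"
proof -
  have "\<bar>exp (- l * r) - 1\<bar> = 1 - exp (- (l * r))" using assms by simp
  also have "\<dots> \<le> (l * r) powr \<theta>" by (rule one_minus_exp_le_powr) (use assms in auto)
  finally have "\<bar>exp (- l * r) - 1\<bar> / r powr (1 + \<sigma>) \<le> (l * r) powr \<theta> / r powr (1 + \<sigma>)"
    by (rule divide_right_mono) simp
  also have "\<dots> = l powr \<theta> * r powr (\<theta> - \<sigma> - 1)"
    using assms by (simp add: powr_mult powr_diff powr_add)
  finally show ?thesis by (simp add: heat_increment_def)
qed

text \<open>The defect is an integral over \<open>(0, \<epsilon>)\<close>, where \<open>1 - exp (-l r) \<le> (l r)\<^sup>\<theta>\<close>. A power \<open>\<theta>\<close> above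
  \<open>\<sigma>\<close> makes it small with \<open>\<epsilon>\<close>, at the price of the larger power \<open>l\<^sup>\<theta>\<close>.\<close>

lemma abs_powr_minus_trunc_symbol_le:
  assumes \<sigma>: "0 < \<sigma>" "\<sigma> < 1" and l: "l > 0" and \<epsilon>: "\<epsilon> > 0" and \<theta>: "\<sigma> < \<theta>" "\<theta> \<le> 1"
  shows "\<bar>l powr \<sigma> - trunc_symbol \<sigma> \<epsilon> l\<bar> \<le> 1 / \<bar>Gamma (- \<sigma>)\<bar> * (\<epsilon> powr (\<theta> - \<sigma>) / (\<theta> - \<sigma>)) * l powr \<theta>"
proof -
  have h: "integrable (lebesgue_on {0<..<\<epsilon>}) (heat_increment \<sigma> l)"
    using integrable_heat_increment(1)[OF \<sigma> l] by (rule integrable_lebesgue_on_mono) auto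
  have "\<bar>LINT r|lebesgue_on {0<..<\<epsilon>}. heat_increment \<sigma> l r\<bar> \<le> (LINT r|lebesgue_on {0<..<\<epsilon>}. \<bar>heat_increment \<sigma> l r\<bar>)"
    by (rule integral_abs_bound)
  also have "\<dots> \<le> (LINT r|lebesgue_on {0<..<\<epsilon>}. l powr \<theta> * r powr (\<theta> - \<sigma> - 1))"
    using h nn_integral_powr_0(2)[of "\<theta> - \<sigma> - 1" \<epsilon>] \<theta> \<epsilon> \<sigma> l
    by (intro integral_mono) (auto intro!: abs_heat_increment_le)
  also have "\<dots> = l powr \<theta> * (\<epsilon> powr (\<theta> - \<sigma>) / (\<theta> - \<sigma>))"
    using nn_integral_powr_0(3)[of "\<theta> - \<sigma> - 1" \<epsilon>] \<theta> \<epsilon> by simp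
  finally show ?thesis
    unfolding powr_minus_trunc_symbol[OF \<sigma> l \<epsilon>]
    using mult_left_mono[of _ _ "1 / \<bar>Gamma (- \<sigma>)\<bar>"] by (fastforce simp: abs_mult mult_ac)
qed

lemma tendsto_trunc_symbol:
  assumes \<sigma>: "0 < \<sigma>" "\<sigma> < 1" and l: "l > 0"
  shows "((\<lambda>\<epsilon>. trunc_symbol \<sigma> \<epsilon> l) \<longlongrightarrow> l powr \<sigma>) (at_right 0)"
proof -
  have "((\<lambda>\<epsilon>. 1 / \<bar>Gamma (- \<sigma>)\<bar> * (\<epsilon> powr (1 - \<sigma>) / (1 - \<sigma>)) * l powr 1) \<longlongrightarrow> 1 / \<bar>Gamma (- \<sigma>)\<bar> * (0 powr (1 - \<sigma>) / (1 - \<sigma>)) * l powr 1) (at_right 0)"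
    using \<sigma> by (intro tendsto_intros tendsto_powr2 tendsto_ident_at) (auto simp: eventually_at_right_less eventually_at_filter)
  then have "((\<lambda>\<epsilon>. 1 / \<bar>Gamma (- \<sigma>)\<bar> * (\<epsilon> powr (1 - \<sigma>) / (1 - \<sigma>)) * l powr 1) \<longlongrightarrow> 0) (at_right 0)" by simp
  moreover have "\<forall>\<^sub>F \<epsilon> in at_right 0. norm (l powr \<sigma> - trunc_symbol \<sigma> \<epsilon> l) \<le> 1 / \<bar>Gamma (- \<sigma>)\<bar> * (\<epsilon> powr (1 - \<sigma>) / (1 - \<sigma>)) * l powr 1"
    using abs_powr_minus_trunc_symbol_le[OF \<sigma> l _ \<sigma>(2)] eventually_at_right_less[of 0]
    by (auto elim!: eventually_mono)
  ultimately have "((\<lambda>\<epsilon>. l powr \<sigma> - trunc_symbol \<sigma> \<epsilon> l) \<longlongrightarrow> 0) (at_right 0)"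
    by (rule Lim_null_comparison[rotated])
  from tendsto_diff[OF tendsto_const[of "l powr \<sigma>"] this] show ?thesis by simp
qed

section \<open>The heat semigroup and fractional powers on integrable functions\<close>

text \<open>Each term is at most \<open>1 / (1 + k\<^sup>2 \<tau>)\<close>, hence by the mean value theorem at most a difference
  of arctangents divided by \<open>sqrt \<tau>\<close>; the sum telescopes.\<close>

lemma exp_square_sum:
  fixes \<tau> :: real
  assumes "\<tau> > 0"
  shows "summable (\<lambda>j. exp (- (real (Suc j))\<^sup>2 * \<tau>))"
    and "(\<Sum>j. exp (- (real (Suc j))\<^sup>2 * \<tau>)) \<le> 2 / sqrt \<tau>"
proof -
  let ?q = "sqrt \<tau>"
  have q: "?q > 0" using assms by simp
  have term_le: "exp (- (real (Suc j))\<^sup>2 * \<tau>) \<le> (arctan (real (Suc j) * ?q) - arctan (real j * ?q)) / ?q" for j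
  proof -
    define a b where "a = real j * ?q" and "b = real (Suc j) * ?q"
    have ab: "a < b" "a \<ge> 0" "b - a = ?q" using q by (auto simp: a_def b_def algebra_simps)
    have "DERIV arctan x :> 1 / (1 + x\<^sup>2)" for x :: real
      by (auto intro!: derivative_eq_intros simp: inverse_eq_divide)
    from MVT2[OF ab(1) this] obtain z where z: "a < z" "z < b" "arctan b - arctan a = (b - a) * (1 / (1 + z\<^sup>2))"
      by blast
    have "z\<^sup>2 \<le> b\<^sup>2" using z ab by (intro power_mono) auto
    have "exp (- (real (Suc j))\<^sup>2 * \<tau>) = inverse (exp (b\<^sup>2))"
      using assms by (simp add: b_def power_mult_distrib exp_minus)
    also have "\<dots> \<le> inverse (1 + z\<^sup>2)"
    proof (rule le_imp_inverse_le)
      show "1 + z\<^sup>2 \<le> exp (b\<^sup>2)" using exp_ge_add_one_self[of "b\<^sup>2"] \<open>z\<^sup>2 \<le> b\<^sup>2\<close> by linarith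
    qed (simp add: add_pos_nonneg)
    also have "\<dots> = (arctan b - arctan a) / ?q" using z(3) ab(3) q by (simp add: inverse_eq_divide)
    finally show ?thesis by (simp add: a_def b_def)
  qed
  have part: "(\<Sum>j<n. exp (- (real (Suc j))\<^sup>2 * \<tau>)) \<le> 2 / ?q" for n
  proof -
    have "(\<Sum>j<n. exp (- (real (Suc j))\<^sup>2 * \<tau>)) \<le> (\<Sum>j<n. (arctan (real (Suc j) * ?q) - arctan (real j * ?q)) / ?q)"
      by (intro sum_mono term_le)
    also have "\<dots> = (arctan (real n * ?q) - arctan (real 0 * ?q)) / ?q"
      unfolding sum_divide_distrib[symmetric] by (subst sum_lessThan_telescope) auto
    also have "\<dots> \<le> 2 / ?q"
      using arctan_ubound[of "real n * ?q"] pi_less_4 q by (intro divide_right_mono) auto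
    finally show ?thesis .
  qed
  show s: "summable (\<lambda>j. exp (- (real (Suc j))\<^sup>2 * \<tau>))"
    by (rule summableI_nonneg_bounded[OF _ part]) simp
  show "(\<Sum>j. exp (- (real (Suc j))\<^sup>2 * \<tau>)) \<le> 2 / sqrt \<tau>"
    by (rule suminf_le_const[OF s part])
qed

definition heat_symbol :: "real \<Rightarrow> nat \<Rightarrow> real"
  where "heat_symbol t k = exp (- (real k)\<^sup>2 * t)"

lemma heat_symbol_summable:
  assumes "t > 0"
  shows "summable (\<lambda>j. \<bar>heat_symbol t (Suc j)\<bar>)" "(\<Sum>j. \<bar>heat_symbol t (Suc j)\<bar>) \<le> 2 / sqrt t"
  using exp_square_sum[OF assms] by (auto simp: heat_symbol_def)

lemma heat_symbol_measurable [measurable]: "(\<lambda>t. heat_symbol t k) \<in> borel_measurable borel"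
  unfolding heat_symbol_def by measurable

lemma heat_symbol_pos: "heat_symbol t k > 0"
  by (simp add: heat_symbol_def)

lemma heat_symbol_mult: "heat_symbol s k * heat_symbol t k = heat_symbol (s + t) k"
  by (simp add: heat_symbol_def exp_add[symmetric] algebra_simps)

lemma heat_kernel_eq: "heat_kernel t = sine_kernel (heat_symbol t)"
  by (simp add: fun_eq_iff heat_kernel_def sine_kernel_def heat_symbol_def)

lemma heat_semigroup_eq:
  assumes "t > 0" "integrable interval_pi f"
  shows "heat_semigroup t f x = sine_series (\<lambda>k. heat_symbol t k * sine_coef f k) x"
  unfolding heat_semigroup_def heat_kernel_eq
  by (rule integral_kernel_eq_sine_series(2)[OF heat_symbol_summable(1)[OF assms(1)] assms(2)])

lemma summable_heat_coef:
  assumes "t > 0" and c: "\<And>k. k \<ge> 1 \<Longrightarrow> \<bar>c k\<bar> \<le> C"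
  shows "summable (\<lambda>j. \<bar>heat_symbol t (Suc j) * c (Suc j)\<bar>)"
    and "(\<Sum>j. \<bar>heat_symbol t (Suc j) * c (Suc j)\<bar>) \<le> 2 / sqrt t * C"
proof -
  have sC: "summable (\<lambda>j. \<bar>heat_symbol t (Suc j)\<bar> * C)"
    by (intro summable_mult2 heat_symbol_summable assms)
  have le: "\<bar>heat_symbol t (Suc j) * c (Suc j)\<bar> \<le> \<bar>heat_symbol t (Suc j)\<bar> * C" for j
    unfolding abs_mult by (intro mult_left_mono c) auto
  show s: "summable (\<lambda>j. \<bar>heat_symbol t (Suc j) * c (Suc j)\<bar>)"
    by (rule summable_comparison_test'[OF sC]) (use le in auto)
  have "C \<ge> 0" using c[of 1] by simp
  have "(\<Sum>j. \<bar>heat_symbol t (Suc j) * c (Suc j)\<bar>) \<le> (\<Sum>j. \<bar>heat_symbol t (Suc j)\<bar> * C)"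
    by (intro suminf_le s sC le)
  also have "\<dots> \<le> 2 / sqrt t * C"
    unfolding suminf_mult2[OF heat_symbol_summable(1)[OF assms(1)], symmetric]
    by (intro mult_right_mono heat_symbol_summable assms \<open>C \<ge> 0\<close>)
  finally show "(\<Sum>j. \<bar>heat_symbol t (Suc j) * c (Suc j)\<bar>) \<le> 2 / sqrt t * C" .
qed

lemma integrable_prod_mult:
  fixes u :: "'a \<Rightarrow> real" and v :: "'b \<Rightarrow> real"
  assumes "pair_sigma_finite M N" "integrable M u" "integrable N v"
  shows "integrable (M \<Otimes>\<^sub>M N) (\<lambda>(x, y). u x * v y)"
proof -
  interpret pair_sigma_finite M N by fact
  have [measurable]: "u \<in> borel_measurable M" "v \<in> borel_measurable N" using assms by auto
  show ?thesis
  proof (rule Fubini_integrable)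
    show "integrable M (\<lambda>x. LINT y|N. norm (case (x, y) of (x, y) \<Rightarrow> u x * v y))"
      using assms(2) by (simp add: abs_mult)
  qed (use assms in \<open>auto simp: case_prod_beta'\<close>)
qed

lemma sigma_finite_lebesgue_on: "S \<in> sets lebesgue \<Longrightarrow> sigma_finite_measure (lebesgue_on (S :: real set))"
proof (rule sigma_finite_measure_restrict_space)
  show "sigma_finite_measure (lebesgue :: real measure)"
  proof
    obtain A :: "real set set" where A: "countable A" "A \<subseteq> sets lborel" "\<Union>A = space lborel" "\<forall>a\<in>A. emeasure lborel a \<noteq> \<infinity>"
      using lborel.sigma_finite_countable by blast
    then show "\<exists>A. countable A \<and> A \<subseteq> sets (lebesgue :: real measure) \<and> \<Union>A = space lebesgue \<and> (\<forall>a\<in>A. emeasure lebesgue a \<noteq> \<infinity>)"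
      by (intro exI[of _ A]) auto
  qed
qed

text \<open>For \<open>t \<ge> \<epsilon>\<close> the semigroup is given by a sine series that is bounded uniformly in \<open>t\<close> and
  \<open>x\<close>, so that the truncated integral converges absolutely on the product space and Fubini's theorem
  computes its coefficients.\<close>

lemma frac_laplacian_trunc_L1:
  assumes s: "0 < s" "s < 2" and f: "integrable interval_pi f" and \<epsilon>: "\<epsilon> > 0"
  shows "integrable (lebesgue_on {\<epsilon>..}) (\<lambda>t. (heat_semigroup t f x - f x) / t powr (1 + s / 2))" (is ?A)
    and "integrable interval_pi (frac_laplacian_trunc s \<epsilon> f)" (is ?B)
    and "k \<ge> 1 \<Longrightarrow> sine_coef (frac_laplacian_trunc s \<epsilon> f) k = trunc_symbol (s / 2) \<epsilon> ((real k)\<^sup>2) * sine_coef f k" (is "_ \<Longrightarrow> ?C")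
proof -
  let ?R = "lebesgue_on {\<epsilon>..}" and ?I = interval_pi
  define \<sigma> where "\<sigma> = s / 2"
  have \<sigma>: "0 < \<sigma>" "\<sigma> < 1" using s by (auto simp: \<sigma>_def)
  interpret R: sigma_finite_measure ?R by (rule sigma_finite_lebesgue_on) auto
  interpret RI: pair_sigma_finite ?R ?I ..
  define L where "L = (LINT y|?I. \<bar>f y\<bar>)"
  have cL: "\<bar>sine_coef f k\<bar> \<le> L" for k unfolding L_def by (rule sine_coef_le[OF f])
  have L0: "L \<ge> 0" by (simp add: L_def)
  define S where "S r x = sine_series (\<lambda>k. heat_symbol r k * sine_coef f k) x" for r x
  define h where "h r x = (S r x - f x) * r powr (- \<sigma> - 1)" for r x
  have [measurable]: "f \<in> borel_measurable ?I" using f by auto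
  have [measurable]: "(\<lambda>z. S (fst z) (snd z)) \<in> borel_measurable (?R \<Otimes>\<^sub>M ?I)" unfolding S_def by measurable
  have [measurable]: "(\<lambda>r. S r x) \<in> borel_measurable ?R" for x unfolding S_def by measurable
  have Sb: "\<bar>S r x\<bar> \<le> 2 / sqrt \<epsilon> * L" if "r \<ge> \<epsilon>" for r x
  proof -
    have r: "r > 0" using that \<epsilon> by simp
    have "\<bar>S r x\<bar> \<le> 2 / sqrt r * L"
      unfolding S_def by (rule order_trans[OF abs_sine_series_le summable_heat_coef(2)[OF r cL]]) (rule summable_heat_coef(1)[OF r cL])
    also have "\<dots> \<le> 2 / sqrt \<epsilon> * L" using that \<epsilon> L0 by (intro mult_right_mono divide_left_mono) auto
    finally show ?thesis .
  qed
  have pw: "integrable ?R (\<lambda>r. r powr (- \<sigma> - 1))"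
  proof -
    have "((\<lambda>r. r powr (- \<sigma> - 1)) has_integral - (\<epsilon> powr (- \<sigma> - 1 + 1)) / (- \<sigma> - 1 + 1)) {\<epsilon>..}"
      using \<sigma> \<epsilon> by (intro has_integral_powr_to_inf) auto
    then have "(\<lambda>r. r powr (- \<sigma> - 1)) absolutely_integrable_on {\<epsilon>..}"
      by (intro nonnegative_absolutely_integrable_1) (auto simp: has_integral_integrable)
    then show ?thesis by (simp add: set_integrable_def integrable_restrict_space)
  qed
  have pm: "r powr (- \<sigma> - 1) = 1 / r powr (1 + \<sigma>)" for r
  proof -
    have "- \<sigma> - 1 = - (1 + \<sigma>)" by simp
    then show ?thesis by (simp only: powr_minus_divide)
  qed
  have heq: "(heat_semigroup t f x - f x) / t powr (1 + s / 2) = h t x" if "t \<in> {\<epsilon>..}" for t x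
    using that \<epsilon> f by (simp add: h_def S_def heat_semigroup_eq pm[unfolded \<sigma>_def] \<sigma>_def)
  have hb: "\<bar>h r x\<bar> \<le> r powr (- \<sigma> - 1) * (2 / sqrt \<epsilon> * L + \<bar>f x\<bar>)" if "r \<in> {\<epsilon>..}" for r x
  proof -
    have "\<bar>S r x - f x\<bar> \<le> 2 / sqrt \<epsilon> * L + \<bar>f x\<bar>" using Sb[of r x] that by simp
    from mult_right_mono[OF this, of "r powr (- \<sigma> - 1)"] show ?thesis by (simp add: h_def abs_mult mult.commute)
  qed
  have "integrable ?R (\<lambda>r. h r x)" for x
  proof (rule Bochner_Integration.integrable_bound)
    show "integrable ?R (\<lambda>r. r powr (- \<sigma> - 1) * (2 / sqrt \<epsilon> * L + \<bar>f x\<bar>))" using pw by simp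
    show "AE r in ?R. norm (h r x) \<le> norm (r powr (- \<sigma> - 1) * (2 / sqrt \<epsilon> * L + \<bar>f x\<bar>))"
      using hb by (intro AE_I2) (auto intro: order_trans[OF _ abs_ge_self])
  qed (unfold h_def, measurable)
  then show ?A by (subst Bochner_Integration.integrable_cong[OF refl heq]) auto
  have hi: "integrable (?R \<Otimes>\<^sub>M ?I) (case_prod h)"
  proof (rule Bochner_Integration.integrable_bound)
    show "integrable (?R \<Otimes>\<^sub>M ?I) (\<lambda>(r, x). r powr (- \<sigma> - 1) * (2 / sqrt \<epsilon> * L + \<bar>f x\<bar>))"
      using f by (intro integrable_prod_mult[OF RI.pair_sigma_finite_axioms pw]) auto
    show "case_prod h \<in> borel_measurable (?R \<Otimes>\<^sub>M ?I)"
      unfolding h_def case_prod_beta' by measurable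
    show "AE z in ?R \<Otimes>\<^sub>M ?I. norm (case_prod h z) \<le> norm (case z of (r, x) \<Rightarrow> r powr (- \<sigma> - 1) * (2 / sqrt \<epsilon> * L + \<bar>f x\<bar>))"
      using hb by (intro AE_I2) (auto simp: space_pair_measure intro: order_trans[OF _ abs_ge_self])
  qed
  have T: "frac_laplacian_trunc s \<epsilon> f x = 1 / Gamma (- \<sigma>) * (LINT r|?R. h r x)" for x
    unfolding frac_laplacian_trunc_def \<sigma>_def[symmetric]
    by (subst Bochner_Integration.integral_cong[OF refl heq[unfolded \<sigma>_def[symmetric]]]) (auto simp: \<sigma>_def)
  show ?B unfolding T using RI.integrable_snd[OF hi] by simp
  assume k: "k \<ge> 1"
  have hki: "integrable (?R \<Otimes>\<^sub>M ?I) (\<lambda>(r, x). h r x * eigenfun k x)"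
  proof (rule Bochner_Integration.integrable_bound[OF hi])
    show "(\<lambda>(r, x). h r x * eigenfun k x) \<in> borel_measurable (?R \<Otimes>\<^sub>M ?I)"
      unfolding h_def case_prod_beta' by measurable
  qed (use abs_sine_term_le(2) in \<open>auto intro!: AE_I2\<close>)
  have inner: "(LINT x|?I. h r x * eigenfun k x) = heat_increment \<sigma> ((real k)\<^sup>2) r * sine_coef f k" if "r \<in> {\<epsilon>..}" for r
  proof -
    have r: "r > 0" using that \<epsilon> by simp
    have SL: "integrable ?I (S r)" 
    proof (rule interval_pi.integrable_const_bound)
      show "AE x in ?I. norm (S r x) \<le> 2 / sqrt \<epsilon> * L" using Sb that by (intro AE_I2) auto
      show "S r \<in> borel_measurable ?I" unfolding S_def by measurable
    qed
    have "(LINT x|?I. h r x * eigenfun k x) = (LINT x|?I. r powr (- \<sigma> - 1) * ((S r x - f x) * eigenfun k x))"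
      by (simp add: h_def mult_ac)
    also have "\<dots> = r powr (- \<sigma> - 1) * (sine_coef (S r) k - sine_coef f k)"
      using sine_coef_diff[OF SL f, of k] by (simp add: sine_coef_def)
    also have "sine_coef (S r) k = heat_symbol r k * sine_coef f k"
      unfolding S_def using sine_coef_sine_series[OF summable_heat_coef(1)[OF r cL] k] .
    finally show ?thesis using r
      by (simp add: heat_increment_def heat_symbol_def pm diff_divide_distrib algebra_simps)
  qed
  have "sine_coef (frac_laplacian_trunc s \<epsilon> f) k = 1 / Gamma (- \<sigma>) * (LINT x|?I. (LINT r|?R. h r x * eigenfun k x))"
    unfolding sine_coef_def T by (simp add: mult.assoc)
  also have "(LINT x|?I. (LINT r|?R. h r x * eigenfun k x)) = (LINT r|?R. (LINT x|?I. h r x * eigenfun k x))"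
    by (rule RI.Fubini_integral[OF hki])
  also have "\<dots> = (LINT r|?R. heat_increment \<sigma> ((real k)\<^sup>2) r * sine_coef f k)"
    by (intro Bochner_Integration.integral_cong) (auto simp: inner)
  also have "\<dots> = (LINT r|?R. heat_increment \<sigma> ((real k)\<^sup>2) r) * sine_coef f k"
    by (rule integral_mult_left_zero)
  finally show ?C by (simp add: trunc_symbol_def \<sigma>_def)
qed

lemma frac_laplacian_smallD:
  assumes "frac_laplacian_small s f g"
  shows "integrable interval_pi f" "integrable interval_pi g"
  using assms by (auto simp: frac_laplacian_small_def Lp_space_1_iff)

text \<open>Coefficients are continuous in \<open>L\<^sub>1\<close>, hence the multiplier of the limit is the limit \<open>k powr s\<close> of the truncated symbols.\<close>

lemma sine_coef_frac_laplacian_small: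
  assumes s: "0 < s" "s < 2" and fg: "frac_laplacian_small s f g" and k: "k \<ge> 1"
  shows "sine_coef g k = real k powr s * sine_coef f k"
proof -
  note int = frac_laplacian_smallD[OF fg]
  let ?T = "\<lambda>\<epsilon>. frac_laplacian_trunc s \<epsilon> f"
  have lim: "((\<lambda>\<epsilon>. \<integral>\<^sup>+x. ennreal \<bar>?T \<epsilon> x - g x\<bar> \<partial>interval_pi) \<longlongrightarrow> 0) (at_right 0)"
    using fg by (simp add: frac_laplacian_small_def)
  have pos: "\<forall>\<^sub>F \<epsilon> in at_right 0. \<epsilon> > (0::real)" by (rule eventually_at_right_less)
  have "((\<lambda>\<epsilon>. ennreal \<bar>sine_coef (?T \<epsilon>) k - sine_coef g k\<bar>) \<longlongrightarrow> 0) (at_right 0)"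
  proof (rule tendsto_sandwich[OF _ _ tendsto_const lim])
    show "\<forall>\<^sub>F \<epsilon> in at_right 0. ennreal \<bar>sine_coef (?T \<epsilon>) k - sine_coef g k\<bar> \<le> (\<integral>\<^sup>+x. ennreal \<bar>?T \<epsilon> x - g x\<bar> \<partial>interval_pi)"
      using pos
    proof eventually_elim
      case (elim \<epsilon>)
      have i: "integrable interval_pi (\<lambda>x. ?T \<epsilon> x - g x)"
        using frac_laplacian_trunc_L1(2)[OF s int(1) elim] int by simp
      have "\<bar>sine_coef (?T \<epsilon>) k - sine_coef g k\<bar> \<le> (LINT x|interval_pi. \<bar>?T \<epsilon> x - g x\<bar>)"
        using sine_coef_le[OF i] sine_coef_diff[OF frac_laplacian_trunc_L1(2)[OF s int(1) elim] int(2)] by simp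
      also have "ennreal \<dots> = (\<integral>\<^sup>+x. ennreal \<bar>?T \<epsilon> x - g x\<bar> \<partial>interval_pi)"
        using i by (intro nn_integral_eq_integral[symmetric]) auto
      finally show ?case by (simp add: ennreal_leI)
    qed
  qed auto
  then have "((\<lambda>\<epsilon>. sine_coef (?T \<epsilon>) k - sine_coef g k) \<longlongrightarrow> 0) (at_right 0)"
    by (simp add: tendsto_ennreal_iff[where x=0, simplified] tendsto_rabs_zero_iff flip: ennreal_0)
  from tendsto_add[OF this tendsto_const[of "sine_coef g k"]]
  have l1: "((\<lambda>\<epsilon>. sine_coef (?T \<epsilon>) k) \<longlongrightarrow> sine_coef g k) (at_right 0)" by simp
  have "((\<lambda>\<epsilon>. trunc_symbol (s/2) \<epsilon> ((real k)\<^sup>2) * sine_coef f k) \<longlongrightarrow> ((real k)\<^sup>2) powr (s/2) * sine_coef f k) (at_right 0)"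
    using s k by (intro tendsto_intros tendsto_trunc_symbol) auto
  moreover have "((real k)\<^sup>2) powr (s/2) = real k powr s"
    using k by (simp add: powr_powr flip: powr_numeral)
  moreover have "\<forall>\<^sub>F \<epsilon> in at_right 0. trunc_symbol (s/2) \<epsilon> ((real k)\<^sup>2) * sine_coef f k = sine_coef (?T \<epsilon>) k"
    using pos by eventually_elim (simp add: frac_laplacian_trunc_L1(3)[OF s int(1) _ k])
  ultimately have "((\<lambda>\<epsilon>. sine_coef (?T \<epsilon>) k) \<longlongrightarrow> real k powr s * sine_coef f k) (at_right 0)"
    by (simp add: Lim_transform_eventually)
  with l1 show ?thesis by (intro tendsto_unique[OF _ l1]) auto
qed

lemma frac_laplacian_small_diff:
  assumes s: "0 < s" "s < 2" and fg: "frac_laplacian_small s f g" and fg': "frac_laplacian_small s f' g'"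
  shows "frac_laplacian_small s (\<lambda>x. f x - f' x) (\<lambda>x. g x - g' x)"
proof -
  note int = frac_laplacian_smallD[OF fg] frac_laplacian_smallD[OF fg']
  let ?d = "\<lambda>f g \<epsilon>. \<integral>\<^sup>+x. ennreal \<bar>frac_laplacian_trunc s \<epsilon> f x - g x\<bar> \<partial>interval_pi"
  have lims: "(?d f g \<longlongrightarrow> 0) (at_right 0)" "(?d f' g' \<longlongrightarrow> 0) (at_right 0)"
    using fg fg' by (auto simp: frac_laplacian_small_def)
  from tendsto_add[OF this] have lim: "((\<lambda>\<epsilon>. ?d f g \<epsilon> + ?d f' g' \<epsilon>) \<longlongrightarrow> 0) (at_right 0)" by simp
  have "(?d (\<lambda>x. f x - f' x) (\<lambda>x. g x - g' x) \<longlongrightarrow> 0) (at_right 0)"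
  proof (rule tendsto_sandwich[OF _ _ tendsto_const lim])
    show "\<forall>\<^sub>F \<epsilon> in at_right 0. ?d (\<lambda>x. f x - f' x) (\<lambda>x. g x - g' x) \<epsilon> \<le> ?d f g \<epsilon> + ?d f' g' \<epsilon>"
      using eventually_at_right_less[of "0::real"]
    proof eventually_elim
      case (elim \<epsilon>)
      have hs: "heat_semigroup t (\<lambda>x. f x - f' x) x = heat_semigroup t f x - heat_semigroup t f' x" if "t > 0" for t x
        unfolding heat_semigroup_def heat_kernel_eq
        using integral_kernel_eq_sine_series(1)[OF heat_symbol_summable(1)[OF that]] int
        by (simp add: right_diff_distrib)
      have T: "frac_laplacian_trunc s \<epsilon> (\<lambda>x. f x - f' x) x = frac_laplacian_trunc s \<epsilon> f x - frac_laplacian_trunc s \<epsilon> f' x" for x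
      proof -
        have "(LINT t|lebesgue_on {\<epsilon>..}. (heat_semigroup t (\<lambda>x. f x - f' x) x - (f x - f' x)) / t powr (1 + s / 2))
          = (LINT t|lebesgue_on {\<epsilon>..}. (heat_semigroup t f x - f x) / t powr (1 + s / 2) - (heat_semigroup t f' x - f' x) / t powr (1 + s / 2))"
          using elim by (intro Bochner_Integration.integral_cong) (auto simp: hs diff_divide_distrib)
        also have "\<dots> = (LINT t|lebesgue_on {\<epsilon>..}. (heat_semigroup t f x - f x) / t powr (1 + s / 2)) - (LINT t|lebesgue_on {\<epsilon>..}. (heat_semigroup t f' x - f' x) / t powr (1 + s / 2))"
          by (intro Bochner_Integration.integral_diff frac_laplacian_trunc_L1 s int elim)
        finally show ?thesis by (simp add: frac_laplacian_trunc_def right_diff_distrib diff_divide_distrib)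
      qed
      have m: "frac_laplacian_trunc s \<epsilon> f \<in> borel_measurable interval_pi" "frac_laplacian_trunc s \<epsilon> f' \<in> borel_measurable interval_pi"
         "g \<in> borel_measurable interval_pi" "g' \<in> borel_measurable interval_pi"
        using frac_laplacian_trunc_L1(2)[OF s int(1) elim] frac_laplacian_trunc_L1(2)[OF s int(3) elim] int by auto
      note [measurable] = m
      have "?d (\<lambda>x. f x - f' x) (\<lambda>x. g x - g' x) \<epsilon> \<le>
        (\<integral>\<^sup>+x. ennreal \<bar>frac_laplacian_trunc s \<epsilon> f x - g x\<bar> + ennreal \<bar>frac_laplacian_trunc s \<epsilon> f' x - g' x\<bar> \<partial>interval_pi)"
        unfolding T by (intro nn_integral_mono) (auto simp: ennreal_plus[symmetric] simp del: ennreal_plus intro!: ennreal_leI)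
      also have "\<dots> = ?d f g \<epsilon> + ?d f' g' \<epsilon>" by (rule nn_integral_add) measurable
      finally show ?case .
    qed
  qed auto
  then show ?thesis using int by (simp add: frac_laplacian_small_def Lp_space_1_iff)
qed

section \<open>The integral norm of a cosine series with smooth coefficients\<close>

text \<open>From \<open>u cos u \<le> sin u\<close> at \<open>u = t / 2\<close> and the double angle formula, \<open>t (1 + cos t) / 2 \<le> sin t\<close>.\<close>

lemma sin_ge_half:
  fixes t :: real
  assumes "0 \<le> t" "t \<le> pi / 2"
  shows "t / 2 \<le> sin t"
proof -
  define u where "u = t / 2"
  have u: "0 \<le> u" "u \<le> pi / 2" "t = 2 * u" using assms by (auto simp: u_def)
  have "sin 0 - 0 * cos 0 \<le> sin u - u * cos u"
  proof (rule DERIV_nonneg_imp_nondecreasing[of 0 u "\<lambda>x. sin x - x * cos x"])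
    fix x assume x: "0 \<le> x" "x \<le> u"
    have "sin x \<ge> 0" using x u by (intro sin_ge_zero) (auto intro: order_trans)
    then show "\<exists>y. ((\<lambda>x. sin x - x * cos x) has_real_derivative y) (at x) \<and> 0 \<le> y"
      using x by (intro exI[of _ "x * sin x"]) (auto intro!: derivative_eq_intros)
  qed (use u in auto)
  then have "u * cos u \<le> sin u" by simp
  moreover have cu: "cos u \<ge> 0" using u by (intro cos_ge_zero) auto
  ultimately have "u * cos u * cos u \<le> sin u * cos u" by (intro mult_right_mono)
  moreover have "sin t = 2 * sin u * cos u" by (simp add: u(3) sin_double)
  moreover have "2 * (cos u * cos u) = 1 + cos t" by (simp add: u(3) cos_double_cos power2_eq_square)
  moreover have "0 \<le> cos t" using assms by (intro cos_ge_zero) auto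
  ultimately have "t * (1 + cos t) / 2 \<le> sin t"
  proof -
    have "t * (1 + cos t) / 2 = u * (2 * (cos u * cos u))"
      unfolding \<open>2 * (cos u * cos u) = 1 + cos t\<close> using u(3) by simp
    also have "\<dots> = 2 * (u * cos u * cos u)" by simp
    also have "\<dots> \<le> 2 * (sin u * cos u)" using \<open>u * cos u * cos u \<le> sin u * cos u\<close> by simp
    also have "\<dots> = sin t" using \<open>sin t = 2 * sin u * cos u\<close> by simp
    finally show ?thesis .
  qed
  moreover have "t * 1 \<le> t * (1 + cos t)" using assms \<open>0 \<le> cos t\<close> by (intro mult_left_mono) auto
  ultimately show ?thesis by simp
qed

lemma one_minus_cos_ge:
  assumes "\<bar>\<theta>\<bar> \<le> pi"
  shows "\<theta>\<^sup>2 / 4 \<le> 2 - 2 * cos \<theta>"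
proof -
  have "\<bar>\<theta>\<bar> / 2 / 2 \<le> sin (\<bar>\<theta>\<bar> / 2)" by (rule sin_ge_half) (use assms in auto)
  then have "(\<bar>\<theta>\<bar> / 2 / 2)\<^sup>2 \<le> (sin (\<bar>\<theta>\<bar> / 2))\<^sup>2" by (intro power_mono) auto
  moreover have "cos \<theta> = 1 - 2 * (sin (\<bar>\<theta>\<bar> / 2))\<^sup>2"
    using cos_double_sin[of "\<bar>\<theta>\<bar> / 2"] by simp
  ultimately show ?thesis by (simp add: power_divide)
qed

lemma integral_cos_shift:
  "integrable (lebesgue_on {-pi<..<pi}) (\<lambda>y. cos (real_of_int n * (x - y)))"
  "(LINT y|lebesgue_on {-pi<..<pi}. cos (real_of_int n * (x - y))) = (if n = 0 then 2 * pi else 0)"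
proof -
  have "integrable (lebesgue_on {-pi..pi}) (\<lambda>y. cos (real_of_int n * (x - y)))"
    by (intro continuous_imp_integrable_real continuous_intros)
  then show i: "integrable (lebesgue_on {-pi<..<pi}) (\<lambda>y. cos (real_of_int n * (x - y)))"
    by (rule integrable_lebesgue_on_mono) auto
  have "((\<lambda>y. cos (real_of_int n * (x - y))) has_integral (if n = 0 then 2 * pi else 0)) {-pi..pi}"
  proof (cases "n = 0")
    case True
    then show ?thesis using has_integral_const_real[of "1::real" "-pi" pi] by simp
  next
    case False
    let ?F = "\<lambda>y. - sin (real_of_int n * (x - y)) / n"
    have "((\<lambda>y. cos (real_of_int n * (x - y))) has_integral (?F pi - ?F (- pi))) {-pi..pi}"
      using False by (intro fundamental_theorem_of_calculus)
        (auto intro!: derivative_eq_intros simp: has_real_derivative_iff_has_vector_derivative[symmetric])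
    moreover have "sin (real_of_int n * (x - (- pi))) = sin (real_of_int n * (x - pi))"
    proof -
      have "real_of_int n * (x - (- pi)) = real_of_int n * (x - pi) + 2 * pi * real_of_int n" by (simp add: algebra_simps)
      then show ?thesis using sin_int_2pin[of n] cos_int_2pin[of n] by (simp only: sin_add mult_1_right mult_zero_right add_0_right)
    qed
    ultimately show ?thesis using False by simp
  qed
  then have "((\<lambda>y. cos (real_of_int n * (x - y))) has_integral (if n = 0 then 2 * pi else 0)) {-pi<..<pi}"
    by (simp only: has_integral_open_interval[of _ _ "-pi" pi, unfolded box_real cbox_interval])
  moreover have "((\<lambda>y. cos (real_of_int n * (x - y))) has_integral (LINT y|lebesgue_on {-pi<..<pi}. cos (real_of_int n * (x - y)))) {-pi<..<pi}"
    using i by (intro has_integral_integral_lebesgue_on) auto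
  ultimately show "(LINT y|lebesgue_on {-pi<..<pi}. cos (real_of_int n * (x - y))) = (if n = 0 then 2 * pi else 0)"
    by (rule has_integral_unique[rotated])
qed

definition trig_series :: "(nat \<Rightarrow> real) \<Rightarrow> real \<Rightarrow> complex"
  where "trig_series d \<theta> = (\<Sum>j. of_real (d j) * cis (real j * \<theta>))"

lemma trig_series_summable: "summable (\<lambda>j. \<bar>d j\<bar>) \<Longrightarrow> summable (\<lambda>j. of_real (d j) * cis (real j * \<theta>))"
  by (rule summable_norm_cancel) (simp add: norm_mult)

lemma borel_measurable_cis_compose [measurable]:
  "g \<in> borel_measurable N \<Longrightarrow> (\<lambda>z. cis (g z)) \<in> borel_measurable N"
  by (rule measurable_compose[OF _ borel_measurable_continuous_onI]) (auto intro!: continuous_intros)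

lemma trig_series_measurable [measurable]:
  "g \<in> borel_measurable N \<Longrightarrow> (\<lambda>z. trig_series d (g z)) \<in> borel_measurable N"
  unfolding trig_series_def by measurable

text \<open>The trigonometric polynomials are orthogonal on any period, in particular for \<open>y\<close> in \<open>(-\<pi>, \<pi>)\<close>
  after the shift by \<open>x\<close>; Fatou's lemma passes from the partial sums to the series.\<close>

lemma trig_series_Bessel:
  assumes d: "summable (\<lambda>j. \<bar>d j\<bar>)" and q: "\<And>N. (\<Sum>j<N. (d j)\<^sup>2) \<le> Q"
  shows "(\<integral>\<^sup>+y. ennreal ((cmod (trig_series d (x - y)))\<^sup>2) \<partial>lebesgue_on {-pi<..<pi}) \<le> ennreal (2 * pi * Q)"
proof -
  let ?J = "lebesgue_on {-pi<..<pi}"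
  define S where "S N y = (\<Sum>j<N. of_real (d j) * cis (real j * (x - y)))" for N y
  have lim: "(\<lambda>N. S N y) \<longlonglongrightarrow> trig_series d (x - y)" for y
    unfolding S_def trig_series_def by (rule summable_LIMSEQ[OF trig_series_summable[OF d]])
  have [measurable]: "(\<lambda>y. x - y) \<in> borel_measurable ?J" by measurable
  have Sm[measurable]: "S N \<in> borel_measurable ?J" for N unfolding S_def by measurable
  have sq: "(cmod (S N y))\<^sup>2 = (\<Sum>i<N. \<Sum>j<N. d i * d j * cos (real_of_int (int i - int j) * (x - y)))" for N y
  proof -
    have "(cmod (S N y))\<^sup>2 = Re (S N y * cnj (S N y))"
      by (simp add: complex_norm_square[symmetric] flip: of_real_power)
    also have "S N y * cnj (S N y) = (\<Sum>i<N. \<Sum>j<N. of_real (d i * d j) * (cis (real i * (x - y)) * cis (- (real j * (x - y)))))"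
      unfolding S_def cnj_sum sum_product by (intro sum.cong refl) (simp add: cis_cnj mult_ac)
    also have "Re \<dots> = (\<Sum>i<N. \<Sum>j<N. d i * d j * cos (real_of_int (int i - int j) * (x - y)))"
      by (simp add: cis_mult algebra_simps)
    finally show ?thesis .
  qed
  have int: "(\<integral>\<^sup>+y. ennreal ((cmod (S N y))\<^sup>2) \<partial>?J) \<le> ennreal (2 * pi * Q)" for N
  proof -
    have i: "integrable ?J (\<lambda>y. (cmod (S N y))\<^sup>2)" unfolding sq
      by (intro Bochner_Integration.integrable_sum integrable_mult_right integral_cos_shift(1))
    have "(LINT y|?J. (cmod (S N y))\<^sup>2) = (\<Sum>i<N. \<Sum>j<N. d i * d j * (if int i - int j = 0 then 2 * pi else 0))"
      unfolding sq integral_cos_shift(2)[symmetric, of _ x]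
      by (subst Bochner_Integration.integral_sum, (intro Bochner_Integration.integrable_sum integrable_mult_right integral_cos_shift(1)),
          intro sum.cong refl, subst Bochner_Integration.integral_sum, (intro integrable_mult_right integral_cos_shift(1)),
          simp only: integral_mult_right_zero)
    also have "\<dots> = (\<Sum>i<N. \<Sum>j<N. if i = j then 2 * pi * (d i)\<^sup>2 else 0)"
      by (intro sum.cong refl) (auto simp: power2_eq_square)
    also have "\<dots> = 2 * pi * (\<Sum>i<N. (d i)\<^sup>2)"
      by (simp add: sum_distrib_left)
    also have "\<dots> \<le> 2 * pi * Q" by (intro mult_left_mono q) auto
    finally show ?thesis using i by (subst nn_integral_eq_integral) (auto intro: ennreal_leI)
  qed
  have "(\<integral>\<^sup>+y. ennreal ((cmod (trig_series d (x - y)))\<^sup>2) \<partial>?J) = (\<integral>\<^sup>+y. liminf (\<lambda>N. ennreal ((cmod (S N y))\<^sup>2)) \<partial>?J)"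
  proof (intro nn_integral_cong)
    fix y
    have "(\<lambda>N. ennreal ((cmod (S N y))\<^sup>2)) \<longlonglongrightarrow> ennreal ((cmod (trig_series d (x - y)))\<^sup>2)"
      by (intro tendsto_intros lim)
    from lim_imp_Liminf[OF sequentially_bot this]
    show "ennreal ((cmod (trig_series d (x - y)))\<^sup>2) = liminf (\<lambda>N. ennreal ((cmod (S N y))\<^sup>2))"
      by simp
  qed
  also have "\<dots> \<le> liminf (\<lambda>N. \<integral>\<^sup>+y. ennreal ((cmod (S N y))\<^sup>2) \<partial>?J)"
    by (rule nn_integral_liminf) measurable
  also have "\<dots> \<le> ennreal (2 * pi * Q)"
    using int by (intro Liminf_le) (auto simp: eventually_sequentially)
  finally show ?thesis .
qed

text \<open>The model is \<open>a k = h (k * sqrt \<tau>)\<close> for a smooth rapidly decreasing function \<open>h\<close> with \<open>h 0 = 0\<close>: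
  size \<open>A\<close>, increments of size \<open>A * sqrt \<tau>\<close>, and Gaussian decay. The increment from \<open>0\<close> to
  \<open>a 1\<close> enters squared and divided by \<open>\<tau>\<close>, where \<open>A\<^sup>2 \<tau>\<^bsup>-1/2\<^esup>\<close> is acceptable; this leads to the
  exponent \<open>1/4\<close>. All conditions are convex in \<open>(a, A)\<close>, so that they survive an integration over a
  parameter.\<close>

definition smooth_symbol :: "real \<Rightarrow> real \<Rightarrow> (nat \<Rightarrow> real) \<Rightarrow> bool"
  where "smooth_symbol \<tau> A a \<longleftrightarrow>
    (\<forall>k\<ge>1. \<bar>a k\<bar> \<le> A * heat_symbol (\<tau> / 2) k) \<and>
    (\<forall>k\<ge>1. \<bar>a (Suc k) - a k\<bar> \<le> A * sqrt \<tau> * heat_symbol (\<tau> / 2) k) \<and>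
    \<bar>a 1\<bar> \<le> A * \<tau> powr (1/4)"

lemma nn_integral_arctan_le:
  fixes \<kappa> x :: real
  assumes "\<kappa> > 0"
  shows "(\<integral>\<^sup>+y. ennreal (1 / (1 + (\<kappa> * (x - y))\<^sup>2)) \<partial>lebesgue_on {-pi<..<pi}) \<le> ennreal (pi / \<kappa>)"
proof -
  let ?f = "\<lambda>y. 1 / (1 + (\<kappa> * (x - y))\<^sup>2)" and ?F = "\<lambda>y. - arctan (\<kappa> * (x - y)) / \<kappa>"
  have "(\<integral>\<^sup>+y. ennreal (?f y) \<partial>lebesgue_on {-pi<..<pi}) = (\<integral>\<^sup>+y. ennreal (?f y) * indicator {-pi<..<pi} y \<partial>lborel)"
    by (rule nn_integral_lebesgue_on_eq_lborel) auto
  also have "\<dots> \<le> (\<integral>\<^sup>+y. ennreal (?f y) * indicator {-pi..pi} y \<partial>lborel)"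
    by (intro nn_integral_mono mult_left_mono) (auto simp: indicator_def)
  also have "\<dots> = ennreal (?F pi - ?F (- pi))"
    using assms by (intro nn_integral_FTC_Icc) (auto intro!: derivative_eq_intros simp: inverse_eq_divide)
  also have "\<dots> \<le> ennreal (pi / \<kappa>)"
  proof (rule ennreal_leI)
    have "- arctan (\<kappa> * (x - pi)) + arctan (\<kappa> * (x - - pi)) \<le> pi"
      using arctan_bounded[of "\<kappa> * (x - pi)"] arctan_bounded[of "\<kappa> * (x - - pi)"] by linarith
    then have "(- arctan (\<kappa> * (x - pi)) + arctan (\<kappa> * (x - - pi))) / \<kappa> \<le> pi / \<kappa>"
      using assms by (intro divide_right_mono) auto
    then show "?F pi - ?F (- pi) \<le> pi / \<kappa>" by (simp add: diff_divide_distrib)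
  qed
  finally show ?thesis .
qed

lemma cmod_cis_minus_1: "(cmod (cis (- \<theta>) - 1))\<^sup>2 = 2 - 2 * cos \<theta>"
proof -
  have "(cmod (cis (- \<theta>) - 1))\<^sup>2 = (cos \<theta> - 1)\<^sup>2 + (sin \<theta>)\<^sup>2"
    by (simp add: cmod_power2)
  then show ?thesis using sin_cos_squared_add[of \<theta>] by (simp add: power2_eq_square algebra_simps)
qed

lemma smooth_symbol_summable:
  assumes "smooth_symbol \<tau> A a" "\<tau> > 0"
  shows "summable (\<lambda>j. \<bar>a (Suc j)\<bar>)"
proof (rule summable_comparison_test')
  show "summable (\<lambda>j. A * heat_symbol (\<tau> / 2) (Suc j))"
    using heat_symbol_summable(1)[of "\<tau> / 2"] assms heat_symbol_pos by (intro summable_mult) (simp add: abs_of_pos)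
qed (use assms in \<open>auto simp: smooth_symbol_def\<close>)

text \<open>Let \<open>H\<close> be the series with \<open>cis\<close> in place of \<open>cos\<close>. Multiplying \<open>H\<close> by \<open>cis (-\<theta>) - 1\<close> replaces the
  coefficients by their differences. By Bessel's inequality for \<open>H\<close> and for this product, the
  weight \<open>w = 1 + \<bar>cis (-\<theta>) - 1\<bar>\<^sup>2 / \<tau>\<close> satisfies \<open>\<integral> w \<bar>H\<bar>\<^sup>2 \<le> 10 \<pi> A\<^sup>2 / sqrt \<tau>\<close>, while
  \<open>\<integral> 1 / w \<le> 4 \<pi> sqrt \<tau>\<close>. The Cauchy-Schwarz inequality, in the form
  \<open>\<bar>H\<bar> \<le> l / (2 w) + w \<bar>H\<bar>\<^sup>2 / (2 l)\<close>, combines the two; the powers of \<open>\<tau>\<close> cancel.\<close>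

lemma smooth_symbol_cos_L1:
  assumes sm: "smooth_symbol \<tau> A a" and \<tau>: "\<tau> > 0" and A: "A > 0" and x: "x \<in> {0<..<pi}"
  shows "(\<integral>\<^sup>+y. ennreal \<bar>\<Sum>j. a (Suc j) * cos (real (Suc j) * (x - y))\<bar> \<partial>lebesgue_on {-pi<..<pi}) \<le> ennreal (7 * pi * A)"
proof -
  let ?J = "lebesgue_on {-pi<..<pi}"
  have h1: "\<bar>a k\<bar> \<le> A * heat_symbol (\<tau> / 2) k" if "k \<ge> 1" for k using sm that by (simp add: smooth_symbol_def)
  have h2: "\<bar>a (Suc k) - a k\<bar> \<le> A * sqrt \<tau> * heat_symbol (\<tau> / 2) k" if "k \<ge> 1" for k using sm that by (simp add: smooth_symbol_def)
  have h3: "\<bar>a 1\<bar> \<le> A * \<tau> powr (1/4)" using sm by (simp add: smooth_symbol_def)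
  have sa: "summable (\<lambda>j. \<bar>a (Suc j)\<bar>)" by (rule smooth_symbol_summable[OF sm \<tau>])
  have st: "sqrt \<tau> > 0" using \<tau> by simp
  define b where "b j = (if j = 0 then 0 else a j)" for j :: nat
  define e where "e j = b (Suc j) - b j" for j :: nat
  define H where "H = trig_series b"
  have sb: "summable (\<lambda>j. \<bar>b j\<bar>)" using sa by (subst summable_Suc_iff[symmetric]) (simp add: b_def)
  have se: "summable (\<lambda>j. \<bar>e j\<bar>)"
  proof (rule summable_comparison_test')
    show "summable (\<lambda>j. \<bar>b (Suc j)\<bar> + \<bar>b j\<bar>)" using sb summable_Suc_iff[of "\<lambda>j. \<bar>b j\<bar>"] by (intro summable_add) simp_all
  qed (auto simp: e_def)
  have hs: "(\<Sum>j<N. heat_symbol \<tau> (Suc j)) \<le> 2 / sqrt \<tau>" for N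
  proof -
    have "(\<Sum>j<N. heat_symbol \<tau> (Suc j)) \<le> (\<Sum>j. heat_symbol \<tau> (Suc j))"
      using heat_symbol_summable(1)[OF \<tau>] heat_symbol_pos[of \<tau>] by (intro sum_le_suminf) (auto simp: less_imp_le)
    also have "\<dots> \<le> 2 / sqrt \<tau>" using heat_symbol_summable(2)[OF \<tau>] by (simp add: abs_of_pos[OF heat_symbol_pos])
    finally show ?thesis .
  qed
  have hh: "(heat_symbol (\<tau> / 2) k)\<^sup>2 = heat_symbol \<tau> k" for k
    by (simp add: power2_eq_square heat_symbol_mult)
  have qb: "(\<Sum>j<N. (b j)\<^sup>2) \<le> 2 * A\<^sup>2 / sqrt \<tau>" for N
  proof -
    have "(\<Sum>j<N. (b j)\<^sup>2) \<le> (\<Sum>j<Suc N. (b j)\<^sup>2)" by simp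
    also have "\<dots> = (\<Sum>j<N. (a (Suc j))\<^sup>2)" unfolding sum.lessThan_Suc_shift by (simp add: b_def)
    also have "\<dots> \<le> (\<Sum>j<N. A\<^sup>2 * heat_symbol \<tau> (Suc j))"
      using power_mono[OF h1, of "Suc _" 2] by (intro sum_mono) (simp add: power_mult_distrib hh)
    also have "\<dots> \<le> A\<^sup>2 * (2 / sqrt \<tau>)" unfolding sum_distrib_left[symmetric] by (intro mult_left_mono hs) auto
    finally show ?thesis by (simp add: mult.commute)
  qed
  have qe: "(\<Sum>j<N. (e j)\<^sup>2) \<le> 3 * A\<^sup>2 * sqrt \<tau>" for N
  proof -
    have "(\<Sum>j<N. (e j)\<^sup>2) \<le> (\<Sum>j<Suc N. (e j)\<^sup>2)" by simp
    also have "\<dots> = (a 1)\<^sup>2 + (\<Sum>j<N. (a (Suc (Suc j)) - a (Suc j))\<^sup>2)" unfolding sum.lessThan_Suc_shift by (simp add: e_def b_def)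
    also have "\<dots> \<le> A\<^sup>2 * sqrt \<tau> + (\<Sum>j<N. A\<^sup>2 * \<tau> * heat_symbol \<tau> (Suc j))"
    proof (intro add_mono sum_mono)
      have "(a 1)\<^sup>2 \<le> (A * \<tau> powr (1/4))\<^sup>2" using power_mono[OF h3, of 2] by simp
      also have "\<dots> = A\<^sup>2 * sqrt \<tau>" using \<tau> by (simp add: power_mult_distrib powr_half_sqrt power2_eq_square flip: powr_add)
      finally show "(a 1)\<^sup>2 \<le> A\<^sup>2 * sqrt \<tau>" .
      show "(a (Suc (Suc j)) - a (Suc j))\<^sup>2 \<le> A\<^sup>2 * \<tau> * heat_symbol \<tau> (Suc j)" for j
        using power_mono[OF h2[of "Suc j"], of 2] \<tau> by (simp add: power_mult_distrib hh)
    qed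
    also have "\<dots> \<le> A\<^sup>2 * sqrt \<tau> + A\<^sup>2 * \<tau> * (2 / sqrt \<tau>)"
      unfolding sum_distrib_left[symmetric] using \<tau> by (intro add_mono mult_left_mono hs) auto
    also have "\<dots> = 3 * A\<^sup>2 * sqrt \<tau>" using \<tau> by (simp add: field_simps)
    finally show ?thesis .
  qed
  have HE: "(cis (- \<theta>) - 1) * H \<theta> = trig_series e \<theta>" for \<theta>
  proof -
    have s0: "summable (\<lambda>j. of_real (b j) * cis (real j * \<theta>))" by (rule trig_series_summable[OF sb])
    then have s1: "summable (\<lambda>j. of_real (b (Suc j)) * cis (real (Suc j) * \<theta>))" by (subst summable_Suc_iff)
    have s2: "summable (\<lambda>j. of_real (b (Suc j)) * cis (real j * \<theta>))"
      by (rule trig_series_summable) (use sb summable_Suc_iff[of "\<lambda>j. \<bar>b j\<bar>"] in simp)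
    have "H \<theta> = (\<Sum>j. of_real (b (Suc j)) * cis (real (Suc j) * \<theta>))"
      using suminf_split_head[OF s0] by (simp add: H_def trig_series_def b_def)
    then have "cis (- \<theta>) * H \<theta> = (\<Sum>j. cis (- \<theta>) * (of_real (b (Suc j)) * cis (real (Suc j) * \<theta>)))"
      by (simp only: suminf_mult[OF s1])
    also have "\<dots> = (\<Sum>j. of_real (b (Suc j)) * cis (real j * \<theta>))"
    proof (rule suminf_cong)
      fix j
      have "cis (- \<theta>) * cis (real (Suc j) * \<theta>) = cis (real j * \<theta>)" by (simp add: cis_mult algebra_simps)
      then show "cis (- \<theta>) * (of_real (b (Suc j)) * cis (real (Suc j) * \<theta>)) = of_real (b (Suc j)) * cis (real j * \<theta>)"
        by (metis mult.left_commute)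
    qed
    finally have "(cis (- \<theta>) - 1) * H \<theta> = (\<Sum>j. of_real (b (Suc j)) * cis (real j * \<theta>)) - H \<theta>"
      by (simp add: left_diff_distrib)
    also have "\<dots> = (\<Sum>j. of_real (b (Suc j)) * cis (real j * \<theta>) - of_real (b j) * cis (real j * \<theta>))"
      unfolding H_def trig_series_def by (rule suminf_diff[OF s2 s0])
    finally show ?thesis by (simp add: trig_series_def e_def left_diff_distrib)
  qed
  have ReH: "(\<Sum>j. a (Suc j) * cos (real (Suc j) * \<theta>)) = Re (H \<theta>)" for \<theta>
  proof -
    have s0: "summable (\<lambda>j. of_real (b j) * cis (real j * \<theta>))" by (rule trig_series_summable[OF sb])
    then have s1: "summable (\<lambda>j. of_real (b (Suc j)) * cis (real (Suc j) * \<theta>))" by (subst summable_Suc_iff)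
    have "H \<theta> = (\<Sum>j. of_real (b (Suc j)) * cis (real (Suc j) * \<theta>))"
      using suminf_split_head[OF s0] by (simp add: H_def trig_series_def b_def)
    then show ?thesis using bounded_linear.suminf[OF bounded_linear_Re s1] by (simp add: b_def)
  qed
  define w where "w \<theta> = 1 + (2 - 2 * cos \<theta>) / \<tau>" for \<theta>
  have w1: "w \<theta> \<ge> 1" for \<theta> using \<tau> cos_le_one[of \<theta>] by (simp add: w_def)
  define \<kappa> where "\<kappa> = 1 / (2 * sqrt \<tau>)"
  have \<kappa>: "\<kappa> > 0" using st by (simp add: \<kappa>_def)
  have w0: "w \<theta> \<ge> 1 + (\<kappa> * \<theta>)\<^sup>2" if "\<bar>\<theta>\<bar> \<le> pi" for \<theta>
  proof -
    have "(\<kappa> * \<theta>)\<^sup>2 = \<theta>\<^sup>2 / 4 / \<tau>" using \<tau> by (simp add: \<kappa>_def power_mult_distrib power_divide)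
    also have "\<dots> \<le> (2 - 2 * cos \<theta>) / \<tau>" using \<tau> one_minus_cos_ge[OF that] by (intro divide_right_mono) auto
    finally show ?thesis by (simp add: w_def)
  qed
  \<comment> \<open>As \<open>x - y\<close> ranges over an interval reaching from \<open>-\<pi>\<close> to \<open>2\<pi>\<close>, the weight is compared with bumps centred at both \<open>0\<close> and \<open>2\<pi>\<close>.\<close>
  have winv: "1 / w (x - y) \<le> 1 / (1 + (\<kappa> * (x - y))\<^sup>2) + 1 / (1 + (\<kappa> * ((x - 2 * pi) - y))\<^sup>2)" if "y \<in> {-pi<..<pi}" for y
  proof -
    have pos: "1 + (\<kappa> * z)\<^sup>2 > 0" for z by (simp add: add_pos_nonneg)
    have nn: "1 / (1 + (\<kappa> * z)\<^sup>2) \<ge> 0" for z using pos[of z] by simp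
    show ?thesis
    proof (cases "x - y \<le> pi")
      case True
      have "1 / w (x - y) \<le> 1 / (1 + (\<kappa> * (x - y))\<^sup>2)"
        using True x that w0[of "x - y"] pos by (intro divide_left_mono) (auto intro!: mult_pos_pos less_le_trans[OF zero_less_one w1])
      then show ?thesis using nn[of "x - 2 * pi - y"] by linarith
    next
      case False
      have "w (x - y) = w ((x - 2 * pi) - y)"
        using cos.minus_1[of "x - y"] by (simp add: w_def) (metis add.commute cos_periodic diff_add_cancel diff_diff_eq2 diff_add_eq)
      then have "1 / w (x - y) \<le> 1 / (1 + (\<kappa> * ((x - 2 * pi) - y))\<^sup>2)"
        using False x that w0[of "x - 2 * pi - y"] pos by (auto intro!: divide_left_mono mult_pos_pos less_le_trans[OF zero_less_one w1])
      then show ?thesis using nn[of "x - y"] by linarith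
    qed
  qed
  \<comment> \<open>Up to a constant, this value balances the two terms of the inequality of Cauchy and Schwarz.\<close>
  define l where "l = A / sqrt \<tau>"
  have l: "l > 0" using A st by (simp add: l_def)
  have Hw: "w \<theta> * (cmod (H \<theta>))\<^sup>2 = (cmod (trig_series b \<theta>))\<^sup>2 + 1 / \<tau> * (cmod (trig_series e \<theta>))\<^sup>2" for \<theta>
    unfolding HE[symmetric] norm_mult power_mult_distrib cmod_cis_minus_1
    by (simp add: w_def H_def algebra_simps diff_divide_distrib)
  have pt: "\<bar>Re (H (x - y))\<bar> \<le> l / 2 * (1 / (1 + (\<kappa> * (x - y))\<^sup>2) + 1 / (1 + (\<kappa> * ((x - 2 * pi) - y))\<^sup>2))
     + 1 / (2 * l) * ((cmod (trig_series b (x - y)))\<^sup>2 + 1 / \<tau> * (cmod (trig_series e (x - y)))\<^sup>2)"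
    if "y \<in> {-pi<..<pi}" for y
  proof -
    define W h where "W = w (x - y)" and "h = cmod (H (x - y))"
    have W: "W > 0" using w1[of "x - y"] by (simp add: W_def)
    have "\<bar>Re (H (x - y))\<bar> \<le> h" unfolding h_def by (rule abs_Re_le_cmod)
    also have "h \<le> l / 2 * (1 / W) + 1 / (2 * l) * (W * h\<^sup>2)"
    proof -
      have "0 \<le> (l - W * h)\<^sup>2" by simp
      then have "2 * l * W * h \<le> l\<^sup>2 + W\<^sup>2 * h\<^sup>2" by (simp add: power2_eq_square algebra_simps)
      then show ?thesis using l W by (simp add: field_simps power2_eq_square)
    qed
    also have "\<dots> \<le> l / 2 * (1 / (1 + (\<kappa> * (x - y))\<^sup>2) + 1 / (1 + (\<kappa> * ((x - 2 * pi) - y))\<^sup>2)) + 1 / (2 * l) * (W * h\<^sup>2)"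
      using winv[OF that] l unfolding W_def by (intro add_right_mono mult_left_mono) auto
    finally show ?thesis unfolding W_def h_def Hw .
  qed
  have nn: "1 / (1 + (z::real)\<^sup>2) \<ge> 0" for z by simp
  have [measurable]: "(\<lambda>y. x - y) \<in> borel_measurable ?J" "(\<lambda>y. x - 2 * pi - y) \<in> borel_measurable ?J" by measurable
  have "(\<integral>\<^sup>+y. ennreal \<bar>Re (H (x - y))\<bar> \<partial>?J) \<le>
     (\<integral>\<^sup>+y. ennreal (l / 2) * (ennreal (1 / (1 + (\<kappa> * (x - y))\<^sup>2)) + ennreal (1 / (1 + (\<kappa> * ((x - 2 * pi) - y))\<^sup>2)))
       + ennreal (1 / (2 * l)) * (ennreal ((cmod (trig_series b (x - y)))\<^sup>2) + ennreal (1 / \<tau>) * ennreal ((cmod (trig_series e (x - y)))\<^sup>2)) \<partial>?J)"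
  proof (rule nn_integral_mono)
    fix y assume "y \<in> space ?J"
    then have y: "y \<in> {-pi<..<pi}" by simp
    have "ennreal \<bar>Re (H (x - y))\<bar> \<le> ennreal (l / 2 * (1 / (1 + (\<kappa> * (x - y))\<^sup>2) + 1 / (1 + (\<kappa> * ((x - 2 * pi) - y))\<^sup>2))
     + 1 / (2 * l) * ((cmod (trig_series b (x - y)))\<^sup>2 + 1 / \<tau> * (cmod (trig_series e (x - y)))\<^sup>2))"
      by (rule ennreal_leI[OF pt[OF y]])
    also have "\<dots> = ennreal (l / 2) * (ennreal (1 / (1 + (\<kappa> * (x - y))\<^sup>2)) + ennreal (1 / (1 + (\<kappa> * ((x - 2 * pi) - y))\<^sup>2)))
       + ennreal (1 / (2 * l)) * (ennreal ((cmod (trig_series b (x - y)))\<^sup>2) + ennreal (1 / \<tau>) * ennreal ((cmod (trig_series e (x - y)))\<^sup>2))"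
      using l \<tau> nn by (simp only: ennreal_plus[symmetric] ennreal_mult[symmetric] add_nonneg_nonneg mult_nonneg_nonneg
          zero_le_power2 divide_nonneg_pos less_imp_le zero_less_divide_1_iff zero_less_mult_iff zero_less_numeral half_gt_zero_iff simp_thms)
    finally show "ennreal \<bar>Re (H (x - y))\<bar> \<le> \<dots>" .
  qed
  also have "\<dots> = ennreal (l / 2) * ((\<integral>\<^sup>+y. ennreal (1 / (1 + (\<kappa> * (x - y))\<^sup>2)) \<partial>?J) + (\<integral>\<^sup>+y. ennreal (1 / (1 + (\<kappa> * ((x - 2 * pi) - y))\<^sup>2)) \<partial>?J))
     + ennreal (1 / (2 * l)) * ((\<integral>\<^sup>+y. ennreal ((cmod (trig_series b (x - y)))\<^sup>2) \<partial>?J) + ennreal (1 / \<tau>) * (\<integral>\<^sup>+y. ennreal ((cmod (trig_series e (x - y)))\<^sup>2) \<partial>?J))"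
    by (simp add: nn_integral_add nn_integral_cmult)
  also have "\<dots> \<le> ennreal (l / 2) * (ennreal (pi / \<kappa>) + ennreal (pi / \<kappa>))
     + ennreal (1 / (2 * l)) * (ennreal (2 * pi * (2 * A\<^sup>2 / sqrt \<tau>)) + ennreal (1 / \<tau>) * ennreal (2 * pi * (3 * A\<^sup>2 * sqrt \<tau>)))"
    by (intro add_mono mult_left_mono nn_integral_arctan_le trig_series_Bessel \<kappa> sb se qb qe) auto
  also have "\<dots> = ennreal (l / 2 * (pi / \<kappa> + pi / \<kappa>) + 1 / (2 * l) * (2 * pi * (2 * A\<^sup>2 / sqrt \<tau>) + 1 / \<tau> * (2 * pi * (3 * A\<^sup>2 * sqrt \<tau>))))"
    using l \<tau> \<kappa> A by (simp add: ennreal_plus[symmetric] ennreal_mult[symmetric] add_nonneg_nonneg del: ennreal_plus)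
  also have "l / 2 * (pi / \<kappa> + pi / \<kappa>) + 1 / (2 * l) * (2 * pi * (2 * A\<^sup>2 / sqrt \<tau>) + 1 / \<tau> * (2 * pi * (3 * A\<^sup>2 * sqrt \<tau>))) = 7 * pi * A"
  proof -
    define q where "q = sqrt \<tau>"
    have q: "q > 0" "\<tau> = q * q" using \<tau> by (auto simp: q_def)
    show ?thesis unfolding l_def \<kappa>_def q_def[symmetric] q(2) using q(1) A by (simp add: field_simps power2_eq_square)
  qed
  finally show ?thesis by (simp only: ReH)
qed

text \<open>The product formula for sines writes the kernel as a difference of cosine series at \<open>x - y\<close> and
  \<open>x + y\<close>. The reflection \<open>y \<mapsto> -y\<close> joins the two integrals over \<open>(0, \<pi>)\<close> to one over
  \<open>(-\<pi>, \<pi>)\<close>.\<close>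

lemma smooth_symbol_kernel_bound:
  assumes sm: "smooth_symbol \<tau> A a" and \<tau>: "\<tau> > 0" and A: "A > 0"
  shows "kernel_bound a (7 * A)"
  unfolding kernel_bound_def
proof (intro conjI ballI smooth_symbol_summable[OF sm \<tau>])
  fix x assume x: "x \<in> {0<..<pi}"
  define G where "G \<theta> = (\<Sum>j. a (Suc j) * cos (real (Suc j) * \<theta>))" for \<theta>
  have Gm[measurable]: "G \<in> borel_measurable borel" unfolding G_def by measurable
  have sG: "summable (\<lambda>j. a (Suc j) * cos (real (Suc j) * \<theta>))" for \<theta>
    by (rule summable_comparison_test'[OF smooth_symbol_summable[OF sm \<tau>]]) (auto simp: abs_mult intro!: mult_left_le)
  have K: "sine_kernel a x y = 1 / pi * (G (x - y) - G (x + y))" for y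
  proof -
    have "a (Suc j) * eigenfun (Suc j) x * eigenfun (Suc j) y =
      1 / pi * (a (Suc j) * cos (real (Suc j) * (x - y)) - a (Suc j) * cos (real (Suc j) * (x + y)))" for j
    proof -
      let ?u = "real (Suc j) * x" and ?v = "real (Suc j) * y"
      have "a (Suc j) * eigenfun (Suc j) x * eigenfun (Suc j) y = a (Suc j) * ((sqrt (2 / pi) * sqrt (2 / pi)) * (sin ?u * sin ?v))"
        by (simp only: eigenfun_def mult_ac)
      also have "\<dots> = a (Suc j) * ((2 / pi) * ((cos (?u - ?v) - cos (?u + ?v)) / 2))"
        by (simp only: sin_times_sin real_sqrt_mult_self) simp
      also have "\<dots> = 1 / pi * (a (Suc j) * cos (?u - ?v) - a (Suc j) * cos (?u + ?v))"
        by (simp add: right_diff_distrib diff_divide_distrib del: of_nat_Suc)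
      finally show ?thesis by (simp only: right_diff_distrib[of "real (Suc j)"] distrib_left[of "real (Suc j)"])
    qed
    then have "sine_kernel a x y = (\<Sum>j. 1 / pi * (a (Suc j) * cos (real (Suc j) * (x - y)) - a (Suc j) * cos (real (Suc j) * (x + y))))"
      by (simp add: sine_kernel_def)
    also have "\<dots> = 1 / pi * (\<Sum>j. a (Suc j) * cos (real (Suc j) * (x - y)) - a (Suc j) * cos (real (Suc j) * (x + y)))"
      by (intro suminf_mult summable_diff sG)
    also have "(\<Sum>j. a (Suc j) * cos (real (Suc j) * (x - y)) - a (Suc j) * cos (real (Suc j) * (x + y))) = G (x - y) - G (x + y)"
      unfolding G_def by (intro suminf_diff[symmetric] sG)
    finally show ?thesis .
  qed
  have "(\<integral>\<^sup>+y. ennreal \<bar>sine_kernel a x y\<bar> \<partial>interval_pi) \<le> (\<integral>\<^sup>+y. ennreal (1 / pi) * (ennreal \<bar>G (x - y)\<bar> + ennreal \<bar>G (x + y)\<bar>) \<partial>interval_pi)"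
  proof (rule nn_integral_mono)
    fix y
    have "\<bar>sine_kernel a x y\<bar> \<le> 1 / pi * (\<bar>G (x - y)\<bar> + \<bar>G (x + y)\<bar>)"
      unfolding K abs_mult by (intro mult_mono abs_triangle_ineq4) auto
    then show "ennreal \<bar>sine_kernel a x y\<bar> \<le> ennreal (1 / pi) * (ennreal \<bar>G (x - y)\<bar> + ennreal \<bar>G (x + y)\<bar>)"
      by (simp add: ennreal_plus[symmetric] ennreal_mult[symmetric] ennreal_leI del: ennreal_plus)
  qed
  also have "\<dots> = ennreal (1 / pi) * ((\<integral>\<^sup>+y. ennreal \<bar>G (x - y)\<bar> \<partial>interval_pi) + (\<integral>\<^sup>+y. ennreal \<bar>G (x + y)\<bar> \<partial>interval_pi))"
    by (subst nn_integral_cmult, measurable, subst nn_integral_add, measurable)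
  also have "(\<integral>\<^sup>+y. ennreal \<bar>G (x + y)\<bar> \<partial>interval_pi) = (\<integral>\<^sup>+y. ennreal \<bar>G (x - y)\<bar> * indicator {-pi<..<0} y \<partial>lborel)"
  proof -
    have "(\<integral>\<^sup>+y. ennreal \<bar>G (x + y)\<bar> \<partial>interval_pi) = (\<integral>\<^sup>+y. ennreal \<bar>G (x + y)\<bar> * indicator {0<..<pi} y \<partial>lborel)"
      by (rule nn_integral_lebesgue_on_eq_lborel) auto
    also have "\<dots> = ennreal \<bar>-1\<bar> * (\<integral>\<^sup>+y. ennreal \<bar>G (x + (0 + (-1) * y))\<bar> * indicator {0<..<pi} (0 + (-1) * y) \<partial>lborel)"
      by (rule nn_integral_real_affine) auto
    also have "\<dots> = (\<integral>\<^sup>+y. ennreal \<bar>G (x - y)\<bar> * indicator {-pi<..<0} y \<partial>lborel)"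
      by (simp, intro nn_integral_cong) (auto simp: indicator_def)
    finally show ?thesis .
  qed
  also have "(\<integral>\<^sup>+y. ennreal \<bar>G (x - y)\<bar> \<partial>interval_pi) = (\<integral>\<^sup>+y. ennreal \<bar>G (x - y)\<bar> * indicator {0<..<pi} y \<partial>lborel)"
    by (rule nn_integral_lebesgue_on_eq_lborel) auto
  also have "(\<integral>\<^sup>+y. ennreal \<bar>G (x - y)\<bar> * indicator {0<..<pi} y \<partial>lborel) + (\<integral>\<^sup>+y. ennreal \<bar>G (x - y)\<bar> * indicator {-pi<..<0} y \<partial>lborel)
     = (\<integral>\<^sup>+y. ennreal \<bar>G (x - y)\<bar> * indicator {0<..<pi} y + ennreal \<bar>G (x - y)\<bar> * indicator {-pi<..<0} y \<partial>lborel)"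
    by (rule nn_integral_add[symmetric]) measurable
  also have "\<dots> \<le> (\<integral>\<^sup>+y. ennreal \<bar>G (x - y)\<bar> * indicator {-pi<..<pi} y \<partial>lborel)"
    by (intro nn_integral_mono) (auto simp: indicator_def)
  also have "\<dots> = (\<integral>\<^sup>+y. ennreal \<bar>G (x - y)\<bar> \<partial>lebesgue_on {-pi<..<pi})"
    by (rule nn_integral_lebesgue_on_eq_lborel[symmetric]) auto
  also have "\<dots> \<le> ennreal (7 * pi * A)"
    unfolding G_def by (rule smooth_symbol_cos_L1[OF sm \<tau> A x])
  finally have "(\<integral>\<^sup>+y. ennreal \<bar>sine_kernel a x y\<bar> \<partial>interval_pi) \<le> ennreal (1 / pi) * ennreal (7 * pi * A)"
    by (simp add: mult_left_mono)
  also have "\<dots> = ennreal (7 * A)" using A by (simp add: ennreal_mult[symmetric])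
  finally show "(\<integral>\<^sup>+y. ennreal \<bar>sine_kernel a x y\<bar> \<partial>interval_pi) \<le> ennreal (7 * A)" .
qed

section \<open>Kernel bounds for powers times the heat symbol\<close>

lemma powr_le_one_plus:
  fixes v \<alpha> :: real
  assumes "v \<ge> 0" "0 \<le> \<alpha>" "\<alpha> \<le> 1"
  shows "v powr \<alpha> \<le> 1 + v"
proof (cases "v \<le> 1")
  case True
  then have "v powr \<alpha> \<le> 1" using assms by (simp add: powr_le1)
  then show ?thesis using assms by simp
next
  case False
  then have "v powr \<alpha> \<le> v powr 1" using assms by (intro powr_mono) auto
  then show ?thesis using False by simp
qed

text \<open>Half of the exponential absorbs the polynomial; the other half remains for the summation over \<open>k\<close>.\<close>

lemma poly_le_exp_half:
  fixes v :: real
  assumes "v \<ge> 0"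
  shows "(1 + v) * (4 + 2 * v) * exp (- v) \<le> 16 * exp (- (v / 2))" "(1 + v) * exp (- v) \<le> 2 * exp (- (v / 2))"
proof -
  have e: "exp (- v) = exp (- (v / 2)) * exp (- (v / 2))" by (simp flip: exp_add)
  have b: "1 + v / 2 + (v / 2)\<^sup>2 / 2 \<le> exp (v / 2)" using exp_lower_Taylor_quadratic[of "v / 2"] assms by simp
  have ei: "exp (v / 2) * exp (- (v / 2)) = 1" by (simp flip: exp_add)
  have "(1 + v) * (4 + 2 * v) \<le> 16 * (1 + v / 2 + (v / 2)\<^sup>2 / 2)" using assms by (simp add: power2_eq_square algebra_simps)
  also have "\<dots> \<le> 16 * exp (v / 2)" using b by simp
  finally have "(1 + v) * (4 + 2 * v) * (exp (- (v / 2)) * exp (- (v / 2))) \<le> 16 * exp (v / 2) * (exp (- (v / 2)) * exp (- (v / 2)))"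
    by (rule mult_right_mono) simp
  then show "(1 + v) * (4 + 2 * v) * exp (- v) \<le> 16 * exp (- (v / 2))"
    unfolding e by (simp add: mult.assoc ei flip: mult.assoc[of "exp (v / 2)"])
  have "1 + v \<le> 2 * exp (v / 2)" using exp_ge_add_one_self[of "v / 2"] by linarith
  then have "(1 + v) * (exp (- (v / 2)) * exp (- (v / 2))) \<le> 2 * exp (v / 2) * (exp (- (v / 2)) * exp (- (v / 2)))"
    by (rule mult_right_mono) simp
  then show "(1 + v) * exp (- v) \<le> 2 * exp (- (v / 2))"
    unfolding e by (simp add: mult.assoc ei flip: mult.assoc[of "exp (v / 2)"])
qed

lemma powr_scale:
  fixes x \<tau> \<alpha> :: real
  assumes "x \<ge> 0" "\<tau> > 0"
  shows "x powr (2 * \<alpha>) = \<tau> powr (- \<alpha>) * (x\<^sup>2 * \<tau>) powr \<alpha>"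
proof -
  have "(x\<^sup>2) powr \<alpha> = x powr (2 * \<alpha>)"
    using assms by (cases "x = 0") (auto simp: powr_powr simp flip: powr_numeral)
  then show ?thesis using assms by (simp add: powr_mult powr_minus field_simps)
qed

text \<open>In the variable \<open>v = x\<^sup>2 \<tau>\<close> the size of the function and of its
  derivative divided by \<open>sqrt \<tau>\<close> are \<open>\<tau> powr (-(q + 2 \<eta>) / 2)\<close> times a polynomial in \<open>v\<close> times \<open>exp (-v)\<close>; increments are
  bounded by the mean value theorem. The derivative carries the power \<open>x powr (q + 2 \<eta> - 1)\<close>, whence
  the lower bound \<open>1\<close> on \<open>q + 2 \<eta>\<close>. The factor \<open>\<phi>\<close> covers both \<open>1\<close> and \<open>1 - exp (-x\<^sup>2 r)\<close>.\<close>

lemma smooth_symbol_powr_mult: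
  fixes \<phi> \<phi>' :: "real \<Rightarrow> real"
  assumes \<tau>: "\<tau> > 0" and q: "0 \<le> q" "0 \<le> \<eta>" "1 \<le> q + 2 * \<eta>" "q + 2 * \<eta> \<le> 2" and \<rho>: "\<rho> > 0"
    and D: "\<And>x. x \<ge> 1 \<Longrightarrow> (\<phi> has_real_derivative \<phi>' x) (at x)"
    and \<phi>: "\<And>x. x \<ge> 1 \<Longrightarrow> \<bar>\<phi> x\<bar> \<le> \<rho> * x powr (2 * \<eta>)"
    and \<phi>': "\<And>x. x \<ge> 1 \<Longrightarrow> \<bar>x * \<phi>' x\<bar> \<le> 2 * \<rho> * x powr (2 * \<eta>)"
  shows "smooth_symbol \<tau> (16 * \<rho> * \<tau> powr (- (q + 2 * \<eta>) / 2)) (\<lambda>k. real k powr q * heat_symbol \<tau> k * \<phi> (real k))"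
proof -
  define Q where "Q = q + 2 * \<eta>"
  have Q: "1 \<le> Q" "Q \<le> 2" using q by (auto simp: Q_def)
  define A where "A = 16 * \<rho> * \<tau> powr (- Q / 2)"
  define a where "a x = x powr q * exp (- (x\<^sup>2 * \<tau>)) * \<phi> x" for x
  define a' where "a' x = x powr (q - 1) * exp (- (x\<^sup>2 * \<tau>)) * (q * \<phi> x - 2 * (x\<^sup>2 * \<tau>) * \<phi> x + x * \<phi>' x)" for x
  have ak: "real k powr q * heat_symbol \<tau> k * \<phi> (real k) = a (real k)" for k
    by (simp add: a_def heat_symbol_def)
  have Da: "(a has_real_derivative a' x) (at x)" if x: "x \<ge> 1" for x
  proof -
    have "x powr q = x powr (q - 1) * x" using x by (simp add: powr_diff)
    then show ?thesis unfolding a_def a'_def using x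
      by (auto intro!: derivative_eq_intros D[OF x] simp: power2_eq_square algebra_simps)
  qed
  have ab: "\<bar>a x\<bar> \<le> A * exp (- (x\<^sup>2 * \<tau> / 2))" if x: "x \<ge> 1" for x
  proof -
    let ?v = "x\<^sup>2 * \<tau>"
    have "\<bar>a x\<bar> \<le> x powr q * exp (- ?v) * (\<rho> * x powr (2 * \<eta>))"
      unfolding a_def abs_mult using \<phi>[OF x] by (simp add: mult_left_mono)
    also have "\<dots> = \<rho> * x powr (2 * (Q / 2)) * exp (- ?v)"
    proof -
      have "2 * (Q / 2) = q + 2 * \<eta>" by (simp add: Q_def)
      then have "x powr (2 * (Q / 2)) = x powr q * x powr (2 * \<eta>)" by (simp only: powr_add)
      then show ?thesis by simp
    qed
    also have "x powr (2 * (Q / 2)) = \<tau> powr (- (Q / 2)) * ?v powr (Q / 2)"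
      using x \<tau> by (intro powr_scale) auto
    also have "\<rho> * (\<tau> powr (- (Q / 2)) * ?v powr (Q / 2)) * exp (- ?v) \<le> \<rho> * (\<tau> powr (- (Q / 2)) * (1 + ?v)) * exp (- ?v)"
      using \<tau> \<rho> Q by (intro mult_left_mono mult_right_mono powr_le_one_plus) auto
    also have "\<dots> = \<rho> * \<tau> powr (- (Q / 2)) * ((1 + ?v) * exp (- ?v))" by simp
    also have "\<dots> \<le> \<rho> * \<tau> powr (- (Q / 2)) * (16 * exp (- (?v / 2)))"
    proof (intro mult_left_mono)
      have "(1 + ?v) * exp (- ?v) \<le> 2 * exp (- (?v / 2))" by (rule poly_le_exp_half(2)) (use \<tau> in auto)
      then show "(1 + ?v) * exp (- ?v) \<le> 16 * exp (- (?v / 2))" by (rule order_trans) simp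
    qed (use \<rho> in auto)
    finally show ?thesis by (simp add: A_def)
  qed
  have a'b: "\<bar>a' x\<bar> \<le> A * sqrt \<tau> * exp (- (x\<^sup>2 * \<tau> / 2))" if x: "x \<ge> 1" for x
  proof -
    let ?v = "x\<^sup>2 * \<tau>"
    have v: "?v \<ge> 0" using \<tau> by simp
    have "\<bar>q * \<phi> x - 2 * ?v * \<phi> x + x * \<phi>' x\<bar> \<le> \<bar>q * \<phi> x\<bar> + \<bar>2 * ?v * \<phi> x\<bar> + \<bar>x * \<phi>' x\<bar>" by linarith
    also have "\<dots> = q * \<bar>\<phi> x\<bar> + 2 * ?v * \<bar>\<phi> x\<bar> + \<bar>x * \<phi>' x\<bar>" using q v \<tau> by (simp add: abs_mult)
    also have "\<dots> \<le> 2 * (\<rho> * x powr (2 * \<eta>)) + 2 * ?v * (\<rho> * x powr (2 * \<eta>)) + 2 * \<rho> * x powr (2 * \<eta>)"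
      using q v \<tau> \<phi>[OF x] \<phi>'[OF x] by (intro add_mono mult_mono) auto
    also have "\<dots> = \<rho> * x powr (2 * \<eta>) * (4 + 2 * ?v)" by (simp add: algebra_simps)
    finally have "\<bar>a' x\<bar> \<le> x powr (q - 1) * exp (- ?v) * (\<rho> * x powr (2 * \<eta>) * (4 + 2 * ?v))"
      unfolding a'_def abs_mult by (simp add: mult_left_mono)
    also have "\<dots> = \<rho> * x powr (2 * ((Q - 1) / 2)) * (4 + 2 * ?v) * exp (- ?v)"
    proof -
      have "2 * ((Q - 1) / 2) = (q - 1) + 2 * \<eta>" by (simp add: Q_def)
      then have "x powr (2 * ((Q - 1) / 2)) = x powr (q - 1) * x powr (2 * \<eta>)" by (simp only: powr_add)
      then show ?thesis by simp
    qed
    also have "x powr (2 * ((Q - 1) / 2)) = \<tau> powr (- ((Q - 1) / 2)) * ?v powr ((Q - 1) / 2)"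
      using x \<tau> by (intro powr_scale) auto
    also have "\<rho> * (\<tau> powr (- ((Q - 1) / 2)) * ?v powr ((Q - 1) / 2)) * (4 + 2 * ?v) * exp (- ?v)
       \<le> \<rho> * (\<tau> powr (- ((Q - 1) / 2)) * (1 + ?v)) * (4 + 2 * ?v) * exp (- ?v)"
      using v \<rho> Q by (intro mult_left_mono mult_right_mono powr_le_one_plus) auto
    also have "\<dots> = \<rho> * \<tau> powr (- ((Q - 1) / 2)) * ((1 + ?v) * (4 + 2 * ?v) * exp (- ?v))" by simp
    also have "\<dots> \<le> \<rho> * \<tau> powr (- ((Q - 1) / 2)) * (16 * exp (- (?v / 2)))"
      using \<rho> v by (intro mult_left_mono poly_le_exp_half) auto
    also have "\<tau> powr (- ((Q - 1) / 2)) = \<tau> powr (- Q / 2) * sqrt \<tau>"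
    proof -
      have "- ((Q - 1) / 2) = - Q / 2 + 1 / 2" by (simp add: field_simps)
      then show ?thesis using \<tau> by (simp only: powr_add powr_half_sqrt)
    qed
    finally show ?thesis by (simp add: A_def)
  qed
  have A0: "A > 0" using \<rho> \<tau> by (simp add: A_def)
  show ?thesis unfolding smooth_symbol_def Q_def[symmetric] A_def[symmetric] ak
  proof (intro conjI allI impI)
    fix k :: nat assume k: "1 \<le> k"
    show "\<bar>a (real k)\<bar> \<le> A * heat_symbol (\<tau> / 2) k"
      using ab[of "real k"] k by (simp add: heat_symbol_def)
    obtain z where z: "real k < z" "z < real (Suc k)" "a (real (Suc k)) - a (real k) = (real (Suc k) - real k) * a' z"
      using MVT2[of "real k" "real (Suc k)" a a'] Da k by force
    have "(real k)\<^sup>2 \<le> z\<^sup>2" using z by (intro power_mono) auto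
    then have "exp (- (z\<^sup>2 * \<tau> / 2)) \<le> exp (- ((real k)\<^sup>2 * \<tau> / 2))" using \<tau> by simp
    then have "A * sqrt \<tau> * exp (- (z\<^sup>2 * \<tau> / 2)) \<le> A * sqrt \<tau> * exp (- ((real k)\<^sup>2 * \<tau> / 2))"
      using A0 \<tau> by (intro mult_left_mono) auto
    moreover have "\<bar>a' z\<bar> \<le> A * sqrt \<tau> * exp (- (z\<^sup>2 * \<tau> / 2))" using z k by (intro a'b) auto
    ultimately show "\<bar>a (real (Suc k)) - a (real k)\<bar> \<le> A * sqrt \<tau> * heat_symbol (\<tau> / 2) k"
      using z(3) by (simp add: heat_symbol_def)
  next
    have "\<bar>a 1\<bar> \<le> \<rho> * exp (- \<tau>)" using \<phi>[of 1] by (simp add: a_def abs_mult mult.commute)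
    also have "\<dots> \<le> A * \<tau> powr (1/4)"
    proof -
      have "\<tau> powr (Q / 2 - 1 / 4) \<le> 1 + \<tau>" using \<tau> Q by (intro powr_le_one_plus) auto
      also have "\<dots> \<le> exp \<tau>" by (rule exp_ge_add_one_self)
      finally have "exp (- \<tau>) \<le> 1 / \<tau> powr (Q / 2 - 1 / 4)" using \<tau> by (simp add: exp_minus field_simps)
      also have "\<dots> = \<tau> powr (- Q / 2) * \<tau> powr (1/4)"
        by (simp add: powr_minus_divide[symmetric] flip: powr_add)
      finally have "\<rho> * exp (- \<tau>) \<le> \<rho> * (\<tau> powr (- Q / 2) * \<tau> powr (1/4))" using \<rho> by (intro mult_left_mono) auto
      also have "\<dots> \<le> 16 * (\<rho> * (\<tau> powr (- Q / 2) * \<tau> powr (1/4)))" using \<rho> by simp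
      finally show ?thesis by (simp add: A_def mult_ac)
    qed
    finally show "\<bar>a (real 1)\<bar> \<le> A * \<tau> powr (1/4)" by simp
  qed
qed

lemma smooth_symbol_powr:
  assumes "\<tau> > 0" "1 \<le> q" "q \<le> 2"
  shows "smooth_symbol \<tau> (16 * \<tau> powr (- q / 2)) (\<lambda>k. real k powr q * heat_symbol \<tau> k)"
  using smooth_symbol_powr_mult[of \<tau> q 0 1 "\<lambda>_. 1" "\<lambda>_. 0"] assms by auto

text \<open>This measures \<open>1 - exp (r\<Delta>)\<close>: a factor \<open>r powr \<eta>\<close> is bought with \<open>2 * \<eta>\<close> additional derivatives.\<close>

lemma smooth_symbol_powr_increment:
  assumes \<tau>: "\<tau> > 0" and q: "0 \<le> q" "0 < \<eta>" "\<eta> \<le> 1" "1 \<le> q + 2 * \<eta>" "q + 2 * \<eta> \<le> 2" and r: "r > 0"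
  shows "smooth_symbol \<tau> (16 * r powr \<eta> * \<tau> powr (- (q + 2 * \<eta>) / 2)) (\<lambda>k. real k powr q * heat_symbol \<tau> k * (1 - heat_symbol r k))"
proof -
  have p: "(x\<^sup>2 * r) powr \<eta> = r powr \<eta> * x powr (2 * \<eta>)" if "x \<ge> 1" for x
  proof -
    have "(x\<^sup>2) powr \<eta> = x powr (2 * \<eta>)" using that by (simp add: powr_powr flip: powr_numeral)
    then show ?thesis using r by (simp add: powr_mult)
  qed
  have "smooth_symbol \<tau> (16 * r powr \<eta> * \<tau> powr (- (q + 2 * \<eta>) / 2)) (\<lambda>k. real k powr q * heat_symbol \<tau> k * ((\<lambda>x. 1 - exp (- (x\<^sup>2 * r))) (real k)))"
  proof (rule smooth_symbol_powr_mult[OF \<tau> q(1) less_imp_le[OF q(2)] q(4,5)])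
    fix x :: real assume x: "x \<ge> 1"
    define u where "u = x\<^sup>2 * r"
    have u: "u > 0" using r x by (simp add: u_def)
    show "((\<lambda>x. 1 - exp (- (x\<^sup>2 * r))) has_real_derivative (2 * x * r * exp (- (x\<^sup>2 * r)))) (at x)"
      by (auto intro!: derivative_eq_intros)
    have "1 - exp (- u) \<le> u powr \<eta>" using u q by (intro one_minus_exp_le_powr) auto
    moreover have "exp (- u) \<le> 1" using u by simp
    ultimately show "\<bar>1 - exp (- (x\<^sup>2 * r))\<bar> \<le> r powr \<eta> * x powr (2 * \<eta>)"
      using p[OF x] by (simp add: u_def)
    have "u * exp (- u) \<le> u powr \<eta>"
    proof (cases "u \<le> 1")
      case True
      have "u * exp (- u) \<le> u powr 1" using u by simp
      also have "\<dots> \<le> u powr \<eta>" using True u q by (intro powr_mono') auto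
      finally show ?thesis .
    next
      case False
      have "u \<le> exp u" using exp_ge_add_one_self[of u] by linarith
      then have "u * exp (- u) \<le> 1" by (simp add: exp_minus field_simps)
      also have "1 \<le> u powr \<eta>" using False q by (intro ge_one_powr_ge_zero) auto
      finally show ?thesis .
    qed
    moreover have "\<bar>x * (2 * x * r * exp (- (x\<^sup>2 * r)))\<bar> = 2 * (u * exp (- u))"
      using x r by (simp add: u_def abs_mult power2_eq_square)
    ultimately show "\<bar>x * (2 * x * r * exp (- (x\<^sup>2 * r)))\<bar> \<le> 2 * r powr \<eta> * x powr (2 * \<eta>)"
      using p[OF x] by (simp add: u_def)
  qed (use r in simp)
  then show ?thesis by (simp add: heat_symbol_def)
qed

lemma smooth_symbol_integral:
  fixes a :: "real \<Rightarrow> nat \<Rightarrow> real"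
  assumes sm: "\<And>r. r \<in> space N \<Longrightarrow> smooth_symbol \<tau> (A r) (a r)"
    and ai: "\<And>k. k \<ge> 1 \<Longrightarrow> integrable N (\<lambda>r. a r k)" and Ai: "integrable N A"
  shows "smooth_symbol \<tau> (LINT r|N. A r) (\<lambda>k. LINT r|N. a r k)"
proof -
  have gen: "\<bar>LINT r|N. f r\<bar> \<le> (LINT r|N. A r) * c" if f: "integrable N f" and le: "\<And>r. r \<in> space N \<Longrightarrow> \<bar>f r\<bar> \<le> A r * c" for f c
  proof -
    have "\<bar>LINT r|N. f r\<bar> \<le> (LINT r|N. \<bar>f r\<bar>)" by (rule integral_abs_bound)
    also have "\<dots> \<le> (LINT r|N. A r * c)" using f Ai le by (intro integral_mono) auto
    finally show ?thesis by simp
  qed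
  show ?thesis unfolding smooth_symbol_def
  proof (intro conjI allI impI)
    fix k :: nat assume k: "1 \<le> k"
    show "\<bar>LINT r|N. a r k\<bar> \<le> (LINT r|N. A r) * heat_symbol (\<tau> / 2) k"
      using sm k by (intro gen ai) (auto simp: smooth_symbol_def)
    have "\<bar>LINT r|N. a r (Suc k) - a r k\<bar> \<le> (LINT r|N. A r) * (sqrt \<tau> * heat_symbol (\<tau> / 2) k)"
      using sm k ai by (intro gen Bochner_Integration.integrable_diff) (auto simp: smooth_symbol_def mult.assoc)
    then show "\<bar>(LINT r|N. a r (Suc k)) - (LINT r|N. a r k)\<bar> \<le> (LINT r|N. A r) * sqrt \<tau> * heat_symbol (\<tau> / 2) k"
      using ai k by (simp add: mult.assoc)
  next
    show "\<bar>LINT r|N. a r 1\<bar> \<le> (LINT r|N. A r) * \<tau> powr (1 / 4)"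
      using sm by (intro gen ai) (auto simp: smooth_symbol_def)
  qed
qed

text \<open>The defect of the truncated symbol is an average over \<open>r < \<epsilon>\<close> of the increments above, with weight \<open>r powr (-1 - \<sigma>)\<close>, integrable against \<open>r powr \<eta>\<close> because \<open>\<sigma> < \<eta>\<close>.\<close>

lemma smooth_symbol_trunc_defect:
  assumes \<tau>: "\<tau> > 0" and \<sigma>: "0 < \<sigma>" "\<sigma> < \<eta>" and q: "0 \<le> q" "\<eta> < 1" "1 \<le> q + 2 * \<eta>" "q + 2 * \<eta> \<le> 2" and \<epsilon>: "\<epsilon> > 0"
  shows "smooth_symbol \<tau> (16 * (\<epsilon> powr (\<eta> - \<sigma>) / (\<eta> - \<sigma>) / \<bar>Gamma (- \<sigma>)\<bar>) * \<tau> powr (- (q + 2 * \<eta>) / 2))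
     (\<lambda>k. real k powr q * heat_symbol \<tau> k * (((real k)\<^sup>2) powr \<sigma> - trunc_symbol \<sigma> \<epsilon> ((real k)\<^sup>2)))"
proof -
  let ?N = "lebesgue_on {0<..<\<epsilon>}"
  have \<sigma>1: "\<sigma> < 1" using \<sigma> q by simp
  have G: "Gamma (- \<sigma>) < 0" by (rule Gamma_neg_less_0) (use \<sigma> \<sigma>1 in auto)
  define g where "g = \<bar>Gamma (- \<sigma>)\<bar>"
  have g: "g > 0" "Gamma (- \<sigma>) = - g" using G by (auto simp: g_def)
  define a where "a r k = real k powr q * heat_symbol \<tau> k * (1 / Gamma (- \<sigma>) * heat_increment \<sigma> ((real k)\<^sup>2) r)" for r k
  have aeq: "a r k = 1 / g * r powr (- \<sigma> - 1) * (real k powr q * heat_symbol \<tau> k * (1 - heat_symbol r k))" for r k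
  proof -
    have "- \<sigma> - 1 = - (1 + \<sigma>)" by simp
    then have "r powr (- \<sigma> - 1) = 1 / r powr (1 + \<sigma>)" by (simp only: powr_minus_divide)
    moreover have "1 / Gamma (- \<sigma>) * heat_increment \<sigma> ((real k)\<^sup>2) r = 1 / g * (1 / r powr (1 + \<sigma>)) * (1 - heat_symbol r k)"
    proof -
      have "1 / (- g) * ((E - 1) / R) = 1 / g * (1 / R) * (1 - E)" for E R :: real
        by (cases "R = 0") (use g(1) in \<open>auto simp: field_simps\<close>)
      then show ?thesis unfolding g(2) heat_increment_def heat_symbol_def by simp
    qed
    ultimately show ?thesis by (simp add: a_def)
  qed
  define A where "A r = 16 / g * \<tau> powr (- (q + 2 * \<eta>) / 2) * r powr (\<eta> - \<sigma> - 1)" for r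
  have "smooth_symbol \<tau> (LINT r|?N. A r) (\<lambda>k. LINT r|?N. a r k)"
  proof (rule smooth_symbol_integral)
    fix r assume "r \<in> space ?N"
    then have r: "r > 0" by simp
    have sc: "smooth_symbol \<tau> (c * B) (\<lambda>k. c * b k)" if "smooth_symbol \<tau> B b" "c > 0" for c B b
    proof -
      have "\<bar>c * u\<bar> \<le> c * B * w" if "\<bar>u\<bar> \<le> B * w" for u w
        using mult_left_mono[OF that, of c] \<open>c > 0\<close> by (simp add: abs_mult mult.assoc)
      from this[where w="heat_symbol (\<tau> / 2) _"] this[where w="sqrt \<tau> * heat_symbol (\<tau> / 2) _"] this[where w="\<tau> powr (1/4)"]
      show ?thesis using that(1) unfolding smooth_symbol_def right_diff_distrib[symmetric] by (simp only: mult.assoc) blast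
    qed
    have "smooth_symbol \<tau> (1 / g * r powr (- \<sigma> - 1) * (16 * r powr \<eta> * \<tau> powr (- (q + 2 * \<eta>) / 2))) (a r)"
      proof -
      have "smooth_symbol \<tau> (16 * r powr \<eta> * \<tau> powr (- (q + 2 * \<eta>) / 2)) (\<lambda>k. real k powr q * heat_symbol \<tau> k * (1 - heat_symbol r k))"
        using r q \<sigma> by (intro smooth_symbol_powr_increment \<tau>) auto
      then show ?thesis unfolding aeq by (rule sc) (use g r in simp)
    qed
    also have "1 / g * r powr (- \<sigma> - 1) * (16 * r powr \<eta> * \<tau> powr (- (q + 2 * \<eta>) / 2)) = A r"
    proof -
      have "r powr (- \<sigma> - 1) * r powr \<eta> = r powr (\<eta> - \<sigma> - 1)"
        unfolding powr_add[symmetric] by (rule arg_cong[where f="\<lambda>z. r powr z"]) simp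
      then show ?thesis by (simp add: A_def mult_ac)
    qed
    finally show "smooth_symbol \<tau> (A r) (a r)" .
  next
    fix k :: nat assume k: "k \<ge> 1"
    have "integrable ?N (heat_increment \<sigma> ((real k)\<^sup>2))"
      using k by (intro integrable_lebesgue_on_mono[OF integrable_heat_increment(1)[OF \<sigma>(1) \<sigma>1]]) auto
    then show "integrable ?N (\<lambda>r. a r k)" unfolding a_def by simp
  next
    show "integrable ?N A" unfolding A_def using nn_integral_powr_0(2)[of "\<eta> - \<sigma> - 1" \<epsilon>] \<sigma> \<epsilon> by simp
  qed
  moreover have "(LINT r|?N. A r) = 16 * (\<epsilon> powr (\<eta> - \<sigma>) / (\<eta> - \<sigma>) / g) * \<tau> powr (- (q + 2 * \<eta>) / 2)"
    unfolding A_def using nn_integral_powr_0(3)[of "\<eta> - \<sigma> - 1" \<epsilon>] \<sigma> \<epsilon> by simp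
  moreover have "(LINT r|?N. a r k) = real k powr q * heat_symbol \<tau> k * (((real k)\<^sup>2) powr \<sigma> - trunc_symbol \<sigma> \<epsilon> ((real k)\<^sup>2))" if "k \<ge> 1" for k
    using powr_minus_trunc_symbol[OF \<sigma>(1) \<sigma>1 _ \<epsilon>, of "(real k)\<^sup>2"] that by (simp add: a_def)
  ultimately show ?thesis unfolding g_def[symmetric] by (simp add: smooth_symbol_def)
qed

lemma kernel_bound_mono: "kernel_bound a A \<Longrightarrow> A \<le> B \<Longrightarrow> kernel_bound a B"
  unfolding kernel_bound_def by (blast intro: order_trans ennreal_leI)

lemma kernel_bound_crude_powr:
  assumes \<tau>: "\<tau> > 0" and \<alpha>: "0 \<le> \<alpha>" "\<alpha> \<le> 2" and D: "D \<ge> 0"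
    and a: "\<And>k. k \<ge> 1 \<Longrightarrow> \<bar>a k\<bar> \<le> D * real k powr \<alpha> * heat_symbol \<tau> k"
  shows "kernel_bound a (32 * D * \<tau> powr (- (\<alpha> + 1) / 2))"
proof -
  have le: "\<bar>a (Suc j)\<bar> \<le> D * (2 * \<tau> powr (- (\<alpha> / 2))) * heat_symbol (\<tau> / 2) (Suc j)" for j
  proof -
    let ?x = "real (Suc j)"
    let ?v = "?x\<^sup>2 * \<tau>"
    have "?x powr (2 * (\<alpha> / 2)) = \<tau> powr (- (\<alpha> / 2)) * ?v powr (\<alpha> / 2)" using \<tau> by (intro powr_scale) auto
    also have "\<dots> \<le> \<tau> powr (- (\<alpha> / 2)) * (1 + ?v)" using \<tau> \<alpha> by (intro mult_left_mono powr_le_one_plus) auto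
    finally have "?x powr \<alpha> * heat_symbol \<tau> (Suc j) \<le> \<tau> powr (- (\<alpha> / 2)) * (1 + ?v) * exp (- ?v)"
      by (simp add: heat_symbol_def mult_right_mono)
    also have "\<dots> \<le> \<tau> powr (- (\<alpha> / 2)) * (2 * exp (- (?v / 2)))"
      unfolding mult.assoc using \<tau> by (intro mult_left_mono poly_le_exp_half) auto
    finally have "D * (?x powr \<alpha> * heat_symbol \<tau> (Suc j)) \<le> D * (\<tau> powr (- (\<alpha> / 2)) * (2 * exp (- (?v / 2))))"
      using D by (rule mult_left_mono)
    then show ?thesis using a[of "Suc j"] by (simp add: heat_symbol_def mult_ac)
  qed
  have hs: "summable (\<lambda>j. heat_symbol (\<tau> / 2) (Suc j))" "(\<Sum>j. heat_symbol (\<tau> / 2) (Suc j)) \<le> 2 / sqrt (\<tau> / 2)"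
    using heat_symbol_summable[of "\<tau> / 2"] \<tau> by (simp_all add: abs_of_pos[OF heat_symbol_pos])
  have s1: "summable (\<lambda>j. D * (2 * \<tau> powr (- (\<alpha> / 2))) * heat_symbol (\<tau> / 2) (Suc j))"
    by (intro summable_mult hs)
  have s: "summable (\<lambda>j. \<bar>a (Suc j)\<bar>)"
    by (rule summable_comparison_test'[OF s1]) (use le in auto)
  have "(\<Sum>j. \<bar>a (Suc j)\<bar>) \<le> (\<Sum>j. D * (2 * \<tau> powr (- (\<alpha> / 2))) * heat_symbol (\<tau> / 2) (Suc j))"
    by (intro suminf_le s s1 le)
  also have "\<dots> \<le> D * (2 * \<tau> powr (- (\<alpha> / 2))) * (2 / sqrt (\<tau> / 2))"
    unfolding suminf_mult[OF hs(1)] using D by (intro mult_left_mono hs) auto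
  also have "\<dots> \<le> D * (2 * \<tau> powr (- (\<alpha> / 2))) * (4 / sqrt \<tau>)"
  proof -
    have "sqrt 2 \<le> 2" by (rule real_le_lsqrt) auto
    then show ?thesis using D \<tau> by (intro mult_left_mono) (auto simp: real_sqrt_divide field_simps)
  qed
  also have "\<dots> = 8 * D * \<tau> powr (- (\<alpha> + 1) / 2)"
  proof -
    have "- (\<alpha> + 1) / 2 = - (\<alpha> / 2) + - (1 / 2)" by (simp add: field_simps)
    then have "\<tau> powr (- (\<alpha> + 1) / 2) = \<tau> powr (- (\<alpha> / 2)) / sqrt \<tau>"
      using \<tau> by (simp only: powr_add powr_minus_divide powr_half_sqrt) simp
    then show ?thesis by simp
  qed
  finally have kb: "kernel_bound a (pi * (8 * D * \<tau> powr (- (\<alpha> + 1) / 2)))" by (rule kernel_bound_crude[OF s])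
  have "pi * (8 * D * \<tau> powr (- (\<alpha> + 1) / 2)) \<le> 4 * (8 * D * \<tau> powr (- (\<alpha> + 1) / 2))"
    using D pi_less_4 by (intro mult_right_mono) auto
  then have "pi * (8 * D * \<tau> powr (- (\<alpha> + 1) / 2)) \<le> 32 * D * \<tau> powr (- (\<alpha> + 1) / 2)" by simp
  with kb show ?thesis by (rule kernel_bound_mono)
qed

section \<open>Fractional powers of heat potentials\<close>

lemma nn_integral_powr_reflect:
  fixes a t C :: real
  assumes "a > -1" "t \<ge> 0" "C \<ge> 0"
  shows "(\<integral>\<^sup>+s. ennreal (C * (t - s) powr a) \<partial>lebesgue_on {0<..<t}) = ennreal (C * t powr (a + 1) / (a + 1))"
proof -
  have "(\<integral>\<^sup>+s. ennreal ((t - s) powr a) \<partial>lebesgue_on {0<..<t}) = (\<integral>\<^sup>+r. ennreal (r powr a) \<partial>lebesgue_on {0<..<t})"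
  proof -
    have "(\<integral>\<^sup>+r. ennreal (r powr a) * indicator {0<..<t} r \<partial>lborel) = ennreal \<bar>-1\<bar> * (\<integral>\<^sup>+s. ennreal ((t + (-1) * s) powr a) * indicator {0<..<t} (t + (-1) * s) \<partial>lborel)"
      by (rule nn_integral_real_affine) auto
    also have "\<dots> = (\<integral>\<^sup>+s. ennreal ((t - s) powr a) * indicator {0<..<t} s \<partial>lborel)"
      by (simp, intro nn_integral_cong) (auto simp: indicator_def)
    finally show ?thesis by (simp add: nn_integral_lebesgue_on_eq_lborel)
  qed
  then have "(\<integral>\<^sup>+s. ennreal C * ennreal ((t - s) powr a) \<partial>lebesgue_on {0<..<t}) = ennreal C * ennreal (t powr (a + 1) / (a + 1))"
    using nn_integral_powr_0(1)[OF assms(1,2)] by (subst nn_integral_cmult) auto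
  then show ?thesis using assms by (simp add: ennreal_mult[symmetric])
qed

lemma series_integral_powr_bounds:
  assumes p: "p \<ge> 1" and M: "M \<ge> 0" and src: "source t p M c" and t: "t \<ge> 0" and C: "C > 0" and \<kappa>: "\<kappa> < 1"
    and am: "\<And>k. (\<lambda>s. a s k) \<in> borel_measurable (lebesgue_on {0<..<t})"
    and kb: "\<forall>s\<in>{0<..<t}. kernel_bound (a s) (C * (t - s) powr (- \<kappa>))"
  shows "series_integral a c t \<in> Lp_space p"
    and "Lp_norm p (series_integral a c t) \<le> C * t powr (1 - \<kappa>) / (1 - \<kappa>) * M"
    and "k \<ge> 1 \<Longrightarrow> sine_coef (series_integral a c t) k = (LINT s|lebesgue_on {0<..<t}. a s k * c s k)"
    and "k \<ge> 1 \<Longrightarrow> integrable (lebesgue_on {0<..<t}) (\<lambda>s. a s k * c s k)"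
proof -
  have B: "(\<integral>\<^sup>+s. ennreal (C * (t - s) powr (- \<kappa>)) \<partial>lebesgue_on {0<..<t}) \<le> ennreal (C * t powr (1 - \<kappa>) / (1 - \<kappa>))"
    using nn_integral_powr_reflect[of "- \<kappa>" t C] C \<kappa> t by simp
  have A0: "C * (t - s) powr (- \<kappa>) > 0" if "s \<in> {0<..<t}" for s using that C by simp
  have B0: "C * t powr (1 - \<kappa>) / (1 - \<kappa>) \<ge> 0" using C \<kappa> by simp
  have Am: "(\<lambda>s. C * (t - s) powr (- \<kappa>)) \<in> borel_measurable (lebesgue_on {0<..<t})" by measurable
  show "series_integral a c t \<in> Lp_space p"
    "Lp_norm p (series_integral a c t) \<le> C * t powr (1 - \<kappa>) / (1 - \<kappa>) * M"
    "k \<ge> 1 \<Longrightarrow> sine_coef (series_integral a c t) k = (LINT s|lebesgue_on {0<..<t}. a s k * c s k)"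
    "k \<ge> 1 \<Longrightarrow> integrable (lebesgue_on {0<..<t}) (\<lambda>s. a s k * c s k)"
    by (rule series_integral_bounds[OF p M src am Am _ A0 B B0]; use kb in auto)+
qed

lemma sq_powr_half: "k \<ge> 1 \<Longrightarrow> ((real k)\<^sup>2) powr (s / 2) = real k powr s"
  by (simp add: powr_powr flip: powr_numeral)

text \<open>The truncated operator applied to the potential, subtracted from the proposed limit, has the same
  coefficients as the potential with the multiplier in \<open>k2\<close>. The two functions agree almost everywhere,
  and the norm of the latter is at most a multiple of \<open>\<epsilon> powr \<delta>\<close>.\<close>

lemma frac_laplacian_small_series_integral:
  assumes s: "0 < s" "s < 2" and M: "M \<ge> 0" and src: "source t 1 M c" and t: "t \<ge> 0"
    and am: "\<And>k. (\<lambda>u. a u k) \<in> borel_measurable (lebesgue_on {0<..<t})"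
    and C: "C0 > 0" "C1 > 0" "C2 > 0" and \<kappa>: "\<kappa>0 < 1" "\<kappa>1 < 1" "\<kappa>2 < 1"
    and k0: "\<And>u. u \<in> {0<..<t} \<Longrightarrow> kernel_bound (a u) (C0 * (t - u) powr (- \<kappa>0))"
    and k1: "\<And>u. u \<in> {0<..<t} \<Longrightarrow> kernel_bound (\<lambda>k. real k powr s * a u k) (C1 * (t - u) powr (- \<kappa>1))"
    and k2: "\<And>u \<epsilon>. u \<in> {0<..<t} \<Longrightarrow> \<epsilon> > 0 \<Longrightarrow>
      kernel_bound (\<lambda>k. a u k * (((real k)\<^sup>2) powr (s / 2) - trunc_symbol (s / 2) \<epsilon> ((real k)\<^sup>2))) (C2 * \<epsilon> powr \<delta> * (t - u) powr (- \<kappa>2))"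
    and \<delta>: "\<delta> > 0"
  shows "frac_laplacian_small s (series_integral a c t) (series_integral (\<lambda>u k. real k powr s * a u k) c t)"
proof -
  let ?J = "lebesgue_on {0<..<t}"
  let ?f = "series_integral a c t" and ?g = "series_integral (\<lambda>u k. real k powr s * a u k) c t"
  note [measurable] = am
  have k0': "\<forall>u\<in>{0<..<t}. kernel_bound (a u) (C0 * (t - u) powr (- \<kappa>0))"
    and k1': "\<forall>u\<in>{0<..<t}. kernel_bound (\<lambda>k. real k powr s * a u k) (C1 * (t - u) powr (- \<kappa>1))"
    using k0 k1 by blast+
  note f = series_integral_powr_bounds[OF order_refl M src t C(1) \<kappa>(1) am k0']
  have am1: "(\<lambda>u. real k powr s * a u k) \<in> borel_measurable ?J" for k by measurable
  note g = series_integral_powr_bounds[OF order_refl M src t C(2) \<kappa>(2) am1 k1']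
  define D where "D \<epsilon> k = ((real k)\<^sup>2) powr (s / 2) - trunc_symbol (s / 2) \<epsilon> ((real k)\<^sup>2)" for \<epsilon> k
  have fi: "integrable interval_pi ?f" and gi: "integrable interval_pi ?g"
    using f(1) g(1) by (auto simp: Lp_space_1_iff)
  define K where "K = C2 * (t powr (1 - \<kappa>2) / (1 - \<kappa>2) * M)"
  have bound: "(\<integral>\<^sup>+x. ennreal \<bar>frac_laplacian_trunc s \<epsilon> ?f x - ?g x\<bar> \<partial>interval_pi) \<le> ennreal (\<epsilon> powr \<delta> * K)" if \<epsilon>: "\<epsilon> > 0" for \<epsilon>
  proof -
    let ?T = "frac_laplacian_trunc s \<epsilon> ?f"
    let ?W = "series_integral (\<lambda>u k. a u k * D \<epsilon> k) c t"
    have am2: "(\<lambda>u. a u k * D \<epsilon> k) \<in> borel_measurable ?J" for k by measurable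
    have C2e: "C2 * \<epsilon> powr \<delta> > 0" using C \<epsilon> by simp
    have k2': "\<forall>u\<in>{0<..<t}. kernel_bound (\<lambda>k. a u k * D \<epsilon> k) (C2 * \<epsilon> powr \<delta> * (t - u) powr (- \<kappa>2))"
      using k2[OF _ \<epsilon>] unfolding D_def by blast
    note W = series_integral_powr_bounds[OF order_refl M src t C2e \<kappa>(3) am2 k2']
    have Ti: "integrable interval_pi ?T" by (rule frac_laplacian_trunc_L1(2)[OF s fi \<epsilon>])
    have Wi: "integrable interval_pi ?W" using W(1) by (simp add: Lp_space_1_iff)
    have "AE x in interval_pi. ?g x - ?T x = ?W x"
    proof (rule sine_coef_eq_imp_AE_eq)
      fix k :: nat assume k: "k \<ge> 1"
      define X where "X = (LINT u|?J. a u k * c u k)"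
      have "sine_coef ?g k = real k powr s * X"
        using g(3)[OF k] by (simp add: X_def mult.assoc)
      moreover have "sine_coef ?T k = trunc_symbol (s / 2) \<epsilon> ((real k)\<^sup>2) * X"
        using frac_laplacian_trunc_L1(3)[OF s fi \<epsilon> k] f(3)[OF k] by (simp add: X_def)
      moreover have "sine_coef ?W k = D \<epsilon> k * X"
        using W(3)[OF k] by (simp add: X_def mult_ac)
      moreover have "D \<epsilon> k = real k powr s - trunc_symbol (s / 2) \<epsilon> ((real k)\<^sup>2)"
        using sq_powr_half[OF k] by (simp add: D_def)
      ultimately show "sine_coef (\<lambda>x. ?g x - ?T x) k = sine_coef ?W k"
        using sine_coef_diff[OF gi Ti, of k] by (simp add: left_diff_distrib)
    qed (use gi Ti Wi in auto)
    then have "AE x in interval_pi. ennreal \<bar>?T x - ?g x\<bar> = ennreal (\<bar>?W x\<bar> powr 1)"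
      by eventually_elim (simp add: abs_minus_commute)
    then have "(\<integral>\<^sup>+x. ennreal \<bar>?T x - ?g x\<bar> \<partial>interval_pi) = (\<integral>\<^sup>+x. ennreal (\<bar>?W x\<bar> powr 1) \<partial>interval_pi)"
      by (rule nn_integral_cong_AE)
    also have "\<dots> = ennreal (Lp_norm 1 ?W powr 1)" by (rule nn_integral_Lp_norm[OF W(1)]) simp
    also have "\<dots> \<le> ennreal (\<epsilon> powr \<delta> * K)"
      using W(2) Lp_norm_nonneg[of 1 ?W] by (intro ennreal_leI) (simp add: K_def mult_ac)
    finally show ?thesis .
  qed
  have "((\<lambda>\<epsilon>. \<epsilon> powr \<delta> * K) \<longlongrightarrow> 0 powr \<delta> * K) (at_right 0)"
    using \<delta> by (intro tendsto_intros tendsto_powr2 tendsto_ident_at) (auto simp: eventually_at_filter)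
  then have "((\<lambda>\<epsilon>. ennreal (\<epsilon> powr \<delta> * K)) \<longlongrightarrow> ennreal 0) (at_right 0)" by (intro tendsto_ennrealI) simp
  then have lim: "((\<lambda>\<epsilon>. ennreal (\<epsilon> powr \<delta> * K)) \<longlongrightarrow> 0) (at_right 0)" by simp
  have "((\<lambda>\<epsilon>. \<integral>\<^sup>+x. ennreal \<bar>frac_laplacian_trunc s \<epsilon> ?f x - ?g x\<bar> \<partial>interval_pi) \<longlongrightarrow> 0) (at_right 0)"
    by (rule tendsto_sandwich[OF _ _ tendsto_const lim])
      (use eventually_at_right_less[of "0::real"] bound in \<open>auto elim: eventually_mono\<close>)
  then show ?thesis using f(1) g(1) by (simp add: frac_laplacian_small_def)
qed

text \<open>Formally \<open>\<integral>\<^sub>0\<^sup>t (-\<Delta>)\<^bsup>q/2\<^esup> exp ((t - s)\<Delta>) (g s) ds\<close>, where \<open>c\<close> are the coefficients of \<open>g\<close>.\<close>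

definition heat_potential :: "real \<Rightarrow> (real \<Rightarrow> nat \<Rightarrow> real) \<Rightarrow> real \<Rightarrow> real \<Rightarrow> real"
  where "heat_potential q c t = series_integral (\<lambda>s k. real k powr q * heat_symbol (t - s) k) c t"

lemma kernel_bound_powr:
  assumes "\<tau> > 0" "1 \<le> q" "q \<le> 2"
  shows "kernel_bound (\<lambda>k. real k powr q * heat_symbol \<tau> k) (112 * \<tau> powr (- (q / 2)))"
  using smooth_symbol_kernel_bound[OF smooth_symbol_powr[OF assms] assms(1)] assms by simp

lemma heat_potential_props:
  assumes p: "p \<ge> 1" and M: "M \<ge> 0" and src: "source t p M c" and t: "t \<ge> 0" and q: "1 \<le> q" "q < 2"
  shows "heat_potential q c t \<in> Lp_space p"
    and "Lp_norm p (heat_potential q c t) \<le> 112 * t powr (1 - q / 2) / (1 - q / 2) * M"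
    and "k \<ge> 1 \<Longrightarrow> sine_coef (heat_potential q c t) k = (LINT s|lebesgue_on {0<..<t}. real k powr q * heat_symbol (t - s) k * c s k)"
    and "k \<ge> 1 \<Longrightarrow> integrable (lebesgue_on {0<..<t}) (\<lambda>s. real k powr q * heat_symbol (t - s) k * c s k)"
  unfolding heat_potential_def
  by (intro series_integral_powr_bounds[OF p M src t, where C=112 and \<kappa>="q/2"] kernel_bound_powr; use q in \<open>auto intro!: kernel_bound_powr\<close>)+

text \<open>Two steps of order \<open>s = 1 + \<beta>/2\<close> lead from \<open>-\<gamma>\<close> over \<open>1 + \<beta>/2 - \<gamma> < 1\<close> to \<open>2 + \<beta> - \<gamma> < 2\<close>. The first stays
  where the crude bound \<open>\<tau> powr (-(q + 1) / 2)\<close> for the order \<open>q\<close> is integrable; the second needs the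
  sharp bound \<open>\<tau> powr (-q / 2)\<close>.\<close>

lemma heat_potential_frac_laplacian:
  fixes \<beta> \<gamma> :: real
  assumes \<beta>\<gamma>: "0 < \<beta>" "\<beta> < \<gamma>" "\<gamma> < 1" and p: "p \<ge> 1" and M: "M \<ge> 0" and src: "source t p M c" and t: "t \<ge> 0"
  shows "frac_laplacian (2 + \<beta>) (heat_potential (- \<gamma>) c t) (heat_potential (2 + \<beta> - \<gamma>) c t)"
proof -
  define s where "s = 1 + \<beta> / 2"
  have s: "0 < s" "s < 2" using \<beta>\<gamma> by (auto simp: s_def)
  have s2: "0 < s / 2" "s / 2 < 1" using s by auto
  have src1: "source t 1 (4 * M) c" by (rule source_imp_source_1[OF src p])
  have M4: "4 * M \<ge> 0" using M by simp
  define g where "g = \<bar>Gamma (- (s / 2))\<bar>"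
  have g: "g > 0" using Gamma_neg_less_0[OF s2] by (simp add: g_def)
  have hn: "heat_symbol \<tau> k \<ge> 0" for \<tau> k using heat_symbol_pos[of \<tau> k] by simp
  have am: "(\<lambda>u. real k powr q * heat_symbol (t - u) k) \<in> borel_measurable (lebesgue_on {0<..<t})" for q k by measurable
  have shift: "real k powr s * (real k powr q * h) = real k powr (q + s) * h" for k q h
    by (simp add: powr_add mult_ac)
  have kbc: "kernel_bound (\<lambda>k. real k powr \<alpha> * heat_symbol \<tau> k) (32 * \<tau> powr (- ((\<alpha> + 1) / 2)))"
    if "\<tau> > 0" "0 \<le> \<alpha>" "\<alpha> \<le> 2" for \<alpha> \<tau>
  proof -
    have "kernel_bound (\<lambda>k. real k powr \<alpha> * heat_symbol \<tau> k) (32 * 1 * \<tau> powr (- (\<alpha> + 1) / 2))"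
      by (rule kernel_bound_crude_powr[OF that]) (use hn in \<open>auto simp: abs_mult\<close>)
    then show ?thesis by (simp only: minus_divide_left mult_1_right)
  qed
  have step1: "frac_laplacian_small s (heat_potential (- \<gamma>) c t) (heat_potential (- \<gamma> + s) c t)"
  proof -
    \<comment> \<open>Needed: \<open>s / 2 < \<eta> \<le> 1\<close> and an error of order \<open>2 * \<eta> - \<gamma> < 1\<close>.\<close>
    define \<eta> where "\<eta> = 1 / 2 + 3 * \<gamma> / 8"
    have \<eta>: "s / 2 < \<eta>" "\<eta> \<le> 1" using \<beta>\<gamma> by (auto simp: \<eta>_def s_def)
    define C2 where "C2 = 32 * (1 / g / (\<eta> - s / 2))"
    have "frac_laplacian_small s (series_integral (\<lambda>u k. real k powr (- \<gamma>) * heat_symbol (t - u) k) c t)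
       (series_integral (\<lambda>u k. real k powr s * (real k powr (- \<gamma>) * heat_symbol (t - u) k)) c t)"
    proof (rule frac_laplacian_small_series_integral[OF s M4 src1 t am, where ?C0.0=32 and ?C1.0=32 and ?\<kappa>0.0="1/2" and ?\<kappa>1.0="(- \<gamma> + s + 1) / 2"
        and ?C2.0=C2 and ?\<kappa>2.0="(2 * \<eta> - \<gamma> + 1) / 2" and \<delta>="\<eta> - s / 2"])
      fix u assume "u \<in> {0<..<t}"
      then have tu: "t - u > 0" by simp
      have k1: "real k powr (- \<gamma>) \<le> real k powr 0" if "k \<ge> 1" for k :: nat using that \<beta>\<gamma> by (intro powr_mono) auto
      show "kernel_bound (\<lambda>k. real k powr (- \<gamma>) * heat_symbol (t - u) k) (32 * (t - u) powr (- (1 / 2)))"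
      proof -
        have "kernel_bound (\<lambda>k. real k powr (- \<gamma>) * heat_symbol (t - u) k) (32 * 1 * (t - u) powr (- (0 + 1) / 2))"
        proof (rule kernel_bound_crude_powr[OF tu])
          fix k :: nat assume k: "k \<ge> 1"
          have "real k powr (- \<gamma>) * heat_symbol (t - u) k \<le> 1 * heat_symbol (t - u) k"
            using k1[OF k] k by (intro mult_right_mono hn) simp
          then show "\<bar>real k powr (- \<gamma>) * heat_symbol (t - u) k\<bar> \<le> 1 * real k powr 0 * heat_symbol (t - u) k"
            using hn[of "t - u" k] k by (simp add: abs_mult)
        qed auto
        then show ?thesis by simp
      qed
      show "kernel_bound (\<lambda>k. real k powr s * (real k powr (- \<gamma>) * heat_symbol (t - u) k)) (32 * (t - u) powr (- ((- \<gamma> + s + 1) / 2)))"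
        unfolding shift by (rule kbc[OF tu]) (use \<beta>\<gamma> in \<open>auto simp: s_def\<close>)
      fix \<epsilon> :: real assume \<epsilon>: "\<epsilon> > 0"
      let ?D = "\<lambda>k. ((real k)\<^sup>2) powr (s / 2) - trunc_symbol (s / 2) \<epsilon> ((real k)\<^sup>2)"
      have "kernel_bound (\<lambda>k. real k powr (- \<gamma>) * heat_symbol (t - u) k * ?D k)
        (32 * (1 / g / (\<eta> - s / 2) * \<epsilon> powr (\<eta> - s / 2)) * (t - u) powr (- (2 * \<eta> - \<gamma> + 1) / 2))"
      proof (rule kernel_bound_crude_powr[OF tu])
        show "0 \<le> 2 * \<eta> - \<gamma>" "2 * \<eta> - \<gamma> \<le> 2" using \<beta>\<gamma> by (auto simp: \<eta>_def)
        show "0 \<le> 1 / g / (\<eta> - s / 2) * \<epsilon> powr (\<eta> - s / 2)" using g \<eta> by simp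
        fix k :: nat assume k: "k \<ge> 1"
        have "\<bar>?D k\<bar> \<le> 1 / g * (\<epsilon> powr (\<eta> - s / 2) / (\<eta> - s / 2)) * ((real k)\<^sup>2) powr \<eta>"
          unfolding g_def by (rule abs_powr_minus_trunc_symbol_le[OF s2 _ \<epsilon> \<eta>]) (use k in simp)
        also have "((real k)\<^sup>2) powr \<eta> = real k powr (2 * \<eta>)" using sq_powr_half[OF k, of "2 * \<eta>"] by simp
        finally have D: "\<bar>?D k\<bar> \<le> 1 / g * (\<epsilon> powr (\<eta> - s / 2) / (\<eta> - s / 2)) * real k powr (2 * \<eta>)" .
        have "\<bar>real k powr (- \<gamma>) * heat_symbol (t - u) k * ?D k\<bar> = real k powr (- \<gamma>) * heat_symbol (t - u) k * \<bar>?D k\<bar>"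
          using hn[of "t - u" k] by (simp add: abs_mult)
        also have "\<dots> \<le> real k powr (- \<gamma>) * heat_symbol (t - u) k * (1 / g * (\<epsilon> powr (\<eta> - s / 2) / (\<eta> - s / 2)) * real k powr (2 * \<eta>))"
          by (intro mult_left_mono D mult_nonneg_nonneg hn) auto
        also have "\<dots> = 1 / g / (\<eta> - s / 2) * \<epsilon> powr (\<eta> - s / 2) * (real k powr (- \<gamma>) * real k powr (2 * \<eta>)) * heat_symbol (t - u) k"
          by simp
        also have "real k powr (- \<gamma>) * real k powr (2 * \<eta>) = real k powr (2 * \<eta> - \<gamma>)"
          unfolding powr_add[symmetric] by simp
        finally show "\<bar>real k powr (- \<gamma>) * heat_symbol (t - u) k * ?D k\<bar> \<le> 1 / g / (\<eta> - s / 2) * \<epsilon> powr (\<eta> - s / 2) * real k powr (2 * \<eta> - \<gamma>) * heat_symbol (t - u) k" .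
      qed
      then show "kernel_bound (\<lambda>k. real k powr (- \<gamma>) * heat_symbol (t - u) k * ?D k) (C2 * \<epsilon> powr (\<eta> - s / 2) * (t - u) powr (- ((2 * \<eta> - \<gamma> + 1) / 2)))"
        unfolding C2_def minus_divide_left by (simp add: mult.assoc)
    qed (use \<beta>\<gamma> g \<eta> in \<open>auto simp: s_def \<eta>_def C2_def\<close>)
    then show ?thesis unfolding heat_potential_def shift .
  qed
  have step2: "frac_laplacian_small s (heat_potential (- \<gamma> + s) c t) (heat_potential (- \<gamma> + s + s) c t)"
  proof -
    \<comment> \<open>Needed: \<open>s / 2 < \<eta> < 1\<close> and an error of order \<open>q + 2 * \<eta>\<close> in the interval \<open>[1, 2)\<close>; here it equals \<open>2 - (\<gamma> - \<beta>) / 2\<close>.\<close>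
    define \<eta> where "\<eta> = 1 / 2 + \<gamma> / 4"
    define q where "q = - \<gamma> + s"
    have \<eta>: "s / 2 < \<eta>" "\<eta> < 1" using \<beta>\<gamma> by (auto simp: \<eta>_def s_def)
    have q: "0 \<le> q" "1 \<le> q + 2 * \<eta>" "q + 2 * \<eta> < 2" "1 \<le> q + s" "q + s < 2" "q < 1" using \<beta>\<gamma> by (auto simp: q_def \<eta>_def s_def)
    define C2 where "C2 = 112 * (1 / (\<eta> - s / 2) / g)"
    have "frac_laplacian_small s (series_integral (\<lambda>u k. real k powr q * heat_symbol (t - u) k) c t)
       (series_integral (\<lambda>u k. real k powr s * (real k powr q * heat_symbol (t - u) k)) c t)"
    proof (rule frac_laplacian_small_series_integral[OF s M4 src1 t am, where ?C0.0=32 and ?C1.0=112 and ?\<kappa>0.0="(q + 1) / 2" and ?\<kappa>1.0="(q + s) / 2"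
        and ?C2.0=C2 and ?\<kappa>2.0="(q + 2 * \<eta>) / 2" and \<delta>="\<eta> - s / 2"])
      fix u assume "u \<in> {0<..<t}"
      then have tu: "t - u > 0" by simp
      show "kernel_bound (\<lambda>k. real k powr q * heat_symbol (t - u) k) (32 * (t - u) powr (- ((q + 1) / 2)))"
        by (rule kbc[OF tu]) (use q in auto)
      show "kernel_bound (\<lambda>k. real k powr s * (real k powr q * heat_symbol (t - u) k)) (112 * (t - u) powr (- ((q + s) / 2)))"
        unfolding shift by (rule kernel_bound_powr[OF tu]) (use q in auto)
      fix \<epsilon> :: real assume \<epsilon>: "\<epsilon> > 0"
      let ?D = "\<lambda>k. ((real k)\<^sup>2) powr (s / 2) - trunc_symbol (s / 2) \<epsilon> ((real k)\<^sup>2)"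
      have *: "kernel_bound (\<lambda>k. real k powr q * heat_symbol (t - u) k * ?D k)
        (7 * (16 * (\<epsilon> powr (\<eta> - s / 2) / (\<eta> - s / 2) / \<bar>Gamma (- (s / 2))\<bar>) * (t - u) powr (- (q + 2 * \<eta>) / 2)))"
        by (rule smooth_symbol_kernel_bound[OF smooth_symbol_trunc_defect[OF tu s2(1) \<eta>(1) q(1) \<eta>(2) q(2) less_imp_le[OF q(3)] \<epsilon>] tu])
          (use \<epsilon> \<eta> g tu in \<open>simp add: g_def\<close>)
      show "kernel_bound (\<lambda>k. real k powr q * heat_symbol (t - u) k * ?D k) (C2 * \<epsilon> powr (\<eta> - s / 2) * (t - u) powr (- ((q + 2 * \<eta>) / 2)))"
        proof -
          have "7 * (16 * (\<epsilon> powr (\<eta> - s / 2) / (\<eta> - s / 2) / \<bar>Gamma (- (s / 2))\<bar>) * (t - u) powr (- (q + 2 * \<eta>) / 2)) = C2 * \<epsilon> powr (\<eta> - s / 2) * (t - u) powr (- ((q + 2 * \<eta>) / 2))"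
            unfolding minus_divide_left[symmetric] by (simp add: C2_def g_def)
          then show ?thesis using * by simp
        qed
    qed (use \<beta>\<gamma> g \<eta> q in \<open>auto simp: C2_def\<close>)
    then show ?thesis unfolding heat_potential_def shift q_def .
  qed
  have n: "nat \<lfloor>(2 + \<beta>) / 2\<rfloor> + 1 = 2"
  proof -
    have "\<lfloor>(2 + \<beta>) / 2\<rfloor> = 1" using \<beta>\<gamma> by (intro floor_unique) auto
    then show ?thesis by simp
  qed
  have s_eq: "(2 + \<beta>) / real 2 = s" by (simp add: s_def)
  have e: "- \<gamma> + s + s = 2 + \<beta> - \<gamma>" by (simp add: s_def)
  show ?thesis
    unfolding frac_laplacian_def n Let_def s_eq
    using step1 step2 unfolding e by (auto simp: numeral_2_eq_2 OO_def)
qed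

section \<open>Dependence of heat potentials on time\<close>

lemma kernel_bound_uminus:
  assumes "kernel_bound a A"
  shows "kernel_bound (\<lambda>k. - a k) A"
proof -
  have s: "summable (\<lambda>j. \<bar>a (Suc j)\<bar>)" using assms by (simp add: kernel_bound_def)
  have "summable (\<lambda>j. a (Suc j) * eigenfun (Suc j) x * eigenfun (Suc j) y)" for x y
    by (rule summable_comparison_test'[OF s]) (use abs_sine_term_le in auto)
  then have "sine_kernel (\<lambda>k. - a k) x y = - sine_kernel a x y" for x y
    by (simp add: sine_kernel_def suminf_minus)
  then show ?thesis using assms by (simp add: kernel_bound_def)
qed

lemma lebesgue_on_Ioo_extend:
  fixes g :: "real \<Rightarrow> real"
  assumes "0 \<le> t'" "t' \<le> t"
  shows "integrable (lebesgue_on {0<..<t'}) g \<longleftrightarrow> integrable (lebesgue_on {0<..<t}) (\<lambda>s. (if s < t' then g s else 0))"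
    and "(LINT s|lebesgue_on {0<..<t'}. g s) = (LINT s|lebesgue_on {0<..<t}. (if s < t' then g s else 0))"
proof -
  have e: "(\<lambda>s. indicator {0<..<t} s * (if s < t' then g s else 0)) = (\<lambda>s. indicator {0<..<t'} s * g s)"
    using assms by (auto simp: indicator_def fun_eq_iff)
  show "integrable (lebesgue_on {0<..<t'}) g \<longleftrightarrow> integrable (lebesgue_on {0<..<t}) (\<lambda>s. (if s < t' then g s else 0))"
    by (simp add: integrable_restrict_space e)
  show "(LINT s|lebesgue_on {0<..<t'}. g s) = (LINT s|lebesgue_on {0<..<t}. (if s < t' then g s else 0))"
    by (simp add: integral_restrict_space e)
qed

lemma AE_eq_imp_Lp_norm_eq:
  assumes "AE x in interval_pi. f x = g x" "f \<in> borel_measurable interval_pi" "g \<in> borel_measurable interval_pi"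
  shows "Lp_norm p f = Lp_norm p g"
proof -
  have "(LINT x|interval_pi. \<bar>f x\<bar> powr p) = (LINT x|interval_pi. \<bar>g x\<bar> powr p)"
    by (rule integral_cong_AE) (use assms in \<open>auto elim: eventually_mono\<close>)
  then show ?thesis by (simp add: Lp_norm_def)
qed

text \<open>Up to \<open>t'\<close> the difference of the integrands contains \<open>1 - exp ((t - t')\<Delta>)\<close>, which gives the factor
  \<open>(t - t') powr \<eta>\<close>; the part of the integral from \<open>t'\<close> to \<open>t\<close> is small because the interval is short.\<close>

lemma heat_potential_time_diff:
  assumes p: "p \<ge> 1" and M: "M \<ge> 0" and src: "source t p M c" and t: "0 \<le> t'" "t' < t"
    and q: "1 \<le> q" and \<eta>: "0 < \<eta>" "\<eta> \<le> 1" "q + 2 * \<eta> < 2"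
  shows "Lp_norm p (\<lambda>x. heat_potential q c t x - heat_potential q c t' x)
    \<le> 112 * ((t - t') powr \<eta> * t' powr (1 - (q + 2 * \<eta>) / 2) / (1 - (q + 2 * \<eta>) / 2) + (t - t') powr (1 - q / 2) / (1 - q / 2)) * M"
proof -
  let ?J = "lebesgue_on {0<..<t}"
  define \<kappa> where "\<kappa> = (q + 2 * \<eta>) / 2"
  define r where "r = t - t'"
  have r: "r > 0" using t by (simp add: r_def)
  have \<kappa>: "\<kappa> < 1" "q / 2 < 1" using \<eta> by (auto simp: \<kappa>_def)
  have src': "source t' p M c" using t by (intro source_subinterval[OF src]) auto
  define a where "a s k = (if s < t' then - (real k powr q * heat_symbol (t' - s) k * (1 - heat_symbol r k)) else real k powr q * heat_symbol (t - s) k)" for s k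
  define A where "A s = (if s < t' then 112 * r powr \<eta> * (t' - s) powr (- \<kappa>) else 112 * (t - s) powr (- (q / 2)))" for s
  have am: "(\<lambda>s. a s k) \<in> borel_measurable ?J" for k unfolding a_def by measurable
  have Am: "A \<in> borel_measurable ?J" unfolding A_def by measurable
  have kb: "kernel_bound (a s) (A s)" if s: "s \<in> {0<..<t}" for s
  proof (cases "s < t'")
    case True
    then have ts: "t' - s > 0" by simp
    have "kernel_bound (\<lambda>k. real k powr q * heat_symbol (t' - s) k * (1 - heat_symbol r k)) (7 * (16 * r powr \<eta> * (t' - s) powr (- (q + 2 * \<eta>) / 2)))"
      by (rule smooth_symbol_kernel_bound[OF smooth_symbol_powr_increment[OF ts _ \<eta>(1,2) _ _ r] ts]) (use q \<eta> r ts in auto)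
    from kernel_bound_uminus[OF this]
    have "kernel_bound (a s) (7 * (16 * r powr \<eta> * (t' - s) powr (- (q + 2 * \<eta>) / 2)))"
      using True by (simp add: a_def[abs_def])
    moreover have "- (q + 2 * \<eta>) / 2 = - \<kappa>" by (simp only: \<kappa>_def minus_divide_left)
    ultimately show ?thesis using True by (simp add: A_def mult.assoc)
  next
    case False
    have "kernel_bound (\<lambda>k. real k powr q * heat_symbol (t - s) k) (112 * (t - s) powr (- (q / 2)))"
      using s q \<eta> by (intro kernel_bound_powr) auto
    then show ?thesis using False by (simp add: a_def[abs_def] A_def)
  qed
  have A0: "A s > 0" if "s \<in> {0<..<t}" for s using that r by (auto simp: A_def)
  define B where "B = 112 * (r powr \<eta> * t' powr (1 - \<kappa>) / (1 - \<kappa>) + r powr (1 - q / 2) / (1 - q / 2))"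
  have B0: "B \<ge> 0" using \<kappa> by (auto simp: B_def intro!: add_nonneg_nonneg)
  have B: "(\<integral>\<^sup>+s. ennreal (A s) \<partial>?J) \<le> ennreal B"
  proof -
    have "(\<integral>\<^sup>+s. ennreal (A s) \<partial>?J) = (\<integral>\<^sup>+s. ennreal (A s) * indicator {0<..<t} s \<partial>lborel)"
      by (rule nn_integral_lebesgue_on_eq_lborel) auto
    also have "\<dots> \<le> (\<integral>\<^sup>+s. ennreal (112 * r powr \<eta> * (t' - s) powr (- \<kappa>)) * indicator {0<..<t'} s
        + ennreal (112 * (t - s) powr (- (q / 2))) * indicator {t'<..<t} s \<partial>lborel)"
    proof (rule nn_integral_mono_AE)
      show "AE s in lborel. ennreal (A s) * indicator {0<..<t} s \<le> ennreal (112 * r powr \<eta> * (t' - s) powr (- \<kappa>)) * indicator {0<..<t'} s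
        + ennreal (112 * (t - s) powr (- (q / 2))) * indicator {t'<..<t} s"
        using AE_lborel_singleton[of t'] by eventually_elim (auto simp: A_def indicator_def)
    qed
    also have "\<dots> = (\<integral>\<^sup>+s. ennreal (112 * r powr \<eta> * (t' - s) powr (- \<kappa>)) * indicator {0<..<t'} s \<partial>lborel)
        + (\<integral>\<^sup>+s. ennreal (112 * (t - s) powr (- (q / 2))) * indicator {t'<..<t} s \<partial>lborel)"
      by (rule nn_integral_add) measurable
    also have "(\<integral>\<^sup>+s. ennreal (112 * (t - s) powr (- (q / 2))) * indicator {t'<..<t} s \<partial>lborel)
       = ennreal \<bar>1\<bar> * (\<integral>\<^sup>+s. ennreal (112 * (t - (t' + 1 * s)) powr (- (q / 2))) * indicator {t'<..<t} (t' + 1 * s) \<partial>lborel)"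
      by (rule nn_integral_real_affine) auto
    also have "\<dots> = (\<integral>\<^sup>+s. ennreal (112 * (r - s) powr (- (q / 2))) * indicator {0<..<r} s \<partial>lborel)"
      by (simp, intro nn_integral_cong) (auto simp: indicator_def r_def algebra_simps)
    also have "\<dots> = (\<integral>\<^sup>+s. ennreal (112 * (r - s) powr (- (q / 2))) \<partial>lebesgue_on {0<..<r})"
      by (rule nn_integral_lebesgue_on_eq_lborel[symmetric]) auto
    also have "\<dots> = ennreal (112 * r powr (- (q / 2) + 1) / (- (q / 2) + 1))"
      using \<kappa> r by (intro nn_integral_powr_reflect) auto
    also have "(\<integral>\<^sup>+s. ennreal (112 * r powr \<eta> * (t' - s) powr (- \<kappa>)) * indicator {0<..<t'} s \<partial>lborel)
       = (\<integral>\<^sup>+s. ennreal (112 * r powr \<eta> * (t' - s) powr (- \<kappa>)) \<partial>lebesgue_on {0<..<t'})"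
      by (rule nn_integral_lebesgue_on_eq_lborel[symmetric]) auto
    also have "\<dots> = ennreal (112 * r powr \<eta> * t' powr (- \<kappa> + 1) / (- \<kappa> + 1))"
      using \<kappa> t by (intro nn_integral_powr_reflect) auto
    also have "ennreal (112 * r powr \<eta> * t' powr (- \<kappa> + 1) / (- \<kappa> + 1)) + ennreal (112 * r powr (- (q / 2) + 1) / (- (q / 2) + 1)) = ennreal B"
    proof -
      have "- \<kappa> + 1 = 1 - \<kappa>" "- (q / 2) + 1 = 1 - q / 2" by simp_all
      then show ?thesis using \<kappa> unfolding B_def
        by (subst ennreal_plus[symmetric]) (auto simp: distrib_left mult_ac)
    qed
    finally show ?thesis .
  qed
  note W = series_integral_bounds[OF p M src am Am kb A0 B B0]
  have q2: "q < 2" using \<eta> by simp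
  have t0: "t \<ge> 0" using t by simp
  note P = heat_potential_props[OF p M src t0 q q2] and P' = heat_potential_props[OF p M src' t(1) q q2]
  have Pi: "integrable interval_pi (heat_potential q c t)" "integrable interval_pi (heat_potential q c t')"
    "integrable interval_pi (series_integral a c t)"
    using Lp_imp_integrable[OF P(1) p] Lp_imp_integrable[OF P'(1) p] Lp_imp_integrable[OF W(1) p] by auto
  have "AE x in interval_pi. heat_potential q c t x - heat_potential q c t' x = series_integral a c t x"
  proof (rule sine_coef_eq_imp_AE_eq)
    fix k :: nat assume k: "k \<ge> 1"
    let ?u = "\<lambda>s. real k powr q * heat_symbol (t - s) k * c s k"
    let ?u' = "\<lambda>s. real k powr q * heat_symbol (t' - s) k * c s k"
    have i': "integrable ?J (\<lambda>s. (if s < t' then ?u' s else 0))"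
      using P'(4)[OF k] t by (subst lebesgue_on_Ioo_extend(1)[symmetric]) auto
    have "sine_coef (\<lambda>x. heat_potential q c t x - heat_potential q c t' x) k = (LINT s|?J. ?u s) - (LINT s|?J. (if s < t' then ?u' s else 0))"
      using sine_coef_diff[OF Pi(1,2), of k] P(3)[OF k] P'(3)[OF k] lebesgue_on_Ioo_extend(2)[of t' t ?u'] t by simp
    also have "\<dots> = (LINT s|?J. ?u s - (if s < t' then ?u' s else 0))"
      by (rule Bochner_Integration.integral_diff[OF P(4)[OF k] i', symmetric])
    also have "\<dots> = (LINT s|?J. a s k * c s k)"
    proof (rule Bochner_Integration.integral_cong[OF refl])
      fix s
      have "heat_symbol (t' - s) k * heat_symbol r k = heat_symbol (t - s) k"
        by (simp add: heat_symbol_mult r_def)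
      then show "?u s - (if s < t' then ?u' s else 0) = a s k * c s k"
        by (simp add: a_def algebra_simps)
    qed
    also have "\<dots> = sine_coef (series_integral a c t) k" using W(3)[OF _ _ k] by simp
    finally show "sine_coef (\<lambda>x. heat_potential q c t x - heat_potential q c t' x) k = sine_coef (series_integral a c t) k" .
  qed (use Pi in auto)
  then have "Lp_norm p (\<lambda>x. heat_potential q c t x - heat_potential q c t' x) = Lp_norm p (series_integral a c t)"
    using Pi by (intro AE_eq_imp_Lp_norm_eq) auto
  also have "\<dots> \<le> B * M" using W(2) by simp
  finally show ?thesis by (simp add: B_def r_def \<kappa>_def)
qed

text \<open>The essential supremum of a non-measurable function is infinite by definition, hence the norm
  has to be measurable in time. The potential is jointly measurable in time and space.\<close>

lemma Lp_norm_heat_potential_measurable: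
  assumes src: "source T p M c"
  shows "(\<lambda>t. Lp_norm p (heat_potential q c t)) \<in> borel_measurable (lebesgue_on {0<..<T})"
proof -
  let ?J = "lebesgue_on {0<..<T}"
  interpret J: finite_measure ?J by (rule finite_measure_lebesgue_on_Ioo)
  have [measurable]: "(\<lambda>s. c s k) \<in> borel_measurable ?J" for k using src by (simp add: source_def)
  define v where "v t x s = (if s < t then sine_series (\<lambda>k. real k powr q * heat_symbol (t - s) k * c s k) x else 0)" for t x s
  have "(\<lambda>z. v (fst (fst z)) (snd (fst z)) (snd z)) \<in> borel_measurable ((?J \<Otimes>\<^sub>M interval_pi) \<Otimes>\<^sub>M ?J)"
  proof -
    have [measurable]: "(\<lambda>z. fst (fst z)) \<in> borel_measurable ((?J \<Otimes>\<^sub>M interval_pi) \<Otimes>\<^sub>M ?J)"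
      "(\<lambda>z. snd (fst z)) \<in> borel_measurable ((?J \<Otimes>\<^sub>M interval_pi) \<Otimes>\<^sub>M ?J)"
      by (rule measurable_compose[OF measurable_fst fst_snd_borel_measurable_lebesgue_on(1)],
          rule measurable_compose[OF measurable_fst fst_snd_borel_measurable_lebesgue_on(2)])
    have [measurable]: "(\<lambda>z. heat_symbol (fst (fst z) - snd z) k) \<in> borel_measurable ((?J \<Otimes>\<^sub>M interval_pi) \<Otimes>\<^sub>M ?J)" for k
      by (rule measurable_compose[OF _ heat_symbol_measurable]) measurable
    show ?thesis unfolding v_def by measurable
  qed
  then have m: "(\<lambda>z. LINT s|?J. v (fst z) (snd z) s) \<in> borel_measurable (?J \<Otimes>\<^sub>M interval_pi)"
    by (intro J.borel_measurable_lebesgue_integral) (simp add: case_prod_beta')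
  have "(\<lambda>t. LINT x|interval_pi. \<bar>LINT s|?J. v t x s\<bar> powr p) \<in> borel_measurable ?J"
    by (rule interval_pi.borel_measurable_lebesgue_integral) (use m in \<open>simp add: case_prod_beta'\<close>)
  then have "(\<lambda>t. (LINT x|interval_pi. \<bar>LINT s|?J. v t x s\<bar> powr p) powr (1 / p)) \<in> borel_measurable ?J" by measurable
  moreover have "Lp_norm p (heat_potential q c t) = (LINT x|interval_pi. \<bar>LINT s|?J. v t x s\<bar> powr p) powr (1 / p)" if "t \<in> space ?J" for t
    using that unfolding Lp_norm_def heat_potential_def series_integral_def v_def
    by (subst lebesgue_on_Ioo_extend(2)[of t T]) auto
  ultimately show ?thesis by (rule measurable_cong[THEN iffD2, rotated])
qed

section \<open>Fractional powers of any order and Sobolev spaces\<close>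

lemma frac_laplacian_iterate:
  assumes r: "0 < r" "r < 2"
  shows "(frac_laplacian_small r ^^ Suc n) f g \<Longrightarrow> integrable interval_pi f \<and> integrable interval_pi g \<and>
      (\<forall>k\<ge>1. sine_coef g k = real k powr (r * real (Suc n)) * sine_coef f k)"
proof (induction n arbitrary: g)
  case 0
  then have "frac_laplacian_small r f g" by (simp add: eq_OO)
  then show ?case using frac_laplacian_smallD[of r f g] sine_coef_frac_laplacian_small[OF r] by auto
next
  case (Suc n)
  from Suc.prems obtain h where h: "(frac_laplacian_small r ^^ Suc n) f h" "frac_laplacian_small r h g"
    by (auto elim: relpowp_Suc_E)
  have e: "r * real (Suc (Suc n)) = r + r * real (Suc n)" by (simp add: algebra_simps)
  show ?case
    using Suc.IH[OF h(1)] frac_laplacian_smallD[OF h(2)] sine_coef_frac_laplacian_small[OF r h(2)]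
    unfolding e powr_add by auto
qed

lemma frac_laplacian_iterate_diff:
  assumes r: "0 < r" "r < 2"
  shows "(frac_laplacian_small r ^^ n) f g \<Longrightarrow> (frac_laplacian_small r ^^ n) f' g' \<Longrightarrow>
      (frac_laplacian_small r ^^ n) (\<lambda>x. f x - f' x) (\<lambda>x. g x - g' x)"
proof (induction n arbitrary: g g')
  case (Suc n)
  from Suc.prems obtain h h' where h: "(frac_laplacian_small r ^^ n) f h" "frac_laplacian_small r h g"
     "(frac_laplacian_small r ^^ n) f' h'" "frac_laplacian_small r h' g'"
    by (auto elim!: relpowp_Suc_E)
  show ?case
    unfolding relpowp.simps by (rule relcomppI, rule Suc.IH[OF h(1,3)], rule frac_laplacian_small_diff[OF r h(2,4)])
qed simp

lemma frac_laplacian_order: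
  assumes "s > 0"
  obtains n where "frac_laplacian s = frac_laplacian_small (s / real (Suc n)) ^^ Suc n" "0 < s / real (Suc n)" "s / real (Suc n) < 2"
proof
  let ?n = "nat \<lfloor>s / 2\<rfloor>"
  show "frac_laplacian s = frac_laplacian_small (s / real (Suc ?n)) ^^ Suc ?n"
    by (simp only: frac_laplacian_def Let_def Suc_eq_plus1)
  show "0 < s / real (Suc ?n)" by (intro divide_pos_pos assms) (simp only: of_nat_0_less_iff zero_less_Suc)
  have "s / 2 < real (Suc ?n)" using assms by (simp add: of_nat_nat) linarith
  then show "s / real (Suc ?n) < 2" by (simp add: divide_less_eq)
qed

lemma frac_laplacianD:
  assumes "s > 0" "frac_laplacian s f g"
  shows "integrable interval_pi f" "integrable interval_pi g" "k \<ge> 1 \<Longrightarrow> sine_coef g k = real k powr s * sine_coef f k"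
proof -
  obtain n where n: "frac_laplacian s = frac_laplacian_small (s / real (Suc n)) ^^ Suc n" "0 < s / real (Suc n)" "s / real (Suc n) < 2"
    using frac_laplacian_order[OF assms(1)] .
  have "s / real (Suc n) * real (Suc n) = s" by simp
  with frac_laplacian_iterate[OF n(2,3) assms(2)[unfolded n(1)]]
  show "integrable interval_pi f" "integrable interval_pi g" "k \<ge> 1 \<Longrightarrow> sine_coef g k = real k powr s * sine_coef f k"
    by auto
qed

lemma frac_laplacian_diff:
  assumes "s > 0" "frac_laplacian s f g" "frac_laplacian s f' g'"
  shows "frac_laplacian s (\<lambda>x. f x - f' x) (\<lambda>x. g x - g' x)"
proof -
  obtain n where n: "frac_laplacian s = frac_laplacian_small (s / real (Suc n)) ^^ Suc n" "0 < s / real (Suc n)" "s / real (Suc n) < 2"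
    using frac_laplacian_order[OF assms(1)] .
  show ?thesis unfolding n(1) by (rule frac_laplacian_iterate_diff[OF n(2,3)]) (use assms n(1) in auto)
qed

text \<open>Any choice of the fractional power gives the same norm, since its coefficients, and thereby its class modulo null sets, are determined by \<open>f\<close>.\<close>

lemma Sobolev_norm_eq:
  assumes s: "s > 0" and fg: "frac_laplacian s f g"
  shows "Sobolev_norm p s f = Lp_norm p g"
proof -
  have g': "frac_laplacian s f (SOME g. frac_laplacian s f g)" by (rule someI[of "frac_laplacian s f", OF fg])
  have "AE x in interval_pi. (SOME g. frac_laplacian s f g) x = g x"
    using frac_laplacianD[OF s fg] frac_laplacianD[OF s g'] by (intro sine_coef_eq_imp_AE_eq) auto
  then show ?thesis unfolding Sobolev_norm_def
    using frac_laplacianD[OF s fg] frac_laplacianD[OF s g'] by (intro AE_eq_imp_Lp_norm_eq) auto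
qed

lemma Lp_space_diff:
  assumes p: "p \<ge> 1" and "f \<in> Lp_space p" "g \<in> Lp_space p"
  shows "(\<lambda>x. f x - g x) \<in> Lp_space p"
proof -
  have [measurable]: "f \<in> borel_measurable interval_pi" "g \<in> borel_measurable interval_pi"
    and i: "integrable interval_pi (\<lambda>x. \<bar>f x\<bar> powr p)" "integrable interval_pi (\<lambda>x. \<bar>g x\<bar> powr p)"
    using assms by (auto simp: Lp_space_def)
  have "integrable interval_pi (\<lambda>x. \<bar>f x - g x\<bar> powr p)"
  proof (rule Bochner_Integration.integrable_bound)
    show "integrable interval_pi (\<lambda>x. 2 powr p * (\<bar>f x\<bar> powr p + \<bar>g x\<bar> powr p))" using i by simp
    show "AE x in interval_pi. norm (\<bar>f x - g x\<bar> powr p) \<le> norm (2 powr p * (\<bar>f x\<bar> powr p + \<bar>g x\<bar> powr p))"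
    proof (rule AE_I2)
      fix x
      let ?m = "max \<bar>f x\<bar> \<bar>g x\<bar>"
      have "\<bar>f x - g x\<bar> powr p \<le> (2 * ?m) powr p" using p by (intro powr_mono2) auto
      also have "\<dots> = 2 powr p * ?m powr p" by (simp add: powr_mult)
      also have "\<dots> \<le> 2 powr p * (\<bar>f x\<bar> powr p + \<bar>g x\<bar> powr p)" by (intro mult_left_mono) (auto simp: max_def)
      finally show "norm (\<bar>f x - g x\<bar> powr p) \<le> norm (2 powr p * (\<bar>f x\<bar> powr p + \<bar>g x\<bar> powr p))" by simp
    qed
  qed measurable
  then show ?thesis by (simp add: Lp_space_def)
qed

lemma Sobolev_diff:
  assumes "p \<ge> 1" "s > 0" "f \<in> Sobolev p s" "g \<in> Sobolev p s"
  shows "(\<lambda>x. f x - g x) \<in> Sobolev p s"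
  using assms frac_laplacian_diff Lp_space_diff unfolding Sobolev_def by blast

lemma abs_sine_coef_le_Sobolev_norm:
  assumes p: "p \<ge> 1" and s: "s > 0" and f: "f \<in> Sobolev p s" and k: "k \<ge> 1"
  shows "\<bar>sine_coef f k\<bar> \<le> 4 * Sobolev_norm p s f"
proof -
  obtain g where g: "frac_laplacian s f g" "g \<in> Lp_space p" using f by (auto simp: Sobolev_def)
  have "1 \<le> real k powr s" using k s by (simp add: ge_one_powr_ge_zero)
  then have "1 * \<bar>sine_coef f k\<bar> \<le> real k powr s * \<bar>sine_coef f k\<bar>" by (intro mult_right_mono) auto
  also have "\<dots> = \<bar>sine_coef g k\<bar>" using frac_laplacianD(3)[OF s g(1) k] by (simp add: abs_mult)
  also have "\<dots> \<le> 4 * Lp_norm p g" using sine_coef_le[OF Lp_imp_integrable[OF g(2) p]] L1_norm_le_Lp_norm[OF g(2) p] by (rule order_trans)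
  finally show ?thesis using Sobolev_norm_eq[OF s g(1)] by simp
qed

lemma Sobolev_imp_integrable: "s > 0 \<Longrightarrow> f \<in> Sobolev p s \<Longrightarrow> integrable interval_pi f"
  using frac_laplacianD(1) by (auto simp: Sobolev_def)

lemma sine_coef_0 [simp]: "sine_coef f 0 = 0"
  by (simp add: sine_coef_def eigenfun_def)

section \<open>The convolution as a heat potential\<close>

text \<open>A coefficient is continuous for the Sobolev seminorm, hence an almost everywhere limit of the coefficients of the approximating simple functions.\<close>

lemma strongly_measurable_sine_coef:
  assumes p: "p \<ge> 1" and s: "s > 0" and f: "strongly_measurable T (Sobolev p s) (Sobolev_norm p s) f"
  shows "(\<lambda>t. sine_coef (f t) k) \<in> borel_measurable (lebesgue_on {0<..<T})"
proof (cases "k \<ge> 1")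
  case k: True
  let ?J = "lebesgue_on {0<..<T}"
  obtain \<phi> :: "nat \<Rightarrow> real \<Rightarrow> real \<Rightarrow> real" where sf: "\<And>n. simple_function ?J (\<phi> n)" "\<And>n. \<phi> n ` {0<..<T} \<subseteq> Sobolev p s"
    and lim: "AE t in ?J. (\<lambda>n. Sobolev_norm p s (\<lambda>x. f t x - \<phi> n t x)) \<longlonglongrightarrow> 0"
    using f unfolding strongly_measurable_def by blast
  have fS: "AE t in ?J. f t \<in> Sobolev p s" using f by (simp add: strongly_measurable_def)
  have m: "(\<lambda>t. sine_coef (\<phi> n t) k) \<in> borel_measurable ?J" for n
    using simple_function_compose1[OF sf(1)[of n], of "\<lambda>h. sine_coef h k"] by (rule borel_measurable_simple_function)
  have "AE t in ?J. sine_coef (f t) k = lim (\<lambda>n. sine_coef (\<phi> n t) k)"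
    using lim fS AE_space
  proof eventually_elim
    case (elim t)
    have \<phi>S: "\<phi> n t \<in> Sobolev p s" for n using sf(2)[of n] elim(3) by auto
    have "(\<lambda>n. sine_coef (f t) k - sine_coef (\<phi> n t) k) \<longlonglongrightarrow> 0"
    proof (rule Lim_null_comparison)
      show "(\<lambda>n. 4 * Sobolev_norm p s (\<lambda>x. f t x - \<phi> n t x)) \<longlonglongrightarrow> 0"
        using tendsto_mult_right_zero[OF elim(1)] .
      show "\<forall>\<^sub>F n in sequentially. norm (sine_coef (f t) k - sine_coef (\<phi> n t) k) \<le> 4 * Sobolev_norm p s (\<lambda>x. f t x - \<phi> n t x)"
        using abs_sine_coef_le_Sobolev_norm[OF p s Sobolev_diff[OF p s elim(2) \<phi>S] k]
          sine_coef_diff[OF Sobolev_imp_integrable[OF s elim(2)] Sobolev_imp_integrable[OF s \<phi>S]] by simp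
    qed
    then have "(\<lambda>n. sine_coef (\<phi> n t) k) \<longlonglongrightarrow> sine_coef (f t) k"
      using tendsto_diff[OF tendsto_const[of "sine_coef (f t) k"]] by fastforce
    then show ?case by (simp add: limI)
  qed
  then show ?thesis
    by (rule integral_cong_AE_lebesgue_on(1)) (use m in \<open>auto intro: borel_measurable_lim_metric\<close>)
next
  case False
  then have "k = 0" by simp
  then show ?thesis by simp
qed

text \<open>The sine coefficients of \<open>(-\<Delta>)\<^bsup>\<gamma>/2\<^esup> (f s)\<close>.\<close>

definition source_coef :: "real \<Rightarrow> (real \<Rightarrow> real \<Rightarrow> real) \<Rightarrow> real \<Rightarrow> nat \<Rightarrow> real"
  where "source_coef \<gamma> f s k = real k powr \<gamma> * sine_coef (f s) k"

lemma source_coefI: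
  assumes g: "\<gamma> > 0"
    and m: "\<And>k. (\<lambda>t. sine_coef (f t) k) \<in> borel_measurable (lebesgue_on {0<..<T})"
    and b: "AE t in lebesgue_on {0<..<T}. f t \<in> Sobolev p \<gamma> \<and> Sobolev_norm p \<gamma> (f t) \<le> M"
  shows "source T p M (source_coef \<gamma> f)"
  unfolding source_def
proof (intro conjI allI)
  show "(\<lambda>s. source_coef \<gamma> f s k) \<in> borel_measurable (lebesgue_on {0<..<T})" for k
    unfolding source_coef_def using m[of k] by measurable
  show "AE s in lebesgue_on {0<..<T}. \<exists>h\<in>Lp_space p. Lp_norm p h \<le> M \<and> (\<forall>k\<ge>1. source_coef \<gamma> f s k = sine_coef h k)"
    using b
  proof eventually_elim
    case (elim t)
    then obtain h where h: "frac_laplacian \<gamma> (f t) h" "h \<in> Lp_space p" by (auto simp: Sobolev_def)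
    then show ?case using elim Sobolev_norm_eq[OF g h(1)] frac_laplacianD(3)[OF g h(1)]
      by (intro bexI[of _ h]) (auto simp: source_coef_def)
  qed
qed

lemma heat_conv_eq_heat_potential:
  assumes g: "\<gamma> > 0" and t: "0 \<le> t" "t \<le> T"
    and m: "\<And>k. (\<lambda>t. sine_coef (f t) k) \<in> borel_measurable (lebesgue_on {0<..<T})"
    and fS: "AE t in lebesgue_on {0<..<T}. f t \<in> Sobolev p \<gamma>"
  shows "heat_conv f t = heat_potential (- \<gamma>) (source_coef \<gamma> f) t"
proof
  fix x
  have sub: "{0<..<t} \<subseteq> {0<..<T}" using t by auto
  have [measurable]: "(\<lambda>s. sine_coef (f s) k) \<in> borel_measurable (lebesgue_on {0<..<t})" for k
    using m by (rule measurable_restrict_mono) (use sub in auto)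
  have ae: "AE s in lebesgue_on {0<..<t}. f s \<in> Sobolev p \<gamma>"
    by (rule AE_lebesgue_on_subset[OF fS sub]) auto
  have "AE s in lebesgue_on {0<..<t}. (LINT y|interval_pi. heat_kernel (t - s) x y * f s y)
     = sine_series (\<lambda>k. real k powr (- \<gamma>) * heat_symbol (t - s) k * source_coef \<gamma> f s k) x"
    using ae AE_space
  proof eventually_elim
    case (elim s)
    then have ts: "t - s > 0" by simp
    have "(LINT y|interval_pi. heat_kernel (t - s) x y * f s y) = sine_series (\<lambda>k. heat_symbol (t - s) k * sine_coef (f s) k) x"
      using heat_semigroup_eq[OF ts Sobolev_imp_integrable[OF g elim(1)]] by (simp add: heat_semigroup_def)
    also have "\<dots> = sine_series (\<lambda>k. real k powr (- \<gamma>) * heat_symbol (t - s) k * source_coef \<gamma> f s k) x"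
    proof (rule sine_series_cong)
      fix k :: nat assume "k \<ge> 1"
      then have "real k powr (- \<gamma>) * real k powr \<gamma> = 1" by (simp flip: powr_add)
      then show "heat_symbol (t - s) k * sine_coef (f s) k = real k powr (- \<gamma>) * heat_symbol (t - s) k * source_coef \<gamma> f s k"
        by (simp add: source_coef_def mult_ac mult.left_commute[of "real k powr (- \<gamma>)"])
    qed
    finally show ?case .
  qed
  then show "heat_conv f t x = heat_potential (- \<gamma>) (source_coef \<gamma> f) t x"
    unfolding heat_conv_def heat_potential_def series_integral_def
  proof (rule integral_cong_AE_lebesgue_on(2))
    show "(\<lambda>s. sine_series (\<lambda>k. real k powr (- \<gamma>) * heat_symbol (t - s) k * source_coef \<gamma> f s k) x) \<in> borel_measurable (lebesgue_on {0<..<t})"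
      unfolding source_coef_def by (intro sine_series_measurable borel_measurable_times) measurable
  qed simp
qed

section \<open>The estimate for the convolution\<close>

lemma Sobolev_norm_nonneg: "Sobolev_norm p s f \<ge> 0"
  by (simp add: Sobolev_norm_def Lp_norm_nonneg)

text \<open>The hypothesis on \<open>H\<close> covers the convolution of one function as well as the difference of two
  convolutions, whose fractional power is a potential only up to null sets.\<close>

lemma Linf_norm_le_heat_potential:
  assumes \<beta>\<gamma>: "0 < \<beta>" "\<beta> < \<gamma>" "\<gamma> < 1" and p: "p \<ge> 1" and M: "M \<ge> 0" and src: "source T p M c" and T: "T > 0"
    and H: "\<And>t. t \<in> {0<..<T} \<Longrightarrow> \<exists>V. frac_laplacian (2 + \<beta>) (H t) V \<and> (AE x in interval_pi. V x = heat_potential (2 + \<beta> - \<gamma>) c t x)"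
  shows "Linf_norm T (Sobolev_norm p (2 + \<beta>)) H \<le> ereal (224 / (\<gamma> - \<beta>) * T powr ((\<gamma> - \<beta>) / 2) * M)"
proof -
  let ?q = "2 + \<beta> - \<gamma>" and ?J = "lebesgue_on {0<..<T}"
  have q: "1 \<le> ?q" "?q < 2" using \<beta>\<gamma> by auto
  have b0: "2 + \<beta> > 0" using \<beta>\<gamma> by simp
  have P: "heat_potential ?q c t \<in> Lp_space p" "Lp_norm p (heat_potential ?q c t) \<le> 112 * t powr (1 - ?q / 2) / (1 - ?q / 2) * M"
    if "t \<in> {0<..<T}" for t
    using heat_potential_props[OF p M source_subinterval[OF src, of t] _ q] that by auto
  have eq: "Sobolev_norm p (2 + \<beta>) (H t) = Lp_norm p (heat_potential ?q c t)" if t: "t \<in> {0<..<T}" for t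
  proof -
    obtain V where V: "frac_laplacian (2 + \<beta>) (H t) V" "AE x in interval_pi. V x = heat_potential ?q c t x"
      using H[OF t] by auto
    have "Lp_norm p V = Lp_norm p (heat_potential ?q c t)"
      using frac_laplacianD(2)[OF b0 V(1)] P(1)[OF t] by (intro AE_eq_imp_Lp_norm_eq[OF V(2)]) (auto simp: Lp_space_def)
    then show ?thesis using Sobolev_norm_eq[OF b0 V(1)] by simp
  qed
  have "(\<lambda>t. ereal (Lp_norm p (heat_potential ?q c t))) \<in> borel_measurable ?J"
    using Lp_norm_heat_potential_measurable[OF src] by (intro borel_measurable_ereal)
  then have m: "(\<lambda>t. ereal (Sobolev_norm p (2 + \<beta>) (H t))) \<in> borel_measurable ?J"
    by (rule measurable_cong[THEN iffD2, rotated]) (use eq in simp)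
  have e: "1 - ?q / 2 = (\<gamma> - \<beta>) / 2" by (simp add: field_simps)
  have "Sobolev_norm p (2 + \<beta>) (H t) \<le> 224 / (\<gamma> - \<beta>) * T powr ((\<gamma> - \<beta>) / 2) * M" if t: "t \<in> {0<..<T}" for t
  proof -
    have "Sobolev_norm p (2 + \<beta>) (H t) \<le> 112 * t powr ((\<gamma> - \<beta>) / 2) / ((\<gamma> - \<beta>) / 2) * M"
      using eq[OF t] P(2)[OF t] unfolding e by simp
    also have "\<dots> \<le> 112 * T powr ((\<gamma> - \<beta>) / 2) / ((\<gamma> - \<beta>) / 2) * M"
      using t \<beta>\<gamma> M by (intro mult_right_mono divide_right_mono mult_left_mono powr_mono2) auto
    finally show ?thesis by simp
  qed
  then show ?thesis unfolding Linf_norm_def by (intro esssup_I[OF m] AE_I2) simp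
qed

text \<open>The solution is continuous in time with values in the Sobolev space, hence the limit of the step
  functions that sample it on finer and finer grids. The left grid point of \<open>t\<close> may be \<open>0\<close>, where the
  potential vanishes.\<close>

lemma strongly_measurable_heat_potential:
  assumes \<beta>\<gamma>: "0 < \<beta>" "\<beta> < \<gamma>" "\<gamma> < 1" and p: "p \<ge> 1" and M: "M \<ge> 0" and src: "source T p M c" and T: "T > 0"
    and H: "\<And>t. t \<in> {0..<T} \<Longrightarrow> H t = heat_potential (- \<gamma>) c t"
  shows "strongly_measurable T (Sobolev p (2 + \<beta>)) (Sobolev_norm p (2 + \<beta>)) H"
proof -
  let ?q = "2 + \<beta> - \<gamma>" and ?J = "lebesgue_on {0<..<T}"
  have q: "1 \<le> ?q" "?q < 2" using \<beta>\<gamma> by auto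
  have b0: "2 + \<beta> > 0" using \<beta>\<gamma> by simp
  \<comment> \<open>Any small positive exponent with \<open>2 + \<beta> - \<gamma> + 2 * \<eta> < 2\<close> serves.\<close>
  define \<eta> where "\<eta> = (\<gamma> - \<beta>) / 4"
  have \<eta>: "0 < \<eta>" "\<eta> \<le> 1" "?q + 2 * \<eta> < 2" using \<beta>\<gamma> by (auto simp: \<eta>_def field_simps)
  have srct: "source t p M c" if "t \<in> {0..<T}" for t using that by (intro source_subinterval[OF src]) auto
  have fl: "frac_laplacian (2 + \<beta>) (H t) (heat_potential ?q c t)" if "t \<in> {0..<T}" for t
    using heat_potential_frac_laplacian[OF \<beta>\<gamma> p M srct[OF that]] that by (simp add: H)
  have HS: "H t \<in> Sobolev p (2 + \<beta>)" if "t \<in> {0..<T}" for t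
    unfolding Sobolev_def using fl[OF that] heat_potential_props(1)[OF p M srct[OF that] _ q] that by auto
  define \<tau> where "\<tau> n t = real_of_int \<lfloor>t * real (Suc n)\<rfloor> / real (Suc n)" for n and t :: real
  have \<tau>: "0 \<le> \<tau> n t" "\<tau> n t \<le> t" "t - \<tau> n t \<le> 1 / real (Suc n)" if "t \<ge> 0" for n t
  proof -
    have "real_of_int \<lfloor>t * real (Suc n)\<rfloor> \<le> t * real (Suc n)" "t * real (Suc n) < real_of_int \<lfloor>t * real (Suc n)\<rfloor> + 1" by linarith+
    then have fl: "0 \<le> t * real (Suc n) - real_of_int \<lfloor>t * real (Suc n)\<rfloor>" "t * real (Suc n) - real_of_int \<lfloor>t * real (Suc n)\<rfloor> \<le> 1"
      by linarith+
    have e: "t - \<tau> n t = (t * real (Suc n) - real_of_int \<lfloor>t * real (Suc n)\<rfloor>) / real (Suc n)"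
      by (simp add: \<tau>_def diff_divide_distrib del: of_nat_Suc)
    show "t - \<tau> n t \<le> 1 / real (Suc n)" unfolding e using fl(2) by (rule divide_right_mono) simp
    have "t - \<tau> n t \<ge> 0" unfolding e using fl(1) by (rule divide_nonneg_nonneg) simp
    then show "\<tau> n t \<le> t" by simp
    show "0 \<le> \<tau> n t" using that by (simp add: \<tau>_def)
  qed
  have sf: "simple_function ?J (\<tau> n)" for n
  proof (rule simple_function_borel_measurable)
    have "\<tau> n \<in> borel_measurable borel" unfolding \<tau>_def by measurable
    then show "\<tau> n \<in> borel_measurable ?J" by (rule borel_measurable_interval_piI)
    have "\<tau> n ` {0<..<T} \<subseteq> (\<lambda>i. real_of_int i / real (Suc n)) ` {0..\<lfloor>T * real (Suc n)\<rfloor>}"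
    proof
      fix y assume "y \<in> \<tau> n ` {0<..<T}"
      then obtain t where t: "0 < t" "t < T" "y = \<tau> n t" by auto
      have "\<lfloor>t * real (Suc n)\<rfloor> \<le> \<lfloor>T * real (Suc n)\<rfloor>" using t by (intro floor_mono mult_right_mono) auto
      moreover have "0 \<le> \<lfloor>t * real (Suc n)\<rfloor>" using t by simp
      ultimately show "y \<in> (\<lambda>i. real_of_int i / real (Suc n)) ` {0..\<lfloor>T * real (Suc n)\<rfloor>}"
        using t(3) by (auto simp: \<tau>_def)
    qed
    from finite_subset[OF this] show "finite (\<tau> n ` space ?J)" by simp
  qed
  define \<phi> where "\<phi> n t = H (\<tau> n t)" for n t
  have lim: "(\<lambda>n. Sobolev_norm p (2 + \<beta>) (\<lambda>x. H t x - \<phi> n t x)) \<longlonglongrightarrow> 0" if t: "t \<in> {0<..<T}" for t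
  proof -
    \<comment> \<open>The bound of the time difference is made explicit, with the part depending on the grid point replaced by its value at \<open>t\<close>.\<close>
    define K1 where "K1 = max 0 (t powr (1 - (?q + 2 * \<eta>) / 2) / (1 - (?q + 2 * \<eta>) / 2))"
    define K2 where "K2 = 1 / (1 - ?q / 2)"
    have K2: "K2 > 0" using q by (simp add: K2_def)
    define b where "b n = 112 * ((1 / real (Suc n)) powr \<eta> * K1 + (1 / real (Suc n)) powr (1 - ?q / 2) * K2) * M" for n
    have b0': "b n \<ge> 0" for n unfolding b_def K1_def using K2 M by (intro mult_nonneg_nonneg add_nonneg_nonneg) auto
    have bound: "Sobolev_norm p (2 + \<beta>) (\<lambda>x. H t x - \<phi> n t x) \<le> b n" for n
    proof -
      have t0: "t \<ge> 0" "t \<in> {0..<T}" "\<tau> n t \<in> {0..<T}" using t \<tau>[of t n] by auto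
      have "frac_laplacian (2 + \<beta>) (\<lambda>x. H t x - \<phi> n t x) (\<lambda>x. heat_potential ?q c t x - heat_potential ?q c (\<tau> n t) x)"
        unfolding \<phi>_def by (rule frac_laplacian_diff[OF b0 fl[OF t0(2)] fl[OF t0(3)]])
      from Sobolev_norm_eq[OF b0 this]
      have N: "Sobolev_norm p (2 + \<beta>) (\<lambda>x. H t x - \<phi> n t x) = Lp_norm p (\<lambda>x. heat_potential ?q c t x - heat_potential ?q c (\<tau> n t) x)" .
      show ?thesis
      proof (cases "\<tau> n t = t")
        case True
        then show ?thesis using N b0'[of n] p by (simp add: Lp_norm_def)
      next
        case False
        then have lt: "\<tau> n t < t" using \<tau>(2)[OF t0(1), of n] by simp
        let ?r = "t - \<tau> n t"
        have r: "0 \<le> ?r" "?r \<le> 1 / real (Suc n)" using lt \<tau>(3)[OF t0(1)] by auto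
        have "\<tau> n t powr (1 - (?q + 2 * \<eta>) / 2) / (1 - (?q + 2 * \<eta>) / 2) \<le> t powr (1 - (?q + 2 * \<eta>) / 2) / (1 - (?q + 2 * \<eta>) / 2)"
          using \<tau>[OF t0(1), of n] \<eta> by (intro divide_right_mono powr_mono2) auto
        also have "\<dots> \<le> K1" by (simp add: K1_def)
        finally have k1: "\<tau> n t powr (1 - (?q + 2 * \<eta>) / 2) / (1 - (?q + 2 * \<eta>) / 2) \<le> K1" .
        have "Sobolev_norm p (2 + \<beta>) (\<lambda>x. H t x - \<phi> n t x) \<le>
          112 * (?r powr \<eta> * \<tau> n t powr (1 - (?q + 2 * \<eta>) / 2) / (1 - (?q + 2 * \<eta>) / 2) + ?r powr (1 - ?q / 2) / (1 - ?q / 2)) * M"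
          unfolding N by (rule heat_potential_time_diff[OF p M srct[OF t0(2)] _ lt q(1) \<eta>]) (use t0 in simp)
        also have "\<dots> = 112 * (?r powr \<eta> * (\<tau> n t powr (1 - (?q + 2 * \<eta>) / 2) / (1 - (?q + 2 * \<eta>) / 2)) + ?r powr (1 - ?q / 2) * K2) * M"
          by (simp add: K2_def)
        also have "\<dots> \<le> b n"
          unfolding b_def using r \<eta> q M K2 k1
          by (intro mult_right_mono mult_left_mono add_mono mult_mono powr_mono2) auto
        finally show ?thesis .
      qed
    qed
    have inv: "(\<lambda>n. 1 / real (Suc n)) \<longlonglongrightarrow> 0" by (rule LIMSEQ_Suc[OF lim_1_over_n])
    have "b \<longlonglongrightarrow> 112 * (0 powr \<eta> * K1 + 0 powr (1 - ?q / 2) * K2) * M"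
      unfolding b_def using \<eta> q by (intro tendsto_intros tendsto_powr2 inv) auto
    then have "b \<longlonglongrightarrow> 0" by simp
    then show ?thesis
      by (rule tendsto_sandwich[OF _ _ tendsto_const, rotated -1]) (auto simp: bound Sobolev_norm_nonneg)
  qed
  show ?thesis unfolding strongly_measurable_def
  proof (intro conjI exI[of _ \<phi>] allI)
    show "AE t in ?J. H t \<in> Sobolev p (2 + \<beta>)" by (intro AE_I2 HS) auto
    show "simple_function ?J (\<phi> n)" for n
      unfolding \<phi>_def by (rule simple_function_compose1[OF sf])
    show "\<phi> n ` {0<..<T} \<subseteq> Sobolev p (2 + \<beta>)" for n
    proof
      fix h assume "h \<in> \<phi> n ` {0<..<T}"
      then obtain t where t: "0 < t" "t < T" "h = H (\<tau> n t)" by (auto simp: \<phi>_def)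
      then have "\<tau> n t \<in> {0..<T}" using \<tau>(1,2)[of t n] by auto
      then show "h \<in> Sobolev p (2 + \<beta>)" unfolding t(3) by (rule HS)
    qed
    show "AE t in ?J. (\<lambda>n. Sobolev_norm p (2 + \<beta>) (\<lambda>x. H t x - \<phi> n t x)) \<longlonglongrightarrow> 0"
      by (intro AE_I2 lim) simp
  qed
qed

text \<open>The interval has positive measure, so that a property holding almost everywhere holds somewhere.\<close>

lemma Linf_norm_nonneg_AE:
  assumes "T > 0" and "\<And>t. N (f t) \<ge> 0"
  shows "Linf_norm T N f \<ge> 0" "AE t in lebesgue_on {0<..<T}. ereal (N (f t)) \<le> Linf_norm T N f"
proof -
  show ae: "AE t in lebesgue_on {0<..<T}. ereal (N (f t)) \<le> Linf_norm T N f"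
    unfolding Linf_norm_def by (rule esssup_AE)
  show "Linf_norm T N f \<ge> 0"
  proof (rule ccontr)
    assume "\<not> Linf_norm T N f \<ge> 0"
    then have "\<not> ereal (N (f t)) \<le> Linf_norm T N f" for t
      using assms(2)[of t] by (metis ereal_less_eq(5) order_trans)
    then have "AE t in lebesgue_on {0<..<T}. False" using ae by simp
    then have "emeasure (lebesgue_on {0<..<T}) (space (lebesgue_on {0<..<T})) = 0"
      by (simp only: ae_filter_eq_bot_iff[symmetric] trivial_limit_def)
    then show False using assms(1) by (simp add: emeasure_restrict_space)
  qed
qed

theorem theorem2p2:
  fixes \<beta> \<gamma> :: real
  assumes "0 < \<beta>" and "\<beta> < \<gamma>" and "\<gamma> < 1"
  shows "\<exists>C>0. \<forall>T>0. \<forall>p\<ge>1.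
    (\<forall>f\<in>Linf_Sobolev T p \<gamma>. heat_conv f \<in> Linf_Sobolev T p (2 + \<beta>)) \<and>
    (\<forall>f\<in>Linf_Sobolev T p \<gamma>. \<forall>\<epsilon>>0. \<exists>\<delta>>0. \<forall>g\<in>Linf_Sobolev T p \<gamma>.
       Linf_Sobolev_norm T p \<gamma> (\<lambda>t x. g t x - f t x) < ereal \<delta> \<longrightarrow>
       Linf_Sobolev_norm T p (2 + \<beta>) (\<lambda>t x. heat_conv g t x - heat_conv f t x) < ereal \<epsilon>) \<and>
    (\<forall>f\<in>Linf_Sobolev T p \<gamma>.
       Linf_Sobolev_norm T p (2 + \<beta>) (heat_conv f)
         \<le> ereal (C * T powr ((\<gamma> - \<beta>) / 2)) * Linf_Sobolev_norm T p \<gamma> f)"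
proof -
  note \<beta>\<gamma> = assms
  have \<gamma>0: "\<gamma> > 0" and b0: "2 + \<beta> > 0" using \<beta>\<gamma> by auto
  define C where "C = 224 / (\<gamma> - \<beta>)"
  have C: "C > 0" using \<beta>\<gamma> by (simp add: C_def)
  show ?thesis
  proof (intro exI[of _ C] conjI C allI impI)
    fix T p :: real assume T: "T > 0" and p: "p \<ge> 1"
    define K where "K = C * T powr ((\<gamma> - \<beta>) / 2)"
    have K: "K > 0" using C T by (simp add: K_def)
    let ?L = "Linf_Sobolev_norm T p \<gamma>"
    have m: "(\<lambda>t. sine_coef (f t) k) \<in> borel_measurable (lebesgue_on {0<..<T})" if "f \<in> Linf_Sobolev T p \<gamma>" for f k
      using that by (intro strongly_measurable_sine_coef[OF p \<gamma>0]) (simp add: Linf_def)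
    have S: "AE t in lebesgue_on {0<..<T}. f t \<in> Sobolev p \<gamma>" if "f \<in> Linf_Sobolev T p \<gamma>" for f
      using that by (simp add: Linf_def strongly_measurable_def)
    have src: "\<exists>M\<ge>0. ?L f = ereal M \<and> source T p M (source_coef \<gamma> f)" if f: "f \<in> Linf_Sobolev T p \<gamma>" for f
    proof -
      note L = Linf_norm_nonneg_AE[OF T, of "Sobolev_norm p \<gamma>" f, OF Sobolev_norm_nonneg]
      have "?L f < \<infinity>" using f by (simp add: Linf_def)
      then obtain M where M: "?L f = ereal M" "M \<ge> 0" using L(1) by (cases "?L f") auto
      have "AE t in lebesgue_on {0<..<T}. f t \<in> Sobolev p \<gamma> \<and> Sobolev_norm p \<gamma> (f t) \<le> M"
        using S[OF f] L(2) unfolding M(1) by eventually_elim simp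
      from source_coefI[OF \<gamma>0 m[OF f] this] show ?thesis using M by auto
    qed
    have hc: "heat_conv f t = heat_potential (- \<gamma>) (source_coef \<gamma> f) t" if "f \<in> Linf_Sobolev T p \<gamma>" "t \<in> {0..<T}" for f t
      using that by (intro heat_conv_eq_heat_potential[OF \<gamma>0 _ _ m[OF that(1)] S[OF that(1)]]) auto
    have fl: "frac_laplacian (2 + \<beta>) (heat_conv f t) (heat_potential (2 + \<beta> - \<gamma>) (source_coef \<gamma> f) t)"
      if f: "f \<in> Linf_Sobolev T p \<gamma>" and t: "t \<in> {0..<T}" for f t
    proof -
      obtain M where M: "M \<ge> 0" "source T p M (source_coef \<gamma> f)" using src[OF f] by auto
      show ?thesis unfolding hc[OF f t]
        using t by (intro heat_potential_frac_laplacian[OF \<beta>\<gamma> p M(1) source_subinterval[OF M(2)]]) auto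
    qed
    have bound: "Linf_Sobolev_norm T p (2 + \<beta>) (heat_conv f) \<le> ereal K * ?L f" if f: "f \<in> Linf_Sobolev T p \<gamma>" for f
    proof -
      obtain M where M: "M \<ge> 0" "?L f = ereal M" "source T p M (source_coef \<gamma> f)" using src[OF f] by auto
      have "Linf_Sobolev_norm T p (2 + \<beta>) (heat_conv f) \<le> ereal (224 / (\<gamma> - \<beta>) * T powr ((\<gamma> - \<beta>) / 2) * M)"
      proof (rule Linf_norm_le_heat_potential[OF \<beta>\<gamma> p M(1,3) T])
        fix t assume "t \<in> {0<..<T}"
        then have "frac_laplacian (2 + \<beta>) (heat_conv f t) (heat_potential (2 + \<beta> - \<gamma>) (source_coef \<gamma> f) t)"
          by (intro fl[OF f]) auto
        then show "\<exists>V. frac_laplacian (2 + \<beta>) (heat_conv f t) V \<and> (AE x in interval_pi. V x = heat_potential (2 + \<beta> - \<gamma>) (source_coef \<gamma> f) t x)"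
          by (intro exI[of _ "heat_potential (2 + \<beta> - \<gamma>) (source_coef \<gamma> f) t"]) auto
      qed
      then show ?thesis unfolding M(2) by (simp add: K_def C_def)
    qed
    show "\<forall>f\<in>Linf_Sobolev T p \<gamma>. Linf_Sobolev_norm T p (2 + \<beta>) (heat_conv f) \<le> ereal (C * T powr ((\<gamma> - \<beta>) / 2)) * ?L f"
      using bound by (simp add: K_def)
    show "\<forall>f\<in>Linf_Sobolev T p \<gamma>. heat_conv f \<in> Linf_Sobolev T p (2 + \<beta>)"
    proof
      fix f assume f: "f \<in> Linf_Sobolev T p \<gamma>"
      then obtain M where M: "M \<ge> 0" "?L f = ereal M" "source T p M (source_coef \<gamma> f)" using src by blast
      have "strongly_measurable T (Sobolev p (2 + \<beta>)) (Sobolev_norm p (2 + \<beta>)) (heat_conv f)"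
        by (rule strongly_measurable_heat_potential[OF \<beta>\<gamma> p M(1,3) T hc[OF f]])
      moreover have "Linf_Sobolev_norm T p (2 + \<beta>) (heat_conv f) < \<infinity>"
        using bound[OF f] unfolding M(2) by (auto intro: le_less_trans)
      ultimately show "heat_conv f \<in> Linf_Sobolev T p (2 + \<beta>)" by (simp add: Linf_def)
    qed
    show "\<forall>f\<in>Linf_Sobolev T p \<gamma>. \<forall>\<epsilon>>0. \<exists>\<delta>>0. \<forall>g\<in>Linf_Sobolev T p \<gamma>.
       ?L (\<lambda>t x. g t x - f t x) < ereal \<delta> \<longrightarrow>
       Linf_Sobolev_norm T p (2 + \<beta>) (\<lambda>t x. heat_conv g t x - heat_conv f t x) < ereal \<epsilon>"
    proof (intro ballI allI impI)
      fix f and \<epsilon> :: real assume f: "f \<in> Linf_Sobolev T p \<gamma>" and \<epsilon>: "\<epsilon> > 0"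
      define \<delta> where "\<delta> = \<epsilon> / (2 * K)"
      have \<delta>: "\<delta> > 0" using \<epsilon> K by (simp add: \<delta>_def)
      show "\<exists>\<delta>>0. \<forall>g\<in>Linf_Sobolev T p \<gamma>. ?L (\<lambda>t x. g t x - f t x) < ereal \<delta> \<longrightarrow>
         Linf_Sobolev_norm T p (2 + \<beta>) (\<lambda>t x. heat_conv g t x - heat_conv f t x) < ereal \<epsilon>"
      proof (intro exI[of _ \<delta>] conjI \<delta> ballI impI)
        fix g assume g: "g \<in> Linf_Sobolev T p \<gamma>" and less: "?L (\<lambda>t x. g t x - f t x) < ereal \<delta>"
        let ?h = "\<lambda>t x. g t x - f t x"
        have ce: "AE t in lebesgue_on {0<..<T}. \<forall>k. sine_coef (?h t) k = sine_coef (g t) k - sine_coef (f t) k"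
          using S[OF f] S[OF g] by eventually_elim (simp add: sine_coef_diff Sobolev_imp_integrable[OF \<gamma>0])
        have hm: "(\<lambda>t. sine_coef (?h t) k) \<in> borel_measurable (lebesgue_on {0<..<T})" for k
        proof (rule integral_cong_AE_lebesgue_on(1))
          show "AE t in lebesgue_on {0<..<T}. sine_coef (?h t) k = sine_coef (g t) k - sine_coef (f t) k"
            using ce by eventually_elim simp
          show "(\<lambda>t. sine_coef (g t) k - sine_coef (f t) k) \<in> borel_measurable (lebesgue_on {0<..<T})"
            using m[OF f, of k] m[OF g, of k] by measurable
        qed simp
        have "AE t in lebesgue_on {0<..<T}. ?h t \<in> Sobolev p \<gamma> \<and> Sobolev_norm p \<gamma> (?h t) \<le> \<delta>"
          using S[OF f] S[OF g] Linf_norm_nonneg_AE(2)[OF T, of "Sobolev_norm p \<gamma>" ?h, OF Sobolev_norm_nonneg]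
        proof eventually_elim
          case (elim t)
          have "ereal (Sobolev_norm p \<gamma> (?h t)) \<le> ereal \<delta>" by (rule less_imp_le[OF le_less_trans[OF elim(3) less]])
          then show ?case using Sobolev_diff[OF p \<gamma>0 elim(2,1)] by simp
        qed
        from source_coefI[OF \<gamma>0 hm this] have sh: "source T p \<delta> (source_coef \<gamma> ?h)" .
        obtain Mf where Mf: "Mf \<ge> 0" "source T p Mf (source_coef \<gamma> f)" using src[OF f] by auto
        obtain Mg where Mg: "Mg \<ge> 0" "source T p Mg (source_coef \<gamma> g)" using src[OF g] by auto
        have q: "1 \<le> 2 + \<beta> - \<gamma>" "2 + \<beta> - \<gamma> < 2" using \<beta>\<gamma> by auto
        have "Linf_Sobolev_norm T p (2 + \<beta>) (\<lambda>t x. heat_conv g t x - heat_conv f t x) \<le> ereal (224 / (\<gamma> - \<beta>) * T powr ((\<gamma> - \<beta>) / 2) * \<delta>)"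
        proof (rule Linf_norm_le_heat_potential[OF \<beta>\<gamma> p less_imp_le[OF \<delta>] sh T])
          fix t assume t: "t \<in> {0<..<T}"
          then have t': "t \<in> {0..<T}" "0 \<le> t" "t \<le> T" by auto
          let ?V = "\<lambda>f. heat_potential (2 + \<beta> - \<gamma>) (source_coef \<gamma> f) t"
          note Pf = heat_potential_props[OF p Mf(1) source_subinterval[OF Mf(2) t'(2,3)] t'(2) q]
          note Pg = heat_potential_props[OF p Mg(1) source_subinterval[OF Mg(2) t'(2,3)] t'(2) q]
          note Ph = heat_potential_props[OF p less_imp_le[OF \<delta>] source_subinterval[OF sh t'(2,3)] t'(2) q]
          have i: "integrable interval_pi (?V f)" "integrable interval_pi (?V g)" "integrable interval_pi (?V ?h)"
            using Lp_imp_integrable[OF Pf(1) p] Lp_imp_integrable[OF Pg(1) p] Lp_imp_integrable[OF Ph(1) p] by auto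
          have "AE x in interval_pi. ?V g x - ?V f x = ?V ?h x"
          proof (rule sine_coef_eq_imp_AE_eq)
            fix k :: nat assume k: "k \<ge> 1"
            let ?w = "\<lambda>s. real k powr (2 + \<beta> - \<gamma>) * heat_symbol (t - s) k"
            have "sine_coef (\<lambda>x. ?V g x - ?V f x) k = (LINT s|lebesgue_on {0<..<t}. ?w s * source_coef \<gamma> g s k - ?w s * source_coef \<gamma> f s k)"
              using sine_coef_diff[OF i(2,1), of k] Pf(3)[OF k] Pg(3)[OF k] Bochner_Integration.integral_diff[OF Pg(4)[OF k] Pf(4)[OF k]] by simp
            also have "\<dots> = (LINT s|lebesgue_on {0<..<t}. ?w s * source_coef \<gamma> ?h s k)"
            proof (rule integral_cong_AE_lebesgue_on(2))
              have "AE s in lebesgue_on {0<..<t}. \<forall>k. sine_coef (?h s) k = sine_coef (g s) k - sine_coef (f s) k"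
                by (rule AE_lebesgue_on_subset[OF ce]) (use t in auto)
              then show "AE s in lebesgue_on {0<..<t}. ?w s * source_coef \<gamma> g s k - ?w s * source_coef \<gamma> f s k = ?w s * source_coef \<gamma> ?h s k"
                by eventually_elim (simp add: source_coef_def right_diff_distrib)
              show "(\<lambda>s. ?w s * source_coef \<gamma> ?h s k) \<in> borel_measurable (lebesgue_on {0<..<t})"
                using Ph(4)[OF k] by (rule borel_measurable_integrable)
            qed simp
            also have "\<dots> = sine_coef (?V ?h) k" by (rule Ph(3)[OF k, symmetric])
            finally show "sine_coef (\<lambda>x. ?V g x - ?V f x) k = sine_coef (?V ?h) k" .
          qed (use i in auto)
          with frac_laplacian_diff[OF b0 fl[OF g t'(1)] fl[OF f t'(1)]]
          show "\<exists>V. frac_laplacian (2 + \<beta>) (\<lambda>x. heat_conv g t x - heat_conv f t x) V \<and> (AE x in interval_pi. V x = ?V ?h x)"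
            by (intro exI[of _ "\<lambda>x. ?V g x - ?V f x"]) simp
        qed
        also have "224 / (\<gamma> - \<beta>) * T powr ((\<gamma> - \<beta>) / 2) * \<delta> = \<epsilon> / 2"
          using K by (simp add: C_def[symmetric] K_def[symmetric] \<delta>_def)
        also have "ereal (\<epsilon> / 2) < ereal \<epsilon>" using \<epsilon> by simp
        finally show "Linf_Sobolev_norm T p (2 + \<beta>) (\<lambda>t x. heat_conv g t x - heat_conv f t x) < ereal \<epsilon>" .
      qed
    qed
  qed
qed

end
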